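(* Let $(M,\mathcal P)$ be an almost para-quaternionic manifold. i) Among all the almost complex structures $I_1^\nabla$, $\nabla\in\Delta(\mathcal P)$, on the twistor space $Z^-$ at most one is integrable. ii) Among all the almost paracomplex structures $P_1^\nabla$, $\nabla\in\Delta(\mathcal P)$, on the reflector space $Z^+$ at most one is integrable. (That is, if $\nabla,\nabla'\in\Delta(\mathcal P)$ and $I_1^\nabla$, $I_1^{\nabla'}$ are both integrable then $I_1^\nabla=I_1^{\nabla'}$, and similarly for $P_1^\nabla$, $P_1^{\nabla'}$.)
   Context: An almost para-quaternionic structure on a smooth manifold $M$ of dimension $4n$ ($n\ge1$) is a rank-3 subbundle $\mathcal P\subset \mathrm{End}(TM)$ locally spanned by a triple $(J_1,J_2,J_3)$ with $J_1^2=J_2^2=-J_3^2=\mathrm{id}$, $J_1J_2=-J_2J_1=J_3$; such a triple is called an admissible local basis. A para-quaternionic connection is a linear connection $\nabla$ on $TM$ preserving $\mathcal P$ (torsion is allowed); $\Delta(\mathcal P)$ is the set of all of them. Twistor and reflector spaces: $Z^{-}=\bigcup_p Z^-_p$ and $Z^+=\bigcup_p Z^+_p$, where $Z^-_p=\{J\in\mathcal P_p: J^2=-\mathrm{id}\}$ and $Z^+_p=\{J\in\mathcal P_p: J^2=\mathrm{id}\}$; these are fibre bundles $\pi:Z^\pm\to M$ inside $\mathcal P$. A connection $\nabla\in\Delta(\mathcal P)$ induces a connection on $\mathcal P$ preserving $Z^\pm$, hence a splitting $T_JZ^{\pm}=V_J\oplus H_J$ into the vertical space $V_J=\{W\in\mathcal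 P_{\pi(J)}: WJ+JW=0\}$ and the $\nabla$-horizontal space $H_J$. Let $v$ be the projection to $V_J$ along $H_J$ and let $X^h\in H_J$ be the horizontal lift of $X\in T_{\pi(J)}M$. The almost complex structure $I_1^\nabla$ on $Z^-$ is $I_1^{\nabla}(W)=J(vW)+(J\pi_*W)^h$ for $W\in T_JZ^-$, and the almost paracomplex structure $P_1^\nabla$ on $Z^+$ is $P_1^{\nabla}(W)=J(vW)+(J\pi_*W)^h$ for $W\in T_JZ^+$, where $J(vW)$ is composition of endomorphisms. An almost complex ($K^2=-\mathrm{id}$) or almost paracomplex ($K^2=\mathrm{id}$) structure $K$ is integrable if its Nijenhuis tensor $N_K(U,W)=[KU,KW]+K^2[U,W]-K[KU,W]-K[U,KW]$ vanishes. *)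

theory Defs
  imports "HOL-Analysis.Analysis"
begin

section \<open>Smooth maps\<close>

text \<open>Only used for open \<open>S\<close> in finite-dimensional spaces, where \<open>Ck_on k S f\<close> is the usual
  class \<open>C\<^sup>k\<close>: all iterated directional derivatives up to order \<open>k\<close> exist and are continuous.\<close>

primrec Ck_on :: "nat \<Rightarrow> 'v set \<Rightarrow> ('v::real_normed_vector \<Rightarrow> 'w::real_normed_vector) \<Rightarrow> bool" where
  "Ck_on 0 S f \<longleftrightarrow> continuous_on S f"
| "Ck_on (Suc k) S f \<longleftrightarrow>
     (\<forall>x\<in>S. f differentiable (at x)) \<and> (\<forall>v. Ck_on k S (\<lambda>x. frechet_derivative f (at x) v))"

definition smooth_on :: "'v set \<Rightarrow> ('v::real_normed_vector \<Rightarrow> 'w::real_normed_vector) \<Rightarrow> bool" where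
  "smooth_on S f \<longleftrightarrow> (\<forall>k. Ck_on k S f)"


section \<open>Manifolds\<close>

type_synonym ('a, 'e) chart = "'a set \<times> ('a \<Rightarrow> 'e)"

abbreviation cdom :: "('a, 'e) chart \<Rightarrow> 'a set" where "cdom \<equiv> fst"
abbreviation cmap :: "('a, 'e) chart \<Rightarrow> 'a \<Rightarrow> 'e" where "cmap \<equiv> snd"

definition cinv :: "('a, 'e) chart \<Rightarrow> 'e \<Rightarrow> 'a" where
  "cinv c = inv_into (cdom c) (cmap c)"

definition smooth_manifold ::
    "('a::{t2_space,second_countable_topology}, 'e::euclidean_space) chart set \<Rightarrow> bool" where
  "smooth_manifold A \<longleftrightarrow>
     (\<Union>c\<in>A. cdom c) = UNIV \<and>
     (\<forall>c\<in>A. open (cdom c) \<and> open (cmap c ` cdom c) \<and>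
             homeomorphism (cdom c) (cmap c ` cdom c) (cmap c) (cinv c)) \<and>
     (\<forall>c\<in>A. \<forall>d\<in>A. smooth_on (cmap c ` (cdom c \<inter> cdom d)) (cmap d \<circ> cinv c))"

text \<open>The remaining notions of this section depend on the atlas \<open>A\<close> only, not on a topology of the
  type \<open>'a\<close>; they are applied to a manifold \<open>M\<close> and to the total space of \<open>End(TM)\<close>.

  Tangent vectors: at each point \<open>p\<close> a chart \<open>chart_at A p\<close> around \<open>p\<close> is singled out, and the
  tangent space at \<open>p\<close> is the model space \<open>'e\<close>, a vector being identified with its components in
  \<open>chart_at A p\<close>.  Nothing is assumed about how \<open>chart_at A p\<close> varies with \<open>p\<close>; components with
  respect to a chart \<open>c\<close> are obtained by applying \<open>mdiff A (cmap c) p\<close>, the differential of \<open>c\<close>.\<close>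

definition chart_at :: "('a, 'e) chart set \<Rightarrow> 'a \<Rightarrow> ('a, 'e) chart" where
  "chart_at A p = (SOME c. c \<in> A \<and> p \<in> cdom c)"

definition mdiff ::
    "('a, 'e::euclidean_space) chart set \<Rightarrow> ('a \<Rightarrow> 'f::real_normed_vector) \<Rightarrow> 'a \<Rightarrow> 'e \<Rightarrow> 'f" where
  "mdiff A f p v =
     frechet_derivative (f \<circ> cinv (chart_at A p)) (at (cmap (chart_at A p) p)) v"

definition tangent_map ::
    "('a, 'e::euclidean_space) chart set \<Rightarrow> ('b, 'f::euclidean_space) chart set \<Rightarrow>
     ('a \<Rightarrow> 'b) \<Rightarrow> 'a \<Rightarrow> 'e \<Rightarrow> 'f" where
  "tangent_map A B f p v = mdiff A (cmap (chart_at B (f p)) \<circ> f) p v"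

definition velocity ::
    "('a, 'e::euclidean_space) chart set \<Rightarrow> (real \<Rightarrow> 'a) \<Rightarrow> real \<Rightarrow> 'e" where
  "velocity A \<gamma> t = vector_derivative (cmap (chart_at A (\<gamma> t)) \<circ> \<gamma>) (at t)"

definition mopen :: "('a, 'e::euclidean_space) chart set \<Rightarrow> 'a set \<Rightarrow> bool" where
  "mopen A U \<longleftrightarrow> (\<forall>c\<in>A. open (cmap c ` (cdom c \<inter> U)))"

definition smooth_fun ::
    "('a, 'e::euclidean_space) chart set \<Rightarrow> 'a set \<Rightarrow> ('a \<Rightarrow> real) \<Rightarrow> bool" where
  "smooth_fun A U f \<longleftrightarrow> (\<forall>c\<in>A. smooth_on (cmap c ` (cdom c \<inter> U)) (f \<circ> cinv c))"

definition field_in_chart ::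
    "('a, 'e::euclidean_space) chart set \<Rightarrow> ('a, 'e) chart \<Rightarrow> ('a \<Rightarrow> 'e) \<Rightarrow> 'e \<Rightarrow> 'e" where
  "field_in_chart A c X x = mdiff A (cmap c) (cinv c x) (X (cinv c x))"

definition smooth_field ::
    "('a, 'e::euclidean_space) chart set \<Rightarrow> 'a set \<Rightarrow> ('a \<Rightarrow> 'e) \<Rightarrow> bool" where
  "smooth_field A U X \<longleftrightarrow> (\<forall>c\<in>A. smooth_on (cmap c ` (cdom c \<inter> U)) (field_in_chart A c X))"

definition lie_bracket ::
    "('a, 'e::euclidean_space) chart set \<Rightarrow> ('a \<Rightarrow> 'e) \<Rightarrow> ('a \<Rightarrow> 'e) \<Rightarrow> 'a \<Rightarrow> 'e" where
  "lie_bracket A X Y p =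
     (let c = chart_at A p; x = cmap c p;
          X' = field_in_chart A c X; Y' = field_in_chart A c Y
      in frechet_derivative Y' (at x) (X' x) - frechet_derivative X' (at x) (Y' x))"


section \<open>Vector fields on a submanifold and the Nijenhuis tensor\<close>

text \<open>\<open>Z\<close> is an embedded submanifold of the manifold with atlas \<open>A\<close>.  Its tangent vectors are the
  velocities of smooth curves in \<open>Z\<close>, its smooth vector fields are those that extend locally to
  smooth vector fields of the ambient manifold, and their Lie bracket is the restriction of the
  bracket of any such extensions.\<close>

definition tangent_to ::
    "('a, 'e::euclidean_space) chart set \<Rightarrow> 'a set \<Rightarrow> 'a \<Rightarrow> 'e set" where
  "tangent_to A Z z =
     {velocity A \<gamma> 0 | \<gamma>. \<gamma> 0 = z \<and>
        (\<exists>e>0. \<gamma> ` {-e<..<e} \<subseteq> Z \<inter> cdom (chart_at A z) \<and>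
               smooth_on {-e<..<e} (cmap (chart_at A z) \<circ> \<gamma>))}"

definition local_extension ::
    "('a, 'e::euclidean_space) chart set \<Rightarrow> 'a set \<Rightarrow> 'a \<Rightarrow> ('a \<Rightarrow> 'e) \<Rightarrow> ('a \<Rightarrow> 'e) \<Rightarrow> bool" where
  "local_extension A Z z U U' \<longleftrightarrow>
     (\<exists>O'. mopen A O' \<and> z \<in> O' \<and> smooth_field A O' U' \<and> (\<forall>y\<in>O' \<inter> Z. U' y = U y))"

definition smooth_field_sub ::
    "('a, 'e::euclidean_space) chart set \<Rightarrow> 'a set \<Rightarrow> 'a set \<Rightarrow> ('a \<Rightarrow> 'e) \<Rightarrow> bool" where
  "smooth_field_sub A Z V U \<longleftrightarrow>
     (\<forall>z\<in>V. U z \<in> tangent_to A Z z \<and> (\<exists>U'. local_extension A Z z U U'))"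

definition lie_bracket_sub ::
    "('a, 'e::euclidean_space) chart set \<Rightarrow> 'a set \<Rightarrow> ('a \<Rightarrow> 'e) \<Rightarrow> ('a \<Rightarrow> 'e) \<Rightarrow> 'a \<Rightarrow> 'e" where
  "lie_bracket_sub A Z U W z =
     (THE b. \<exists>U' W'. local_extension A Z z U U' \<and> local_extension A Z z W W' \<and>
                     b = lie_bracket A U' W' z)"

definition nijenhuis ::
    "('a, 'e::euclidean_space) chart set \<Rightarrow> 'a set \<Rightarrow> ('a \<Rightarrow> 'e \<Rightarrow> 'e) \<Rightarrow>
     ('a \<Rightarrow> 'e) \<Rightarrow> ('a \<Rightarrow> 'e) \<Rightarrow> 'a \<Rightarrow> 'e" where
  "nijenhuis A Z K U W z =
     (let KU = (\<lambda>y. K y (U y)); KW = (\<lambda>y. K y (W y)); br = lie_bracket_sub A Z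
      in br KU KW z + K z (K z (br U W z)) - K z (br KU W z) - K z (br U KW z))"

definition integrable_structure ::
    "('a, 'e::euclidean_space) chart set \<Rightarrow> 'a set \<Rightarrow> ('a \<Rightarrow> 'e \<Rightarrow> 'e) \<Rightarrow> bool" where
  "integrable_structure A Z K \<longleftrightarrow>
     (\<forall>O' U W. mopen A O' \<and> smooth_field_sub A Z (Z \<inter> O') U \<and> smooth_field_sub A Z (Z \<inter> O') W \<longrightarrow>
        (\<forall>z\<in>Z \<inter> O'. nijenhuis A Z K U W z = 0))"


section \<open>The endomorphism bundle\<close>

text \<open>As every tangent space is \<open>real ^ 'm\<close>, an endomorphism of it is a matrix and \<open>End(TM)\<close> is the
  type \<open>'a \<times> (real ^ 'm ^ 'm)\<close>.  Its manifold structure is the one given by \<open>endo_atlas\<close>, which is in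
  general not compatible with the product topology.\<close>

definition endo_in_chart ::
    "('a, real ^ 'm) chart set \<Rightarrow> ('a, real ^ 'm) chart \<Rightarrow> 'a \<Rightarrow> real ^ 'm ^ 'm \<Rightarrow> real ^ 'm ^ 'm" where
  "endo_in_chart A c p J =
     (let D = matrix (mdiff A (cmap c) p) in D ** J ** matrix_inv D)"

definition endo_atlas ::
    "('a, real ^ 'm) chart set \<Rightarrow> ('a \<times> (real ^ 'm ^ 'm), (real ^ 'm) \<times> (real ^ 'm ^ 'm)) chart set" where
  "endo_atlas A =
     (\<lambda>c. (cdom c \<times> UNIV, \<lambda>(p, J). (cmap c p, endo_in_chart A c p J))) ` A"

definition smooth_endo ::
    "('a, real ^ 'm) chart set \<Rightarrow> 'a set \<Rightarrow> ('a \<Rightarrow> real ^ 'm ^ 'm) \<Rightarrow> bool" where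
  "smooth_endo A U \<sigma> \<longleftrightarrow>
     (\<forall>c\<in>A. smooth_on (cmap c ` (cdom c \<inter> U)) (\<lambda>x. endo_in_chart A c (cinv c x) (\<sigma> (cinv c x))))"


section \<open>Almost para-quaternionic structures and connections\<close>

definition admissible_local_basis ::
    "('a, real ^ 'm) chart set \<Rightarrow> ('a \<Rightarrow> (real ^ 'm ^ 'm) set) \<Rightarrow> 'a set \<Rightarrow>
     ('a \<Rightarrow> real ^ 'm ^ 'm) \<Rightarrow> ('a \<Rightarrow> real ^ 'm ^ 'm) \<Rightarrow> ('a \<Rightarrow> real ^ 'm ^ 'm) \<Rightarrow> bool" where
  "admissible_local_basis A P U J1 J2 J3 \<longleftrightarrow>
     smooth_endo A U J1 \<and> smooth_endo A U J2 \<and> smooth_endo A U J3 \<and>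
     (\<forall>q\<in>U. J1 q ** J1 q = mat 1 \<and> J2 q ** J2 q = mat 1 \<and> J3 q ** J3 q = - mat 1 \<and>
             J1 q ** J2 q = J3 q \<and> J2 q ** J1 q = - J3 q \<and>
             P q = span {J1 q, J2 q, J3 q})"

text \<open>The fibres of \<open>P\<close> have rank 3 because such triples are linearly independent.\<close>

definition almost_para_quaternionic ::
    "('a::topological_space, real ^ 'm) chart set \<Rightarrow> ('a \<Rightarrow> (real ^ 'm ^ 'm) set) \<Rightarrow> bool" where
  "almost_para_quaternionic A P \<longleftrightarrow>
     (\<forall>p. \<exists>U J1 J2 J3. open U \<and> p \<in> U \<and> admissible_local_basis A P U J1 J2 J3)"

text \<open>\<open>D p v Y\<close> is \<open>\<nabla>\<^sub>v Y\<close> for a tangent vector \<open>v\<close> at \<open>p\<close> and a smooth vector field \<open>Y\<close> defined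
  near \<open>p\<close>; values on other functions \<open>Y\<close> are irrelevant.\<close>

type_synonym ('a, 'e) connection = "'a \<Rightarrow> 'e \<Rightarrow> ('a \<Rightarrow> 'e) \<Rightarrow> 'e"

definition linear_connection ::
    "('a::topological_space, 'e::euclidean_space) chart set \<Rightarrow> ('a, 'e) connection \<Rightarrow> bool" where
  "linear_connection A D \<longleftrightarrow>
     (\<forall>U p Y. open U \<and> p \<in> U \<and> smooth_field A U Y \<longrightarrow> linear (\<lambda>v. D p v Y)) \<and>
     (\<forall>U p v Y Y'. open U \<and> p \<in> U \<and> smooth_field A U Y \<and> smooth_field A U Y' \<longrightarrow>
        D p v (\<lambda>q. Y q + Y' q) = D p v Y + D p v Y') \<and>
     (\<forall>U p v f Y. open U \<and> p \<in> U \<and> smooth_fun A U f \<and> smooth_field A U Y \<longrightarrow>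
        D p v (\<lambda>q. f q *\<^sub>R Y q) = mdiff A f p v *\<^sub>R Y p + f p *\<^sub>R D p v Y) \<and>
     (\<forall>U p v Y Y'. open U \<and> p \<in> U \<and> smooth_field A U Y \<and> (\<forall>q\<in>U. Y' q = Y q) \<longrightarrow>
        D p v Y' = D p v Y) \<and>
     (\<forall>U X Y. open U \<and> smooth_field A U X \<and> smooth_field A U Y \<longrightarrow>
        smooth_field A U (\<lambda>p. D p (X p) Y))"

text \<open>The induced connection on \<open>End(TM)\<close>: \<open>(\<nabla>\<^sub>v \<sigma>) Y = \<nabla>\<^sub>v (\<sigma> Y) - \<sigma> (\<nabla>\<^sub>v Y)\<close>.\<close>

definition nabla_endo ::
    "('a::topological_space, real ^ 'm) chart set \<Rightarrow> ('a, real ^ 'm) connection \<Rightarrow>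
     'a \<Rightarrow> real ^ 'm \<Rightarrow> ('a \<Rightarrow> real ^ 'm ^ 'm) \<Rightarrow> real ^ 'm ^ 'm" where
  "nabla_endo A D p v \<sigma> =
     (THE B. \<forall>U Y. open U \<and> p \<in> U \<and> smooth_field A U Y \<longrightarrow>
        B *v Y p = D p v (\<lambda>q. \<sigma> q *v Y q) - \<sigma> p *v D p v Y)"

definition local_section ::
    "('a::topological_space, real ^ 'm) chart set \<Rightarrow> ('a \<Rightarrow> (real ^ 'm ^ 'm) set) \<Rightarrow>
     'a \<Rightarrow> ('a \<Rightarrow> real ^ 'm ^ 'm) \<Rightarrow> bool" where
  "local_section A P p \<sigma> \<longleftrightarrow>
     (\<exists>U. open U \<and> p \<in> U \<and> smooth_endo A U \<sigma> \<and> (\<forall>q\<in>U. \<sigma> q \<in> P q))"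

definition para_quaternionic_connections ::
    "('a::topological_space, real ^ 'm) chart set \<Rightarrow> ('a \<Rightarrow> (real ^ 'm ^ 'm) set) \<Rightarrow>
     ('a, real ^ 'm) connection set" where
  "para_quaternionic_connections A P =
     {D. linear_connection A D \<and>
         (\<forall>p v \<sigma>. local_section A P p \<sigma> \<longrightarrow> nabla_endo A D p v \<sigma> \<in> P p)}"


section \<open>Twistor and reflector spaces\<close>

definition twistor_space :: "('a \<Rightarrow> (real ^ 'm ^ 'm) set) \<Rightarrow> ('a \<times> (real ^ 'm ^ 'm)) set" where
  "twistor_space P = {(p, J). J \<in> P p \<and> J ** J = - mat 1}"

definition reflector_space :: "('a \<Rightarrow> (real ^ 'm ^ 'm) set) \<Rightarrow> ('a \<times> (real ^ 'm ^ 'm)) set" where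
  "reflector_space P = {(p, J). J \<in> P p \<and> J ** J = mat 1}"

definition vertical_space ::
    "('a \<Rightarrow> (real ^ 'm ^ 'm) set) \<Rightarrow> 'a \<times> (real ^ 'm ^ 'm) \<Rightarrow> (real ^ 'm ^ 'm) set" where
  "vertical_space P z = (case z of (p, J) \<Rightarrow> {B \<in> P p. B ** J + J ** B = 0})"

text \<open>The identification of an endomorphism \<open>B\<close> of the tangent space at \<open>p\<close> with a vertical tangent
  vector of \<open>End(TM)\<close> at \<open>(p, J)\<close>.\<close>

definition vlift ::
    "('a, real ^ 'm) chart set \<Rightarrow> 'a \<times> (real ^ 'm ^ 'm) \<Rightarrow> real ^ 'm ^ 'm \<Rightarrow>
     (real ^ 'm) \<times> (real ^ 'm ^ 'm)" where
  "vlift A z B = (case z of (p, J) \<Rightarrow> velocity (endo_atlas A) (\<lambda>t. (p, J + t *\<^sub>R B)) 0)"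

text \<open>The horizontal space of the connection induced on \<open>P\<close>: the differentials of sections in
  directions in which they are parallel.\<close>

definition horizontal_space ::
    "('a::topological_space, real ^ 'm) chart set \<Rightarrow> ('a \<Rightarrow> (real ^ 'm ^ 'm) set) \<Rightarrow>
     ('a, real ^ 'm) connection \<Rightarrow> 'a \<times> (real ^ 'm ^ 'm) \<Rightarrow> ((real ^ 'm) \<times> (real ^ 'm ^ 'm)) set" where
  "horizontal_space A P D z = (case z of (p, J) \<Rightarrow>
     {tangent_map A (endo_atlas A) (\<lambda>q. (q, \<sigma> q)) p w | \<sigma> w.
        local_section A P p \<sigma> \<and> \<sigma> p = J \<and> nabla_endo A D p w \<sigma> = 0})"

definition proj_differential ::
    "('a, real ^ 'm) chart set \<Rightarrow> 'a \<times> (real ^ 'm ^ 'm) \<Rightarrow>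
     (real ^ 'm) \<times> (real ^ 'm ^ 'm) \<Rightarrow> real ^ 'm" where
  "proj_differential A z W = tangent_map (endo_atlas A) A fst z W"

definition hlift ::
    "('a::topological_space, real ^ 'm) chart set \<Rightarrow> ('a \<Rightarrow> (real ^ 'm ^ 'm) set) \<Rightarrow>
     ('a, real ^ 'm) connection \<Rightarrow> 'a \<times> (real ^ 'm ^ 'm) \<Rightarrow> real ^ 'm \<Rightarrow>
     (real ^ 'm) \<times> (real ^ 'm ^ 'm)" where
  "hlift A P D z X = (THE W. W \<in> horizontal_space A P D z \<and> proj_differential A z W = X)"

definition vproj ::
    "('a::topological_space, real ^ 'm) chart set \<Rightarrow> ('a \<Rightarrow> (real ^ 'm ^ 'm) set) \<Rightarrow>
     ('a, real ^ 'm) connection \<Rightarrow> 'a \<times> (real ^ 'm ^ 'm) \<Rightarrow>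
     (real ^ 'm) \<times> (real ^ 'm ^ 'm) \<Rightarrow> real ^ 'm ^ 'm" where
  "vproj A P D z W =
     (THE B. B \<in> vertical_space P z \<and> W - vlift A z B \<in> horizontal_space A P D z)"

text \<open>\<open>W \<mapsto> J (v W) + (J \<pi>\<^sub>* W)\<^sup>h\<close>; on the twistor space this is the almost complex structure
  \<open>I\<^sub>1\<close>, on the reflector space the almost paracomplex structure \<open>P\<^sub>1\<close>.\<close>

definition canonical_structure ::
    "('a::topological_space, real ^ 'm) chart set \<Rightarrow> ('a \<Rightarrow> (real ^ 'm ^ 'm) set) \<Rightarrow>
     ('a, real ^ 'm) connection \<Rightarrow> 'a \<times> (real ^ 'm ^ 'm) \<Rightarrow>
     (real ^ 'm) \<times> (real ^ 'm ^ 'm) \<Rightarrow> (real ^ 'm) \<times> (real ^ 'm ^ 'm)" where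
  "canonical_structure A P D z W =
     vlift A z (snd z ** vproj A P D z W) + hlift A P D z (snd z *v proj_differential A z W)"

end

theory Submission imports Defs begin

text \<open>
  Why it is true. Let \<open>G\<close> denote the connection form of a para-quaternionic connection in a chart:
  \<open>\<nabla>\<^sub>X Y = dY(X) + G(X) Y\<close> for fields and \<open>\<nabla>\<^sub>X \<sigma> = d\<sigma>(X) + [G(X), \<sigma>]\<close> for endomorphisms. Both bundles are
  treated at once, as the set \<open>Z\<close> of all \<open>J \<in> P\<close> with \<open>J\<^sup>2 = e\<close>, \<open>e = \<plusminus>1\<close>. At \<open>J\<close> the horizontal space
  consists of the vectors \<open>(X, - [G(X), J])\<close>, and on a tangent vector \<open>(X, C)\<close> of \<open>Z\<close> the canonical
  structure is \<open>(J X, J (C + [G(X), J]) - [G(J X), J])\<close>. Consequently the structures of two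
  connections with forms \<open>G\<close> and \<open>G'\<close> differ at \<open>J\<close> by the vertical vector
  \<open>\<delta>(X) = J [S(X), J] - [S(J X), J]\<close> with \<open>S = G' - G\<close>.

  Integrability makes \<open>\<delta>\<close> symmetric. Evaluate the Nijenhuis tensor on the horizontal lifts of two
  constant fields \<open>X\<close>, \<open>Y\<close>. The four fields that enter it are horizontal, and the projection of the
  tensor to the base is \<open>\<tau>(X) Y - \<tau>(Y) X\<close>, where \<open>\<tau>(X) = J [G(X), J] - [G(J X), J]\<close>
  (\<open>integrable_imp_symmetric\<close>); this is essentially the \<open>(0,2)\<close> part of the torsion. Subtracting the
  identities of the two connections gives \<open>\<delta>(X) Y = \<delta>(Y) X\<close>.

  Such a \<open>\<delta>\<close> vanishes for algebraic reasons. Both connections preserve \<open>P\<close>, so \<open>\<delta>\<close> takes values in the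
  elements of \<open>P\<close> that anticommute with \<open>J\<close>, and \<open>\<delta>(J X) = - J \<delta>(X)\<close>. If \<open>N = \<delta>(X)\<close> is not zero, then
  \<open>N Y = \<delta>(Y) X\<close> confines the range of \<open>N\<close> to the few vectors obtained by applying \<open>P\<close> to the fixed vector
  \<open>X\<close>, which is impossible in dimension at least \<open>4\<close>: for \<open>e = -1\<close> the endomorphism \<open>N\<close> is invertible
  (\<open>symmetric_vertical_form_zero_twistor\<close>), and for \<open>e = 1\<close> its range is still large enough after \<open>X\<close> has
  been chosen to be an eigenvector of \<open>J\<close> (\<open>symmetric_vertical_form_zero_reflector\<close>).

  The analytic work consists in reaching this computation from the definitions: vectors, fields,
  connections and definite descriptions have to be expressed in one chart, smoothness has to be
  transported between charts, and the horizontal fields have to be shown tangent to \<open>Z\<close>, so that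
  their brackets can be computed from any extensions to the ambient bundle.
\<close>

section \<open>Calculus of smooth maps\<close>

lemma Ck_on_subset: "Ck_on k T f \<Longrightarrow> S \<subseteq> T \<Longrightarrow> Ck_on k S f"
  by (induction k arbitrary: f) (auto intro: continuous_on_subset)

lemma frechet_derivative_cong_open:
  assumes "open S" "x \<in> S" "\<And>y. y \<in> S \<Longrightarrow> f y = g y"
  shows "frechet_derivative f (at x) = frechet_derivative g (at x)"
proof -
  have "(f has_derivative D) (at x) \<longleftrightarrow> (g has_derivative D) (at x)" for D
    using has_derivative_transform_within_open[OF _ assms(1,2), of f D UNIV g]
      has_derivative_transform_within_open[OF _ assms(1,2), of g D UNIV f] assms(3) by auto
  then show ?thesis by (simp add: frechet_derivative_def)
qed

lemma differentiable_cong_open: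
  assumes "open S" "x \<in> S" "\<And>y. y \<in> S \<Longrightarrow> f y = g y" "f differentiable (at x)"
  shows "g differentiable (at x)"
proof -
  obtain D where "(f has_derivative D) (at x)" using assms(4) differentiable_def by blast
  then have "(g has_derivative D) (at x)"
    by (rule has_derivative_transform_within_open[OF _ assms(1,2,3)])
  then show ?thesis by (auto simp: differentiable_def)
qed

lemma Ck_on_cong:
  assumes "open S" "Ck_on k S f" "\<And>x. x \<in> S \<Longrightarrow> f x = g x"
  shows "Ck_on k S g"
  using assms(2,3)
proof (induction k arbitrary: f g)
  case 0
  then show ?case using continuous_on_cong by force
next
  case (Suc k)
  have "g differentiable (at x)" if "x \<in> S" for x
    using differentiable_cong_open[OF assms(1) that, of f g] Suc.prems that by auto
  moreover have "Ck_on k S (\<lambda>x. frechet_derivative g (at x) v)" for v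
  proof (rule Suc.IH)
    show "Ck_on k S (\<lambda>x. frechet_derivative f (at x) v)" using Suc.prems by simp
    show "frechet_derivative f (at x) v = frechet_derivative g (at x) v" if "x \<in> S" for x
      using frechet_derivative_cong_open[OF assms(1) that, of f g] Suc.prems by simp
  qed
  ultimately show ?case by simp
qed

lemma Ck_on_continuous: "Ck_on k S f \<Longrightarrow> continuous_on S f"
  by (cases k) (auto simp: continuous_on_eq_continuous_at differentiable_imp_continuous_within
      intro!: continuous_at_imp_continuous_on)

lemma Ck_on_Suc_imp: "Ck_on (Suc k) S f \<Longrightarrow> Ck_on k S f"
proof (induction k arbitrary: f)
  case 0 then show ?case using Ck_on_continuous by (metis Ck_on.simps(1))
next
  case (Suc k)
  have "Ck_on k S (\<lambda>x. frechet_derivative f (at x) v)" for v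
    by (rule Suc.IH) (use Suc.prems in auto)
  then show ?case using Suc.prems by simp
qed

lemma Ck_on_SucI:
  assumes "open S" "\<And>x. x \<in> S \<Longrightarrow> (f has_derivative D x) (at x)"
    "\<And>v. Ck_on k S (\<lambda>x. D x v)"
  shows "Ck_on (Suc k) S f"
proof -
  have "frechet_derivative f (at x) = D x" if "x \<in> S" for x
    using assms(2)[OF that] frechet_derivative_at by metis
  then have "Ck_on k S (\<lambda>x. frechet_derivative f (at x) v)" for v
    using Ck_on_cong[OF assms(1) assms(3)[of v]] by simp
  then show ?thesis using assms(2) by (auto simp: differentiable_def)
qed

lemma Ck_on_has_derivative:
  assumes "Ck_on (Suc k) S f" "x \<in> S"
  shows "(f has_derivative frechet_derivative f (at x)) (at x)"
  using assms by (simp add: frechet_derivative_works)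

lemma Ck_on_const: "open S \<Longrightarrow> Ck_on k S (\<lambda>x. c)"
proof (induction k arbitrary: c)
  case (Suc k)
  show ?case by (rule Ck_on_SucI[where D = "\<lambda>x v. 0"]) (use Suc in auto)
qed auto

lemma Ck_on_linear_comp:
  assumes "open S" "bounded_linear L" "Ck_on k S f"
  shows "Ck_on k S (\<lambda>x. L (f x))"
  using assms(3)
proof (induction k arbitrary: f)
  case 0
  then show ?case using bounded_linear.continuous_on[OF assms(2)] by auto
next
  case (Suc k)
  show ?case
  proof (rule Ck_on_SucI[where D = "\<lambda>x v. L (frechet_derivative f (at x) v)"])
    show "((\<lambda>x. L (f x)) has_derivative (\<lambda>v. L (frechet_derivative f (at x) v))) (at x)" if "x \<in> S" for x
      using bounded_linear.has_derivative[OF assms(2) Ck_on_has_derivative[OF Suc.prems that]] .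
  qed (use assms Suc in auto)
qed

lemma Ck_on_add:
  assumes "open S" "Ck_on k S f" "Ck_on k S g"
  shows "Ck_on k S (\<lambda>x. f x + g x)"
  using assms(2,3)
proof (induction k arbitrary: f g)
  case 0
  then show ?case by (auto intro: continuous_on_add)
next
  case (Suc k)
  show ?case
  proof (rule Ck_on_SucI[where D = "\<lambda>x v. frechet_derivative f (at x) v + frechet_derivative g (at x) v"])
    show "((\<lambda>x. f x + g x) has_derivative
        (\<lambda>v. frechet_derivative f (at x) v + frechet_derivative g (at x) v)) (at x)" if "x \<in> S" for x
      by (intro has_derivative_add Ck_on_has_derivative[OF Suc.prems(1) that]
          Ck_on_has_derivative[OF Suc.prems(2) that])
  qed (use assms Suc in auto)
qed

lemma Ck_on_bilinear:
  assumes "open S" "bounded_bilinear B" "Ck_on k S f" "Ck_on k S g"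
  shows "Ck_on k S (\<lambda>x. B (f x) (g x))"
  using assms(3,4)
proof (induction k arbitrary: f g)
  case 0
  then show ?case using bounded_bilinear.continuous_on[OF assms(2)] by auto
next
  case (Suc k)
  let ?f = "\<lambda>x. frechet_derivative f (at x)" and ?g = "\<lambda>x. frechet_derivative g (at x)"
  show ?case
  proof (rule Ck_on_SucI[where D = "\<lambda>x v. B (f x) (?g x v) + B (?f x v) (g x)"])
    show "((\<lambda>x. B (f x) (g x)) has_derivative (\<lambda>v. B (f x) (?g x v) + B (?f x v) (g x))) (at x)"
      if "x \<in> S" for x
      by (rule bounded_bilinear.FDERIV[OF assms(2) Ck_on_has_derivative[OF Suc.prems(1) that]
            Ck_on_has_derivative[OF Suc.prems(2) that]])
    show "Ck_on k S (\<lambda>x. B (f x) (?g x v) + B (?f x v) (g x))" for v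
    proof (rule Ck_on_add[OF assms(1)])
      show "Ck_on k S (\<lambda>x. B (f x) (?g x v))"
        by (rule Suc.IH) (use Suc.prems Ck_on_Suc_imp in auto)
      show "Ck_on k S (\<lambda>x. B (?f x v) (g x))"
        by (rule Suc.IH) (use Suc.prems Ck_on_Suc_imp in auto)
    qed
  qed (use assms in auto)
qed

lemma Ck_on_sum:
  assumes "open S" "finite I" "\<And>i. i \<in> I \<Longrightarrow> Ck_on k S (f i)"
  shows "Ck_on k S (\<lambda>x. \<Sum>i\<in>I. f i x)"
  using assms(2,3)
  by (induction I rule: finite_induct) (auto intro: Ck_on_const Ck_on_add assms(1))

lemma linear_eq_sum_Basis:
  fixes h :: "'w::euclidean_space \<Rightarrow> 'u::real_vector"
  assumes "linear h"
  shows "h w = (\<Sum>b\<in>Basis. (w \<bullet> b) *\<^sub>R h b)"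
proof -
  have "h w = h (\<Sum>b\<in>Basis. (w \<bullet> b) *\<^sub>R b)"
    by (simp add: euclidean_representation)
  also have "\<dots> = (\<Sum>b\<in>Basis. (w \<bullet> b) *\<^sub>R h b)"
    by (simp add: linear_sum[OF assms] linear_cmul[OF assms])
  finally show ?thesis .
qed

text \<open>The derivative of a composition is a sum over a basis of products of derivatives of the two
  maps, so that the class of the composition follows by induction from the bilinear case.\<close>

lemma Ck_on_compose:
  fixes g :: "'w::euclidean_space \<Rightarrow> 'u::real_normed_vector"
  assumes "open S" "open T" "f ` S \<subseteq> T" "Ck_on k S f" "Ck_on k T g"
  shows "Ck_on k S (\<lambda>x. g (f x))"
  using assms(4,5)
proof (induction k arbitrary: g)
  case 0
  then show ?case
    using continuous_on_compose[of S f g] continuous_on_subset[of T g "f ` S"] assms(3)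
    by (auto simp: comp_def)
next
  case (Suc k)
  let ?f = "\<lambda>x. frechet_derivative f (at x)" and ?g = "\<lambda>y. frechet_derivative g (at y)"
  have lin: "?g y w = (\<Sum>b\<in>Basis. (w \<bullet> b) *\<^sub>R ?g y b)" if "y \<in> T" for y w
  proof -
    have "linear (?g y)"
      using Ck_on_has_derivative[OF Suc.prems(2) that] has_derivative_linear by blast
    then show ?thesis by (rule linear_eq_sum_Basis)
  qed
  have ck: "Ck_on k S f" using Suc.prems Ck_on_Suc_imp by blast
  show ?case
  proof (rule Ck_on_SucI[where D = "\<lambda>x v. \<Sum>b\<in>Basis. (?f x v \<bullet> b) *\<^sub>R ?g (f x) b"])
    show "((\<lambda>x. g (f x)) has_derivative (\<lambda>v. \<Sum>b\<in>Basis. (?f x v \<bullet> b) *\<^sub>R ?g (f x) b)) (at x)"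
      if x: "x \<in> S" for x
    proof -
      have fx: "f x \<in> T" using x assms(3) by auto
      have "((\<lambda>x. g (f x)) has_derivative (\<lambda>v. ?g (f x) (?f x v))) (at x)"
        using diff_chain_at[OF Ck_on_has_derivative[OF Suc.prems(1) x]
            Ck_on_has_derivative[OF Suc.prems(2) fx]] by (simp add: comp_def)
      moreover have "(\<lambda>v. ?g (f x) (?f x v)) = (\<lambda>v. \<Sum>b\<in>Basis. (?f x v \<bullet> b) *\<^sub>R ?g (f x) b)"
        by (rule ext, rule lin[OF fx])
      ultimately show ?thesis by simp
    qed
    show "Ck_on k S (\<lambda>x. \<Sum>b\<in>Basis. (?f x v \<bullet> b) *\<^sub>R ?g (f x) b)" for v
    proof (intro Ck_on_sum assms(1) Ck_on_bilinear[OF _ bounded_bilinear_scaleR])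
      show "Ck_on k S (\<lambda>x. ?g (f x) b)" for b
        by (rule Suc.IH) (use ck Suc.prems in auto)
      show "Ck_on k S (\<lambda>x. ?f x v \<bullet> b)" for b
        by (rule Ck_on_linear_comp[OF assms(1) bounded_linear_inner_left]) (use Suc.prems in auto)
    qed auto
  qed (use assms in auto)
qed

lemma smooth_on_subset: "smooth_on T f \<Longrightarrow> S \<subseteq> T \<Longrightarrow> smooth_on S f"
  by (auto simp: smooth_on_def intro: Ck_on_subset)

lemma smooth_on_cong:
  "open S \<Longrightarrow> smooth_on S f \<Longrightarrow> (\<And>x. x \<in> S \<Longrightarrow> f x = g x) \<Longrightarrow> smooth_on S g"
  unfolding smooth_on_def using Ck_on_cong by blast

lemma smooth_on_continuous: "smooth_on S f \<Longrightarrow> continuous_on S f"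
  by (auto simp: smooth_on_def intro: Ck_on_continuous)

lemma smooth_on_has_derivative:
  "smooth_on S f \<Longrightarrow> x \<in> S \<Longrightarrow> (f has_derivative frechet_derivative f (at x)) (at x)"
  unfolding smooth_on_def using Ck_on_has_derivative by blast

lemma smooth_on_differentiable: "smooth_on S f \<Longrightarrow> x \<in> S \<Longrightarrow> f differentiable (at x)"
  using smooth_on_has_derivative differentiable_def by blast

lemma smooth_on_const: "open S \<Longrightarrow> smooth_on S (\<lambda>x. c)"
  by (simp add: smooth_on_def Ck_on_const)

lemma smooth_on_linear_comp:
  "open S \<Longrightarrow> bounded_linear L \<Longrightarrow> smooth_on S f \<Longrightarrow> smooth_on S (\<lambda>x. L (f x))"
  by (simp add: smooth_on_def Ck_on_linear_comp)

lemma smooth_on_linear: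
  assumes "open S" "bounded_linear L" shows "smooth_on S L"
  unfolding smooth_on_def
proof
  fix k show "Ck_on k S L"
  proof (cases k)
    case 0 then show ?thesis
      using linear_continuous_on[OF assms(2)] by simp
  next
    case (Suc l)
    show ?thesis unfolding Suc
      by (rule Ck_on_SucI[where D = "\<lambda>x. L"])
        (auto intro!: assms Ck_on_const bounded_linear_imp_has_derivative)
  qed
qed

lemma smooth_on_id: "open S \<Longrightarrow> smooth_on S (\<lambda>x. x)"
  by (rule smooth_on_linear) (auto intro: bounded_linear_ident)

lemma smooth_on_add:
  "open S \<Longrightarrow> smooth_on S f \<Longrightarrow> smooth_on S g \<Longrightarrow> smooth_on S (\<lambda>x. f x + g x)"
  by (simp add: smooth_on_def Ck_on_add)

lemma smooth_on_minus: "open S \<Longrightarrow> smooth_on S f \<Longrightarrow> smooth_on S (\<lambda>x. - f x)"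
  using smooth_on_linear_comp[OF _ bounded_linear_minus[OF bounded_linear_ident]] by auto

lemma smooth_on_diff:
  "open S \<Longrightarrow> smooth_on S f \<Longrightarrow> smooth_on S g \<Longrightarrow> smooth_on S (\<lambda>x. f x - g x)"
  using smooth_on_add[of S f "\<lambda>x. - g x"] smooth_on_minus[of S g] by simp

lemma smooth_on_bilinear:
  "open S \<Longrightarrow> bounded_bilinear B \<Longrightarrow> smooth_on S f \<Longrightarrow> smooth_on S g \<Longrightarrow>
    smooth_on S (\<lambda>x. B (f x) (g x))"
  by (simp add: smooth_on_def Ck_on_bilinear)

lemmas smooth_on_scaleR = smooth_on_bilinear[OF _ bounded_bilinear_scaleR]
lemmas smooth_on_mult = smooth_on_bilinear[OF _ bounded_bilinear_mult]

lemma smooth_on_sum: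
  "open S \<Longrightarrow> finite I \<Longrightarrow> (\<And>i. i \<in> I \<Longrightarrow> smooth_on S (f i)) \<Longrightarrow> smooth_on S (\<lambda>x. \<Sum>i\<in>I. f i x)"
  by (simp add: smooth_on_def Ck_on_sum)

lemma smooth_on_compose:
  fixes g :: "'w::euclidean_space \<Rightarrow> 'u::real_normed_vector"
  shows "open S \<Longrightarrow> open T \<Longrightarrow> f ` S \<subseteq> T \<Longrightarrow> smooth_on S f \<Longrightarrow> smooth_on T g \<Longrightarrow>
    smooth_on S (\<lambda>x. g (f x))"
  unfolding smooth_on_def using Ck_on_compose by blast

lemma smooth_on_Pair:
  assumes "open S" "smooth_on S f" "smooth_on S g"
  shows "smooth_on S (\<lambda>x. (f x, g x))"
proof -
  have "bounded_linear (\<lambda>a. (a, 0))" "bounded_linear (\<lambda>b. (0, b))"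
    by (auto intro!: bounded_linear_Pair bounded_linear_ident bounded_linear_zero)
  then have "smooth_on S (\<lambda>x. (f x, 0) + (0, g x))"
    using assms by (intro smooth_on_add smooth_on_linear_comp[where L = "\<lambda>a. (a, 0)"]
        smooth_on_linear_comp[where L = "\<lambda>a. (0, a)"])
  then show ?thesis by simp
qed

lemma smooth_on_derivative:
  "smooth_on S f \<Longrightarrow> smooth_on S (\<lambda>x. frechet_derivative f (at x) v)"
  unfolding smooth_on_def using Ck_on.simps(2) by blast

lemma smooth_on_linear_family:
  fixes G :: "'v::real_normed_vector \<Rightarrow> 'w::euclidean_space \<Rightarrow> 'u::real_normed_vector"
  assumes "open S" "\<And>x. x \<in> S \<Longrightarrow> linear (G x)" "\<And>v. smooth_on S (\<lambda>x. G x v)" "smooth_on S g"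
  shows "smooth_on S (\<lambda>x. G x (g x))"
proof (rule smooth_on_cong[OF assms(1)])
  show "smooth_on S (\<lambda>x. \<Sum>b\<in>Basis. (g x \<bullet> b) *\<^sub>R G x b)"
    by (intro smooth_on_sum smooth_on_scaleR smooth_on_linear_comp[OF _ bounded_linear_inner_left]
        assms) auto
  show "(\<Sum>b\<in>Basis. (g x \<bullet> b) *\<^sub>R G x b) = G x (g x)" if "x \<in> S" for x
    by (rule linear_eq_sum_Basis[OF assms(2)[OF that], symmetric])
qed

lemma smooth_on_inverse: "smooth_on {x::real. x \<noteq> 0} inverse"
proof -
  have op: "open {x::real. x \<noteq> 0}" by (simp add: open_delete[of UNIV, simplified] open_Collect_neq)
  have "Ck_on k {x::real. x \<noteq> 0} inverse" for k
  proof (induction k)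
    case 0
    then show ?case by (auto intro!: continuous_intros)
  next
    case (Suc k)
    show ?case
    proof (rule Ck_on_SucI[OF op, where D = "\<lambda>x v. (- v) * (inverse x * inverse x)"])
      show "Ck_on k {x. x \<noteq> 0} (\<lambda>x::real. (- v) * (inverse x * inverse x))" for v
        by (intro Ck_on_bilinear[OF op bounded_bilinear_mult] Suc Ck_on_const op)
      show "(inverse has_derivative (\<lambda>v. (- v) * (inverse x * inverse x))) (at x)"
        if "x \<in> {x. x \<noteq> 0}" for x :: real
        using has_derivative_inverse'[of x UNIV] that
        by (auto simp: algebra_simps)
    qed
  qed
  then show ?thesis by (simp add: smooth_on_def)
qed

lemma smooth_on_divide:
  fixes f g :: "'v::real_normed_vector \<Rightarrow> real"
  assumes "open S" "smooth_on S f" "smooth_on S g" "\<And>x. x \<in> S \<Longrightarrow> g x \<noteq> 0"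
  shows "smooth_on S (\<lambda>x. f x / g x)"
proof -
  have "smooth_on S (\<lambda>x. inverse (g x))"
    by (rule smooth_on_compose[OF assms(1) _ _ assms(3) smooth_on_inverse])
      (use assms in \<open>auto simp: open_Collect_neq\<close>)
  then show ?thesis using smooth_on_mult[OF assms(1,2)] by (simp add: divide_inverse)
qed

section \<open>Tangent vectors in charts\<close>

lemma has_derivative_cong_nhds:
  assumes "(f has_derivative D) (at x)" "\<forall>\<^sub>F y in nhds x. f y = g y"
  shows "(g has_derivative D) (at x)"
proof -
  obtain S where "open S" "x \<in> S" "\<And>y. y \<in> S \<Longrightarrow> f y = g y"
    using assms(2) unfolding eventually_nhds by blast
  then show ?thesis using has_derivative_transform_within_open[OF assms(1)] by blast
qed

lemma has_vector_derivative_cong_nhds: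
  "(f has_vector_derivative w) (at s) \<Longrightarrow> \<forall>\<^sub>F t in nhds s. f t = g t \<Longrightarrow>
    (g has_vector_derivative w) (at s)"
  unfolding has_vector_derivative_def by (rule has_derivative_cong_nhds)

lemma has_vector_derivative_chain:
  assumes "(\<gamma> has_vector_derivative w) (at s)" "(f has_derivative D) (at x)" "\<gamma> s = x"
  shows "((f \<circ> \<gamma>) has_vector_derivative D w) (at s)"
  by (rule vector_derivative_diff_chain_within[OF assms(1)])
    (simp add: has_derivative_at_withinI assms)

text \<open>What the calculus of tangent vectors needs from an atlas; no topology on the type of points is
  involved, so that the same lemmas serve a manifold and the total space of its endomorphism bundle.\<close>

locale smooth_atlas =
  fixes A :: "('a, 'e::euclidean_space) chart set"
  assumes cover: "(\<Union>c\<in>A. cdom c) = UNIV"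
    and inj_chart: "c \<in> A \<Longrightarrow> inj_on (cmap c) (cdom c)"
    and open_overlap: "c \<in> A \<Longrightarrow> d \<in> A \<Longrightarrow> open (cmap c ` (cdom c \<inter> cdom d))"
    and smooth_transition:
      "c \<in> A \<Longrightarrow> d \<in> A \<Longrightarrow> smooth_on (cmap c ` (cdom c \<inter> cdom d)) (cmap d \<circ> cinv c)"

text \<open>The tangent vector at \<open>p\<close> with components \<open>w\<close> in the chart \<open>c\<close>: the inverse of
  \<open>mdiff A (cmap c) p\<close>.\<close>

definition tangent_vector ::
    "('a, 'e::euclidean_space) chart set \<Rightarrow> ('a, 'e) chart \<Rightarrow> 'a \<Rightarrow> 'e \<Rightarrow> 'e" where
  "tangent_vector A c p w =
     frechet_derivative (cmap (chart_at A p) \<circ> cinv c) (at (cmap c p)) w"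

context smooth_atlas
begin

lemma chart_at_in: "chart_at A p \<in> A" and in_chart_at: "p \<in> cdom (chart_at A p)"
proof -
  have "\<exists>c. c \<in> A \<and> p \<in> cdom c" using cover by blast
  from someI_ex[OF this] show "chart_at A p \<in> A" "p \<in> cdom (chart_at A p)"
    by (simp_all add: chart_at_def)
qed

lemma cinv_cmap: "c \<in> A \<Longrightarrow> p \<in> cdom c \<Longrightarrow> cinv c (cmap c p) = p"
  by (simp add: cinv_def inj_chart inv_into_f_f)

lemma cinv_in: "x \<in> cmap c ` cdom c \<Longrightarrow> cinv c x \<in> cdom c"
  by (simp add: cinv_def inv_into_into)

lemma cmap_cinv: "x \<in> cmap c ` cdom c \<Longrightarrow> cmap c (cinv c x) = x"
  by (simp add: cinv_def f_inv_into_f)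

lemma open_chart: "c \<in> A \<Longrightarrow> open (cmap c ` cdom c)"
  using open_overlap[of c c] by simp

lemma transition_has_derivative:
  assumes "c \<in> A" "d \<in> A" "p \<in> cdom c" "p \<in> cdom d"
  shows "((cmap d \<circ> cinv c) has_derivative frechet_derivative (cmap d \<circ> cinv c) (at (cmap c p)))
    (at (cmap c p))"
  using smooth_on_has_derivative[OF smooth_transition[OF assms(1,2)]] assms by auto

text \<open>The chart chosen at \<open>p\<close> enters only through a transition map, whose derivative turns the
  components in that chart into the components in \<open>c\<close>. So differentials can be computed in any chart.\<close>

lemma mdiff_in_chart:
  assumes "c \<in> A" "p \<in> cdom c" "((f \<circ> cinv c) has_derivative D) (at (cmap c p))"
  shows "mdiff A f p v = D (mdiff A (cmap c) p v)"
proof -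
  let ?d = "chart_at A p"
  let ?T = "frechet_derivative (cmap c \<circ> cinv ?d) (at (cmap ?d p))"
  note d = chart_at_in[of p] in_chart_at[of p]
  have T: "((cmap c \<circ> cinv ?d) has_derivative ?T) (at (cmap ?d p))"
    using transition_has_derivative d assms by blast
  have "((f \<circ> cinv c) \<circ> (cmap c \<circ> cinv ?d) has_derivative D \<circ> ?T) (at (cmap ?d p))"
    using diff_chain_at[OF T] assms d by (simp add: cinv_cmap)
  then have "(f \<circ> cinv ?d has_derivative D \<circ> ?T) (at (cmap ?d p))"
  proof (rule has_derivative_transform_within_open)
    show "open (cmap ?d ` (cdom ?d \<inter> cdom c))" using open_overlap d assms by blast
    show "cmap ?d p \<in> cmap ?d ` (cdom ?d \<inter> cdom c)" using d assms by blast
    show "(f \<circ> cinv c \<circ> (cmap c \<circ> cinv ?d)) x = (f \<circ> cinv ?d) x"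
      if "x \<in> cmap ?d ` (cdom ?d \<inter> cdom c)" for x
      using that d assms by (auto simp: cinv_cmap)
  qed
  then have "frechet_derivative (f \<circ> cinv ?d) (at (cmap ?d p)) = D \<circ> ?T"
    using frechet_derivative_at by metis
  then show ?thesis by (simp add: mdiff_def)
qed

lemma mdiff_change_chart:
  assumes "c \<in> A" "d \<in> A" "p \<in> cdom c" "p \<in> cdom d"
  shows "mdiff A (cmap d) p v =
    frechet_derivative (cmap d \<circ> cinv c) (at (cmap c p)) (mdiff A (cmap c) p v)"
  by (rule mdiff_in_chart[OF assms(1,3) transition_has_derivative[OF assms]])

lemma mdiff_chart_at: "mdiff A (cmap (chart_at A p)) p v = v"
proof -
  let ?d = "chart_at A p"
  note d = chart_at_in[of p] in_chart_at[of p]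
  have "(cmap ?d \<circ> cinv ?d has_derivative (\<lambda>x. x)) (at (cmap ?d p))"
    by (rule has_derivative_transform_within_open[OF has_derivative_ident, of "cmap ?d ` cdom ?d"])
      (auto simp: cinv_cmap[OF d(1)] intro: open_chart[OF d(1)] d(2))
  then have "frechet_derivative (cmap ?d \<circ> cinv ?d) (at (cmap ?d p)) = (\<lambda>x. x)"
    using frechet_derivative_at by metis
  then show ?thesis by (simp add: mdiff_def)
qed

lemma linear_mdiff_chart:
  assumes "c \<in> A" "p \<in> cdom c" shows "linear (mdiff A (cmap c) p)"
proof -
  have "mdiff A (cmap c) p = frechet_derivative (cmap c \<circ> cinv (chart_at A p)) (at (cmap (chart_at A p) p))"
    by (simp add: mdiff_def fun_eq_iff)
  then show ?thesis
    using has_derivative_linear[OF transition_has_derivative[OF chart_at_in assms(1) in_chart_at assms(2)]]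
    by simp
qed

lemma linear_tangent_vector:
  assumes "c \<in> A" "p \<in> cdom c" shows "linear (tangent_vector A c p)"
proof -
  have "tangent_vector A c p = frechet_derivative (cmap (chart_at A p) \<circ> cinv c) (at (cmap c p))"
    by (simp add: tangent_vector_def fun_eq_iff)
  then show ?thesis
    using has_derivative_linear[OF transition_has_derivative[OF assms(1) chart_at_in assms(2) in_chart_at]]
    by simp
qed

lemma tangent_vector_mdiff:
  assumes "c \<in> A" "p \<in> cdom c" shows "tangent_vector A c p (mdiff A (cmap c) p v) = v"
  unfolding tangent_vector_def
  using mdiff_change_chart[OF assms(1) chart_at_in assms(2) in_chart_at, of v] mdiff_chart_at by simp

lemma mdiff_tangent_vector:
  assumes "c \<in> A" "p \<in> cdom c" shows "mdiff A (cmap c) p (tangent_vector A c p w) = w"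
proof -
  have "inj (mdiff A (cmap c) p)"
    by (metis assms injI tangent_vector_mdiff)
  then have "surj (mdiff A (cmap c) p)"
    using linear_injective_imp_surjective linear_mdiff_chart assms by blast
  then obtain v where "w = mdiff A (cmap c) p v" by blast
  then show ?thesis using tangent_vector_mdiff assms by simp
qed

lemma mdiff_chart_eq_iff:
  assumes "c \<in> A" "p \<in> cdom c"
  shows "mdiff A (cmap c) p v = mdiff A (cmap c) p w \<longleftrightarrow> v = w"
  by (metis assms tangent_vector_mdiff)

lemma transition_derivative_inverse:
  assumes "c \<in> A" "d \<in> A" "p \<in> cdom c" "p \<in> cdom d"
  shows "frechet_derivative (cmap d \<circ> cinv c) (at (cmap c p)) w =
    mdiff A (cmap d) p (tangent_vector A c p w)"
  using mdiff_change_chart[OF assms] mdiff_tangent_vector[OF assms(1,3)] by simp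

section \<open>Open sets and smooth fields\<close>

lemma mopenI:
  assumes "c \<in> A" "U \<subseteq> cdom c" "open (cmap c ` U)"
  shows "mopen A U"
  unfolding mopen_def
proof
  fix d assume d: "d \<in> A"
  let ?T = "cmap d ` (cdom d \<inter> cdom c)"
  have "cmap d ` (cdom d \<inter> U) = ?T \<inter> (cmap c \<circ> cinv d) -` (cmap c ` U)" (is "?L = ?R")
  proof
    show "?L \<subseteq> ?R" using assms(2) d by (auto simp: cinv_cmap)
    show "?R \<subseteq> ?L"
    proof
      fix y assume "y \<in> ?R"
      then obtain p q where p: "p \<in> cdom d" "p \<in> cdom c" "y = cmap d p" "q \<in> U" "cmap c p = cmap c q"
        using d by (auto simp: cinv_cmap)
      then have "p = q" using inj_chart[OF assms(1)] assms(2) by (auto dest: inj_onD)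
      then show "y \<in> ?L" using p by auto
    qed
  qed
  moreover have "open ?R"
    by (rule continuous_open_preimage[OF smooth_on_continuous[OF smooth_transition]])
      (use d assms open_overlap in auto)
  ultimately show "open (cmap d ` (cdom d \<inter> U))" by simp
qed

text \<open>Smoothness on a subset of one chart domain passes to all charts, because expressions in another
  chart are compositions with a transition map; for fields and endomorphisms there is in addition a
  Jacobian factor, which is smooth as well.\<close>

lemma smooth_on_change_chart:
  assumes "c \<in> A" "d \<in> A" "U \<subseteq> cdom c" "open (cmap c ` U)" "smooth_on (cmap c ` U) g"
  shows "smooth_on (cmap d ` (cdom d \<inter> U)) (\<lambda>y. g (cmap c (cinv d y)))"
proof (rule smooth_on_compose[OF _ assms(4) _ _ assms(5)])
  show "open (cmap d ` (cdom d \<inter> U))" using mopenI assms mopen_def by blast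
  show "(\<lambda>y. cmap c (cinv d y)) ` (cmap d ` (cdom d \<inter> U)) \<subseteq> cmap c ` U"
    using assms by (auto simp: cinv_cmap)
  show "smooth_on (cmap d ` (cdom d \<inter> U)) (\<lambda>y. cmap c (cinv d y))"
    using smooth_on_subset[OF smooth_transition[OF assms(2,1)], of "cmap d ` (cdom d \<inter> U)"]
      image_mono[of "cdom d \<inter> U" "cdom d \<inter> cdom c" "cmap d"] assms(3)
    by (simp add: comp_def le_infI2)
qed

lemma smooth_fieldI:
  assumes "c \<in> A" "U \<subseteq> cdom c" "open (cmap c ` U)" "smooth_on (cmap c ` U) (field_in_chart A c X)"
  shows "smooth_field A U X"
  unfolding smooth_field_def
proof
  fix d assume d: "d \<in> A"
  let ?V = "cmap d ` (cdom d \<inter> U)"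
  let ?D = "\<lambda>y. frechet_derivative (cmap d \<circ> cinv c) (at (cmap c (cinv d y)))
    (field_in_chart A c X (cmap c (cinv d y)))"
  have op: "open ?V" using mopenI assms d mopen_def by blast
  show "smooth_on ?V (field_in_chart A d X)"
  proof (rule smooth_on_cong[OF op])
    show "smooth_on ?V ?D"
    proof (rule smooth_on_linear_family[OF op, where G =
          "\<lambda>y. frechet_derivative (cmap d \<circ> cinv c) (at (cmap c (cinv d y)))"
          and g = "\<lambda>y. field_in_chart A c X (cmap c (cinv d y))"])
      show "linear (frechet_derivative (cmap d \<circ> cinv c) (at (cmap c (cinv d y))))" if "y \<in> ?V" for y
      proof -
        from that obtain q where "q \<in> cdom d" "q \<in> U" "y = cmap d q" by blast
        then show ?thesis
          using has_derivative_linear[OF transition_has_derivative[OF assms(1) d, of q]] d assms(2)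
          by (simp add: cinv_cmap subset_iff)
      qed
      show "smooth_on ?V (\<lambda>y. field_in_chart A c X (cmap c (cinv d y)))"
        by (rule smooth_on_change_chart[OF assms(1) d assms(2,3,4)])
      have "smooth_on (cmap c ` (U \<inter> cdom d)) (\<lambda>x. frechet_derivative (cmap d \<circ> cinv c) (at x) v)" for v
        by (rule smooth_on_derivative[OF smooth_on_subset[OF smooth_transition[OF assms(1) d]]])
          (use assms(2) in auto)
      moreover have "open (cmap c ` (U \<inter> cdom d))"
      proof -
        have "mopen A (U \<inter> cdom d)"
        proof (rule mopenI[OF d])
          show "open (cmap d ` (U \<inter> cdom d))" using op by (simp add: Int_commute)
        qed auto
        moreover have "cdom c \<inter> (U \<inter> cdom d) = U \<inter> cdom d" using assms(2) by auto
        ultimately show ?thesis unfolding mopen_def using assms(1) by metis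
      qed
      ultimately have "smooth_on (cmap d ` (cdom d \<inter> (U \<inter> cdom d)))
          (\<lambda>y. frechet_derivative (cmap d \<circ> cinv c) (at (cmap c (cinv d y))) v)" for v
        by (intro smooth_on_change_chart[OF assms(1) d,
              of "U \<inter> cdom d" "\<lambda>x. frechet_derivative (cmap d \<circ> cinv c) (at x) v"]) (use assms(2) in auto)
      then show "smooth_on ?V (\<lambda>y. frechet_derivative (cmap d \<circ> cinv c) (at (cmap c (cinv d y))) v)" for v
        by (simp add: Int_ac)
    qed
    show "?D y = field_in_chart A d X y" if "y \<in> ?V" for y
      using that assms d mdiff_change_chart[OF assms(1) d]
      by (auto simp: field_in_chart_def cinv_cmap)
  qed
qed

lemma smooth_funI:
  assumes "c \<in> A" "U \<subseteq> cdom c" "open (cmap c ` U)" "smooth_on (cmap c ` U) (f \<circ> cinv c)"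
  shows "smooth_fun A U f"
  unfolding smooth_fun_def
proof
  fix d assume d: "d \<in> A"
  show "smooth_on (cmap d ` (cdom d \<inter> U)) (f \<circ> cinv d)"
    by (rule smooth_on_cong[OF _ smooth_on_change_chart[OF assms(1) d assms(2,3,4)]])
      (use mopenI[OF assms(1-3)] d assms in \<open>auto simp: mopen_def cinv_cmap\<close>)
qed

lemma field_in_chart_cmap:
  "c \<in> A \<Longrightarrow> p \<in> cdom c \<Longrightarrow> field_in_chart A c X (cmap c p) = mdiff A (cmap c) p (X p)"
  by (simp add: field_in_chart_def cinv_cmap)

section \<open>Curves and differentials\<close>

lemma velocity_in_chart:
  assumes "c \<in> A" "\<forall>\<^sub>F t in nhds s. \<gamma> t \<in> cdom c"
    "((cmap c \<circ> \<gamma>) has_vector_derivative w) (at s)"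
  shows "velocity A \<gamma> s = tangent_vector A c (\<gamma> s) w"
proof -
  let ?d = "chart_at A (\<gamma> s)"
  let ?T = "frechet_derivative (cmap ?d \<circ> cinv c) (at (cmap c (\<gamma> s)))"
  have s: "\<gamma> s \<in> cdom c" using assms(2) eventually_nhds_x_imp_x by fastforce
  have T: "((cmap ?d \<circ> cinv c) has_derivative ?T) (at (cmap c (\<gamma> s)))"
    using transition_has_derivative[OF assms(1) chart_at_in s in_chart_at] .
  have "(((cmap ?d \<circ> cinv c) \<circ> (cmap c \<circ> \<gamma>)) has_vector_derivative ?T w) (at s)"
    by (rule has_vector_derivative_chain[OF assms(3) T]) simp
  moreover have "\<forall>\<^sub>F t in nhds s. ((cmap ?d \<circ> cinv c) \<circ> (cmap c \<circ> \<gamma>)) t = (cmap ?d \<circ> \<gamma>) t"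
    using assms(2) by eventually_elim (use assms(1) in \<open>simp add: cinv_cmap\<close>)
  ultimately have "((cmap ?d \<circ> \<gamma>) has_vector_derivative ?T w) (at s)"
    by (rule has_vector_derivative_cong_nhds)
  then show ?thesis
    by (simp add: velocity_def tangent_vector_def vector_derivative_at)
qed

text \<open>A curve in the chart \<open>c\<close> need not stay in the chart that is chosen at \<open>z\<close>; it does so on a
  smaller interval.\<close>

lemma tangent_toI:
  assumes "c \<in> A" "z \<in> cdom c" "e > 0" "smooth_on {-e<..<e} \<beta>" "\<beta> 0 = cmap c z"
    "\<And>t. t \<in> {-e<..<e} \<Longrightarrow> \<beta> t \<in> cmap c ` cdom c \<and> cinv c (\<beta> t) \<in> Z"
    "(\<beta> has_vector_derivative mdiff A (cmap c) z w) (at 0)"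
  shows "w \<in> tangent_to A Z z"
proof -
  let ?d = "chart_at A z"
  define \<gamma> where "\<gamma> t = cinv c (\<beta> t)" for t
  have g0: "\<gamma> 0 = z" by (simp add: \<gamma>_def assms cinv_cmap)
  have cont: "continuous_on {-e<..<e} \<beta>" using assms(4) by (rule smooth_on_continuous)
  let ?T = "cmap c ` (cdom c \<inter> cdom ?d)"
  have "open ({-e<..<e} \<inter> \<beta> -` ?T)"
    by (rule continuous_open_preimage[OF cont]) (auto intro: open_overlap assms(1) chart_at_in)
  moreover have "0 \<in> {-e<..<e} \<inter> \<beta> -` ?T"
    using assms(2,3,5) in_chart_at by auto
  ultimately obtain e' where e': "e' > 0" "ball 0 e' \<subseteq> {-e<..<e} \<inter> \<beta> -` ?T"
    by (meson open_contains_ball)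
  have ball: "ball 0 e' = {-e'<..<e'}" by (auto simp: dist_real_def)
  have sub: "{-e'<..<e'} \<subseteq> {-e<..<e}" "\<beta> ` {-e'<..<e'} \<subseteq> ?T" using e'(2) unfolding ball by auto
  have "smooth_on {-e'<..<e'} (\<lambda>t. (cmap ?d \<circ> cinv c) (\<beta> t))"
    by (rule smooth_on_compose[OF _ open_overlap sub(2) smooth_on_subset[OF assms(4) sub(1)]
          smooth_transition]) (auto intro: assms(1) chart_at_in)
  moreover have "\<gamma> ` {-e'<..<e'} \<subseteq> Z \<inter> cdom ?d"
  proof
    fix y assume "y \<in> \<gamma> ` {-e'<..<e'}"
    then obtain t where t: "t \<in> {-e'<..<e'}" "y = cinv c (\<beta> t)" by (auto simp: \<gamma>_def)
    then have "\<beta> t \<in> ?T" "t \<in> {-e<..<e}" using sub by blast+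
    then show "y \<in> Z \<inter> cdom ?d" using assms(1,6) t by (auto simp: cinv_cmap)
  qed
  moreover have "velocity A \<gamma> 0 = w"
  proof -
    have ev: "\<forall>\<^sub>F t in nhds 0. t \<in> {-e<..<e}"
      using assms(3) by (intro eventually_nhds_in_open) auto
    have ev1: "\<forall>\<^sub>F t in nhds 0. \<gamma> t \<in> cdom c"
      using ev by eventually_elim (use assms(6) in \<open>simp add: \<gamma>_def cinv_in\<close>)
    have "\<forall>\<^sub>F t in nhds 0. \<beta> t = (cmap c \<circ> \<gamma>) t"
      using ev by eventually_elim (use assms(6) in \<open>simp add: \<gamma>_def cmap_cinv\<close>)
    then have "((cmap c \<circ> \<gamma>) has_vector_derivative mdiff A (cmap c) z w) (at 0)"
      by (rule has_vector_derivative_cong_nhds[OF assms(7)])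
    from velocity_in_chart[OF assms(1) ev1 this] show ?thesis
      using g0 tangent_vector_mdiff[OF assms(1,2)] by simp
  qed
  ultimately show ?thesis
    unfolding tangent_to_def using g0 e'(1) by (auto simp: comp_def \<gamma>_def intro!: exI[of _ \<gamma>])
qed

lemma tangent_toE:
  assumes "c \<in> A" "z \<in> cdom c" "w \<in> tangent_to A Z z"
  obtains \<gamma> where "\<gamma> 0 = z" "((cmap c \<circ> \<gamma>) has_vector_derivative mdiff A (cmap c) z w) (at 0)"
    "\<forall>\<^sub>F t in nhds 0. \<gamma> t \<in> Z \<inter> cdom c"
proof -
  let ?d = "chart_at A z"
  obtain \<gamma> e where g: "\<gamma> 0 = z" "w = velocity A \<gamma> 0" "e > 0" "\<gamma> ` {-e<..<e} \<subseteq> Z \<inter> cdom ?d"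
    "smooth_on {-e<..<e} (cmap ?d \<circ> \<gamma>)"
    using assms(3) unfolding tangent_to_def by auto
  let ?I = "{-e<..<e}" and ?T = "cmap ?d ` (cdom ?d \<inter> cdom c)"
  have "open (?I \<inter> (cmap ?d \<circ> \<gamma>) -` ?T)"
    by (rule continuous_open_preimage[OF smooth_on_continuous[OF g(5)]])
      (auto intro: open_overlap assms(1) chart_at_in)
  moreover have "0 \<in> ?I \<inter> (cmap ?d \<circ> \<gamma>) -` ?T"
    using g(1,3) assms(2) in_chart_at by auto
  ultimately have ev0: "\<forall>\<^sub>F t in nhds 0. t \<in> ?I \<inter> (cmap ?d \<circ> \<gamma>) -` ?T"
    by (rule eventually_nhds_in_open)
  have ev: "\<forall>\<^sub>F t in nhds 0. \<gamma> t \<in> Z \<inter> (cdom c \<inter> cdom ?d)"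
    using ev0
  proof eventually_elim
    case (elim t)
    then obtain q where q: "q \<in> cdom ?d \<inter> cdom c" "cmap ?d (\<gamma> t) = cmap ?d q" by auto
    moreover have "\<gamma> t \<in> Z \<inter> cdom ?d" using g(4) elim by auto
    ultimately have "\<gamma> t = q" using inj_chart[OF chart_at_in] by (auto dest: inj_onD)
    then show ?case using q \<open>\<gamma> t \<in> Z \<inter> cdom ?d\<close> by auto
  qed
  have w: "((cmap ?d \<circ> \<gamma>) has_vector_derivative w) (at 0)"
  proof -
    have "(cmap ?d \<circ> \<gamma>) differentiable at 0"
      by (rule smooth_on_differentiable[OF g(5)]) (use g(3) in auto)
    then have "((cmap ?d \<circ> \<gamma>) has_vector_derivative vector_derivative (cmap ?d \<circ> \<gamma>) (at 0)) (at 0)"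
      by (simp add: vector_derivative_works)
    then show ?thesis by (simp add: g(1,2) velocity_def)
  qed
  let ?T = "frechet_derivative (cmap c \<circ> cinv ?d) (at (cmap ?d z))"
  have "(((cmap c \<circ> cinv ?d) \<circ> (cmap ?d \<circ> \<gamma>)) has_vector_derivative ?T w) (at 0)"
    by (rule has_vector_derivative_chain[OF w
          transition_has_derivative[OF chart_at_in assms(1) in_chart_at assms(2)]]) (simp add: g(1))
  moreover have "\<forall>\<^sub>F t in nhds 0. ((cmap c \<circ> cinv ?d) \<circ> (cmap ?d \<circ> \<gamma>)) t = (cmap c \<circ> \<gamma>) t"
    using ev by eventually_elim (simp add: cinv_cmap[OF chart_at_in])
  ultimately have "((cmap c \<circ> \<gamma>) has_vector_derivative ?T w) (at 0)"
    by (rule has_vector_derivative_cong_nhds)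
  moreover have "?T w = mdiff A (cmap c) z w" by (simp add: mdiff_def)
  moreover have "\<forall>\<^sub>F t in nhds 0. \<gamma> t \<in> Z \<inter> cdom c"
    using ev by (rule eventually_mono) auto
  ultimately show ?thesis using that[of \<gamma>] g(1) by simp
qed

lemma tangent_map_in_chart:
  fixes B :: "('b, 'f::euclidean_space) chart set"
  assumes B: "smooth_atlas B" and "c \<in> A" "d \<in> B" "p \<in> cdom c" "f p \<in> cdom d"
    and near: "\<forall>\<^sub>F y in nhds (cmap c p). f (cinv c y) \<in> cdom d"
    and D: "((cmap d \<circ> f \<circ> cinv c) has_derivative D) (at (cmap c p))"
  shows "mdiff B (cmap d) (f p) (tangent_map A B f p v) = D (mdiff A (cmap c) p v)"
proof -
  interpret B: smooth_atlas B by fact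
  let ?d = "chart_at B (f p)"
  let ?T = "frechet_derivative (cmap ?d \<circ> cinv d) (at (cmap d (f p)))"
  have T: "((cmap ?d \<circ> cinv d) has_derivative ?T) (at (cmap d (f p)))"
    by (rule B.transition_has_derivative[OF assms(3) B.chart_at_in assms(5) B.in_chart_at])
  have "((cmap ?d \<circ> cinv d) \<circ> (cmap d \<circ> f \<circ> cinv c) has_derivative ?T \<circ> D) (at (cmap c p))"
    by (rule diff_chain_at[OF D]) (use T assms in \<open>simp add: cinv_cmap\<close>)
  moreover have "\<forall>\<^sub>F y in nhds (cmap c p).
      ((cmap ?d \<circ> cinv d) \<circ> (cmap d \<circ> f \<circ> cinv c)) y = (cmap ?d \<circ> f \<circ> cinv c) y"
    using near by eventually_elim (simp add: B.cinv_cmap[OF assms(3)])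
  ultimately have "((cmap ?d \<circ> f) \<circ> cinv c has_derivative ?T \<circ> D) (at (cmap c p))"
    unfolding comp_assoc by (rule has_derivative_cong_nhds)
  from mdiff_in_chart[OF assms(2,4) this]
  have "tangent_map A B f p v = tangent_vector B d (f p) (D (mdiff A (cmap c) p v))"
    by (simp add: tangent_map_def tangent_vector_def)
  then show ?thesis by (simp add: B.mdiff_tangent_vector assms)
qed

section \<open>Brackets of fields on a subset\<close>

text \<open>A tangent vector of \<open>Z\<close> is the velocity of a curve in \<open>Z\<close>, so the derivative of a field in
  its direction depends on the values on \<open>Z\<close> only. Hence so does the bracket of fields tangent to
  \<open>Z\<close> at \<open>z\<close>.\<close>

lemma local_extension_derivative_unique:
  assumes "local_extension A Z z U U1" "local_extension A Z z U U2" "w \<in> tangent_to A Z z"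
  defines "c \<equiv> chart_at A z"
  shows "frechet_derivative (field_in_chart A c U1) (at (cmap c z)) w =
    frechet_derivative (field_in_chart A c U2) (at (cmap c z)) w"
proof -
  have c: "c \<in> A" "z \<in> cdom c" by (simp_all add: c_def chart_at_in in_chart_at)
  obtain \<gamma> where g: "\<gamma> 0 = z" "((cmap c \<circ> \<gamma>) has_vector_derivative w) (at 0)"
    "\<forall>\<^sub>F t in nhds 0. \<gamma> t \<in> Z \<inter> cdom c"
    using tangent_toE[OF c assms(3)] by (auto simp: c_def mdiff_chart_at)
  have der: "((\<lambda>t. mdiff A (cmap c) (\<gamma> t) (U (\<gamma> t))) has_vector_derivative
      frechet_derivative (field_in_chart A c V) (at (cmap c z)) w) (at 0)"
    if V: "local_extension A Z z U V" for V
  proof -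
    obtain O' where O: "mopen A O'" "z \<in> O'" "smooth_field A O' V" "\<forall>y\<in>O' \<inter> Z. V y = U y"
      using V unfolding local_extension_def by blast
    let ?O = "cmap c ` (cdom c \<inter> O')"
    have "cmap c z \<in> ?O" using O c by auto
    then have "(field_in_chart A c V has_derivative
        frechet_derivative (field_in_chart A c V) (at (cmap c z))) (at (cmap c z))"
      using O(3) c smooth_on_has_derivative unfolding smooth_field_def by blast
    then have "((field_in_chart A c V \<circ> (cmap c \<circ> \<gamma>)) has_vector_derivative
      frechet_derivative (field_in_chart A c V) (at (cmap c z)) w) (at 0)"
      by (rule has_vector_derivative_chain[OF g(2)]) (simp add: g(1))
    moreover have "\<forall>\<^sub>F t in nhds 0.
        (field_in_chart A c V \<circ> (cmap c \<circ> \<gamma>)) t = mdiff A (cmap c) (\<gamma> t) (U (\<gamma> t))"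
    proof -
      have "isCont (cmap c \<circ> \<gamma>) 0" using g(2) has_vector_derivative_continuous by blast
      then have "((cmap c \<circ> \<gamma>) \<longlongrightarrow> (cmap c \<circ> \<gamma>) 0) (nhds 0)"
        unfolding isCont_def tendsto_at_iff_tendsto_nhds .
      moreover have "open ?O" using O(1) c(1) by (simp add: mopen_def)
      ultimately have "\<forall>\<^sub>F t in nhds 0. (cmap c \<circ> \<gamma>) t \<in> ?O"
        by (rule topological_tendstoD) (simp add: g(1) \<open>cmap c z \<in> ?O\<close>)
      then show ?thesis using g(3)
      proof eventually_elim
        case (elim t)
        then obtain q where q: "q \<in> cdom c" "q \<in> O'" "cmap c (\<gamma> t) = cmap c q" by auto
        then have "\<gamma> t = q" using elim inj_chart[OF c(1)] by (auto dest: inj_onD)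
        then have "V (\<gamma> t) = U (\<gamma> t)" using O(4) q elim by auto
        then show ?case using elim c(1) by (simp add: field_in_chart_cmap)
      qed
    qed
    ultimately show ?thesis
      by (rule has_vector_derivative_cong_nhds)
  qed
  show ?thesis
    using vector_derivative_unique_at[OF der[OF assms(1)] der[OF assms(2)]] .
qed

lemma lie_bracket_sub_eq:
  assumes "local_extension A Z z U U'" "local_extension A Z z W W'"
    "U z \<in> tangent_to A Z z" "W z \<in> tangent_to A Z z" "z \<in> Z"
  shows "lie_bracket_sub A Z U W z = lie_bracket A U' W' z"
proof -
  let ?c = "chart_at A z"
  have val: "field_in_chart A ?c V' (cmap ?c z) = V z" if "local_extension A Z z V V'" for V V'
  proof -
    have "V' z = V z" using that assms(5) unfolding local_extension_def by blast
    then show ?thesis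
      by (simp add: field_in_chart_cmap[OF chart_at_in in_chart_at] mdiff_chart_at)
  qed
  have "lie_bracket A U1 W1 z = lie_bracket A U' W' z"
    if "local_extension A Z z U U1" "local_extension A Z z W W1" for U1 W1
    unfolding lie_bracket_def Let_def
    by (simp add: val[OF that(1)] val[OF that(2)] val[OF assms(1)] val[OF assms(2)]
        local_extension_derivative_unique[OF that(1) assms(1,4)]
        local_extension_derivative_unique[OF that(2) assms(2,3)])
  then show ?thesis
    unfolding lie_bracket_sub_def using assms(1,2) by (intro the_equality) blast+
qed

end

lemma smooth_manifold_imp_smooth_atlas:
  assumes "smooth_manifold A" shows "smooth_atlas A"
proof
  show "(\<Union>c\<in>A. cdom c) = UNIV" using assms by (simp add: smooth_manifold_def)
next
  fix c assume c: "c \<in> A"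
  then have h: "homeomorphism (cdom c) (cmap c ` cdom c) (cmap c) (cinv c)"
    using assms by (simp add: smooth_manifold_def)
  show "inj_on (cmap c) (cdom c)"
    by (rule inj_on_inverseI[where g = "cinv c"]) (rule homeomorphism_apply1[OF h])
  fix d assume d: "d \<in> A"
  have "openin (top_of_set (cmap c ` cdom c)) (cmap c ` (cdom c \<inter> cdom d))"
    by (rule homeomorphism_imp_open_map[OF h])
      (use assms c d in \<open>auto simp: smooth_manifold_def intro: openin_open_Int\<close>)
  then show "open (cmap c ` (cdom c \<inter> cdom d))"
    using assms c by (metis openin_open_trans smooth_manifold_def)
  show "smooth_on (cmap c ` (cdom c \<inter> cdom d)) (cmap d \<circ> cinv c)"
    using assms c d by (simp add: smooth_manifold_def)
qed

lemma smooth_manifold_open_image: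
  assumes "smooth_manifold A" "c \<in> A" "open U"
  shows "open (cmap c ` (cdom c \<inter> U))"
proof -
  have h: "homeomorphism (cdom c) (cmap c ` cdom c) (cmap c) (cinv c)"
    using assms by (simp add: smooth_manifold_def)
  have "openin (top_of_set (cmap c ` cdom c)) (cmap c ` (cdom c \<inter> U))"
    by (rule homeomorphism_imp_open_map[OF h]) (use assms in \<open>auto intro: openin_open_Int\<close>)
  then show ?thesis using assms by (metis openin_open_trans smooth_manifold_def)
qed

section \<open>Endomorphisms in charts\<close>

lemma bounded_bilinear_matrix_mul:
  "bounded_bilinear ((**) :: real ^ 'm ^ 'm \<Rightarrow> real ^ 'm ^ 'm \<Rightarrow> real ^ 'm ^ 'm)"
  unfolding bilinear_conv_bounded_bilinear[symmetric] bilinear_def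
  by (auto intro!: linearI simp: matrix_matrix_mult_def vec_eq_iff algebra_simps sum.distrib
      sum_distrib_left)

lemma bounded_bilinear_matrix_vector:
  "bounded_bilinear ((*v) :: real ^ 'm ^ 'm \<Rightarrow> real ^ 'm \<Rightarrow> real ^ 'm)"
  unfolding bilinear_conv_bounded_bilinear[symmetric] bilinear_def
  by (auto intro!: linearI simp: matrix_vector_mult_def vec_eq_iff algebra_simps sum.distrib
      sum_distrib_left)

interpretation mm: bounded_bilinear "(**) :: real ^ 'm ^ 'm \<Rightarrow> real ^ 'm ^ 'm \<Rightarrow> real ^ 'm ^ 'm"
  by (rule bounded_bilinear_matrix_mul)

interpretation mv: bounded_bilinear "(*v) :: real ^ 'm ^ 'm \<Rightarrow> real ^ 'm \<Rightarrow> real ^ 'm"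
  by (rule bounded_bilinear_matrix_vector)

lemmas matrix_distribs = mm.add_left mm.add_right mm.diff_left mm.diff_right mm.minus_left
  mm.minus_right mm.scaleR_left mm.scaleR_right mm.zero_left mm.zero_right

lemmas smooth_on_matrix_mul = smooth_on_bilinear[OF _ bounded_bilinear_matrix_mul]
lemmas smooth_on_matrix_vector = smooth_on_bilinear[OF _ bounded_bilinear_matrix_vector]

lemma matrix_inv_eqI:
  fixes M N :: "real ^ 'm ^ 'm"
  assumes "M ** N = mat 1" shows "matrix_inv M = N"
proof -
  have "N ** M = mat 1" using assms matrix_left_right_inverse by blast
  with assms have "\<exists>N'. M ** N' = mat 1 \<and> N' ** M = mat 1" by blast
  from someI_ex[OF this] have "matrix_inv M ** M = mat 1" unfolding matrix_inv_def by blast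
  then have "matrix_inv M ** M ** N = N" by simp
  then show ?thesis using assms by (simp add: matrix_mul_assoc[symmetric])
qed

text \<open>The entries of a matrix are inner products of its values on basis vectors with basis vectors.\<close>

lemma smooth_on_matrixI:
  fixes M :: "'v::real_normed_vector \<Rightarrow> real ^ 'm ^ 'm"
  assumes "open S" "\<And>v. smooth_on S (\<lambda>x. M x *v v)"
  shows "smooth_on S M"
proof (rule smooth_on_cong[OF assms(1)])
  show "smooth_on S (\<lambda>x. \<Sum>b\<in>Basis. (M x \<bullet> b) *\<^sub>R b)"
  proof (intro smooth_on_sum smooth_on_scaleR smooth_on_const assms(1) finite_Basis)
    fix b :: "real ^ 'm ^ 'm" assume "b \<in> Basis"
    then obtain i j where b: "b = axis i (axis j 1)"
      by (auto simp: Basis_vec_def)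
    have "M x \<bullet> b = (M x *v axis j 1) \<bullet> axis i 1" for x
      by (simp add: b inner_axis matrix_vector_mult_basis column_def inner_axis')
    then show "smooth_on S (\<lambda>x. M x \<bullet> b)"
      using smooth_on_linear_comp[OF assms(1) bounded_linear_inner_left assms(2)] by simp
  qed
  show "(\<Sum>b\<in>Basis. (M x \<bullet> b) *\<^sub>R b) = M x" for x
    by (rule euclidean_representation)
qed

lemma smooth_on_matrix_of_linear:
  fixes G :: "'v::real_normed_vector \<Rightarrow> real ^ 'm \<Rightarrow> real ^ 'm"
  assumes "open S" "\<And>x. x \<in> S \<Longrightarrow> linear (G x)" "\<And>v. smooth_on S (\<lambda>x. G x v)"
  shows "smooth_on S (\<lambda>x. matrix (G x))"
proof (rule smooth_on_matrixI[OF assms(1)])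
  show "smooth_on S (\<lambda>x. matrix (G x) *v v)" for v
    by (rule smooth_on_cong[OF assms(1) assms(3)]) (simp add: matrix_works assms(2))
qed

definition endo_chart ::
    "('a, real ^ 'm) chart set \<Rightarrow> ('a, real ^ 'm) chart \<Rightarrow>
     ('a \<times> (real ^ 'm ^ 'm), (real ^ 'm) \<times> (real ^ 'm ^ 'm)) chart" where
  "endo_chart A c = (cdom c \<times> UNIV, \<lambda>(p, J). (cmap c p, endo_in_chart A c p J))"

definition endo_from_chart ::
    "('a, real ^ 'm) chart set \<Rightarrow> ('a, real ^ 'm) chart \<Rightarrow> 'a \<Rightarrow> real ^ 'm ^ 'm \<Rightarrow> real ^ 'm ^ 'm" where
  "endo_from_chart A c p B =
     matrix (tangent_vector A c p) ** B ** matrix (mdiff A (cmap c) p)"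

lemma cdom_endo_chart [simp]: "cdom (endo_chart A c) = cdom c \<times> UNIV"
  by (simp add: endo_chart_def)

lemma cmap_endo_chart [simp]:
  "cmap (endo_chart A c) (p, J) = (cmap c p, endo_in_chart A c p J)"
  by (simp add: endo_chart_def)

lemma endo_atlas_eq: "endo_atlas A = endo_chart A ` A"
  by (simp add: endo_atlas_def endo_chart_def[abs_def])

locale frame_atlas = smooth_atlas A for A :: "('a, real ^ 'm) chart set"
begin

lemma matrix_tangent_vector_mdiff:
  assumes "c \<in> A" "p \<in> cdom c"
  shows "matrix (tangent_vector A c p) ** matrix (mdiff A (cmap c) p) = mat 1"
    and "matrix (mdiff A (cmap c) p) ** matrix (tangent_vector A c p) = mat 1"
  by (simp_all add: matrix_eq matrix_works linear_mdiff_chart linear_tangent_vector assms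
      mdiff_tangent_vector tangent_vector_mdiff flip: matrix_vector_mul_assoc)

lemma endo_in_chart_eq:
  assumes "c \<in> A" "p \<in> cdom c"
  shows "endo_in_chart A c p J =
    matrix (mdiff A (cmap c) p) ** J ** matrix (tangent_vector A c p)"
  unfolding endo_in_chart_def Let_def
  by (simp add: matrix_inv_eqI[OF matrix_tangent_vector_mdiff(2)[OF assms]])

lemma endo_in_chart_apply:
  assumes "c \<in> A" "p \<in> cdom c"
  shows "endo_in_chart A c p J *v mdiff A (cmap c) p v = mdiff A (cmap c) p (J *v v)"
  by (simp add: endo_in_chart_eq assms matrix_works linear_mdiff_chart linear_tangent_vector
      tangent_vector_mdiff flip: matrix_vector_mul_assoc)

lemma endo_in_chart_mult:
  assumes "c \<in> A" "p \<in> cdom c"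
  shows "endo_in_chart A c p (J ** K) = endo_in_chart A c p J ** endo_in_chart A c p K"
proof -
  have "endo_in_chart A c p J ** endo_in_chart A c p K =
      matrix (mdiff A (cmap c) p) ** J ** (matrix (tangent_vector A c p) ** matrix (mdiff A (cmap c) p))
        ** K ** matrix (tangent_vector A c p)"
    by (simp add: endo_in_chart_eq assms matrix_mul_assoc)
  then show ?thesis
    by (simp add: endo_in_chart_eq matrix_tangent_vector_mdiff assms matrix_mul_assoc)
qed

lemma linear_endo_in_chart:
  assumes "c \<in> A" "p \<in> cdom c"
  shows "linear (endo_in_chart A c p)"
  by (rule linearI) (simp_all add: endo_in_chart_eq assms matrix_distribs)

lemma endo_in_chart_one:
  assumes "c \<in> A" "p \<in> cdom c"
  shows "endo_in_chart A c p (mat 1) = mat 1"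
  by (simp add: endo_in_chart_eq assms matrix_tangent_vector_mdiff)

lemma endo_in_from_chart:
  assumes "c \<in> A" "p \<in> cdom c"
  shows "endo_in_chart A c p (endo_from_chart A c p B) = B"
proof -
  have "endo_in_chart A c p (endo_from_chart A c p B) =
    (matrix (mdiff A (cmap c) p) ** matrix (tangent_vector A c p)) ** B **
    (matrix (mdiff A (cmap c) p) ** matrix (tangent_vector A c p))"
    by (simp add: endo_in_chart_eq assms endo_from_chart_def matrix_mul_assoc)
  then show ?thesis by (simp add: matrix_tangent_vector_mdiff assms)
qed

lemma endo_from_in_chart:
  assumes "c \<in> A" "p \<in> cdom c"
  shows "endo_from_chart A c p (endo_in_chart A c p J) = J"
proof -
  have "endo_from_chart A c p (endo_in_chart A c p J) =
    (matrix (tangent_vector A c p) ** matrix (mdiff A (cmap c) p)) ** J **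
    (matrix (tangent_vector A c p) ** matrix (mdiff A (cmap c) p))"
    by (simp add: endo_in_chart_eq assms endo_from_chart_def matrix_mul_assoc)
  then show ?thesis by (simp add: matrix_tangent_vector_mdiff assms)
qed

lemma endo_in_chart_eq_iff:
  assumes "c \<in> A" "p \<in> cdom c"
  shows "endo_in_chart A c p J = endo_in_chart A c p K \<longleftrightarrow> J = K"
  by (metis assms endo_from_in_chart)

lemma endo_in_chart_change:
  assumes "c \<in> A" "d \<in> A" "p \<in> cdom c" "p \<in> cdom d"
  shows "endo_in_chart A d p J =
    matrix (frechet_derivative (cmap d \<circ> cinv c) (at (cmap c p))) ** endo_in_chart A c p J **
    matrix (frechet_derivative (cmap c \<circ> cinv d) (at (cmap d p)))"
proof -
  have lin: "linear (frechet_derivative (cmap d \<circ> cinv c) (at (cmap c p)))"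
    "linear (frechet_derivative (cmap c \<circ> cinv d) (at (cmap d p)))"
    using transition_has_derivative assms has_derivative_linear by blast+
  show ?thesis
    unfolding matrix_eq
  proof
    fix v
    show "endo_in_chart A d p J *v v =
      matrix (frechet_derivative (cmap d \<circ> cinv c) (at (cmap c p))) ** endo_in_chart A c p J **
      matrix (frechet_derivative (cmap c \<circ> cinv d) (at (cmap d p))) *v v"
      using endo_in_chart_apply[OF assms(2,4), of J "tangent_vector A d p v"]
      by (simp add: matrix_works lin transition_derivative_inverse assms endo_in_chart_apply
          mdiff_tangent_vector tangent_vector_mdiff flip: matrix_vector_mul_assoc)
  qed
qed

text \<open>The inverse of the Jacobian of a transition map is the Jacobian of the inverse transition
  map, which makes its smoothness immediate.\<close>

lemma smooth_transition_matrices: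
  assumes "c \<in> A" "d \<in> A"
  defines "S \<equiv> cmap c ` (cdom c \<inter> cdom d)"
  shows "smooth_on S (\<lambda>x. matrix (frechet_derivative (cmap d \<circ> cinv c) (at x)))"
    and "smooth_on S (\<lambda>x. matrix (frechet_derivative (cmap c \<circ> cinv d) (at (cmap d (cinv c x)))))"
proof -
  have fwd: "smooth_on (cmap c ` (cdom c \<inter> cdom d)) (\<lambda>x. matrix (frechet_derivative (cmap d \<circ> cinv c) (at x)))"
    if "c \<in> A" "d \<in> A" for c d
  proof (rule smooth_on_matrix_of_linear[OF open_overlap[OF that]])
    show "linear (frechet_derivative (cmap d \<circ> cinv c) (at x))" if "x \<in> cmap c ` (cdom c \<inter> cdom d)" for x
      using has_derivative_linear[OF smooth_on_has_derivative[OF smooth_transition that]] \<open>c \<in> A\<close> \<open>d \<in> A\<close> by blast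
    show "smooth_on (cmap c ` (cdom c \<inter> cdom d)) (\<lambda>x. frechet_derivative (cmap d \<circ> cinv c) (at x) v)" for v
      by (rule smooth_on_derivative[OF smooth_transition[OF that]])
  qed
  show "smooth_on S (\<lambda>x. matrix (frechet_derivative (cmap d \<circ> cinv c) (at x)))"
    unfolding S_def by (rule fwd[OF assms(1,2)])
  have "smooth_on S (\<lambda>x. matrix (frechet_derivative (cmap c \<circ> cinv d) (at ((cmap d \<circ> cinv c) x))))"
    unfolding S_def
    by (rule smooth_on_compose[OF open_overlap[OF assms(1,2)] open_overlap[OF assms(2,1)] _
          smooth_transition[OF assms(1,2)] fwd[OF assms(2,1)]])
      (auto simp: cinv_cmap assms)
  then show "smooth_on S (\<lambda>x. matrix (frechet_derivative (cmap c \<circ> cinv d) (at (cmap d (cinv c x)))))"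
    by (simp add: comp_def)
qed

lemma smooth_endoI:
  assumes "c \<in> A" "U \<subseteq> cdom c" "open (cmap c ` U)"
    "smooth_on (cmap c ` U) (\<lambda>x. endo_in_chart A c (cinv c x) (\<sigma> (cinv c x)))"
  shows "smooth_endo A U \<sigma>"
  unfolding smooth_endo_def
proof
  fix d assume d: "d \<in> A"
  let ?V = "cmap d ` (cdom d \<inter> U)"
  have op: "open ?V" using mopenI[OF assms(1-3)] d by (simp add: mopen_def)
  have sub: "?V \<subseteq> cmap d ` (cdom d \<inter> cdom c)" using assms(2) by auto
  let ?T = "\<lambda>y. matrix (frechet_derivative (cmap d \<circ> cinv c) (at (cmap c (cinv d y))))"
  let ?T' = "\<lambda>y. matrix (frechet_derivative (cmap c \<circ> cinv d) (at y))"
  show "smooth_on ?V (\<lambda>y. endo_in_chart A d (cinv d y) (\<sigma> (cinv d y)))"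
  proof (rule smooth_on_cong[OF op])
    show "smooth_on ?V (\<lambda>y. ?T y ** (\<lambda>x. endo_in_chart A c (cinv c x) (\<sigma> (cinv c x))) (cmap c (cinv d y)) ** ?T' y)"
      by (intro smooth_on_matrix_mul op smooth_on_change_chart[OF assms(1) d assms(2-4)]
          smooth_on_subset[OF smooth_transition_matrices(1)[OF d assms(1)] sub]
          smooth_on_subset[OF smooth_transition_matrices(2)[OF d assms(1)] sub])
    fix y assume "y \<in> ?V"
    then obtain p where p: "p \<in> cdom d" "p \<in> U" "y = cmap d p" by blast
    then have "p \<in> cdom c" using assms(2) by blast
    then show "?T y ** (\<lambda>x. endo_in_chart A c (cinv c x) (\<sigma> (cinv c x))) (cmap c (cinv d y)) ** ?T' y
        = endo_in_chart A d (cinv d y) (\<sigma> (cinv d y))"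
      using p endo_in_chart_change[OF assms(1) d] by (simp add: cinv_cmap d assms(1))
  qed
qed

lemma smooth_endo_mult_field:
  assumes "mopen A U" "smooth_endo A U \<sigma>" "smooth_field A U Y"
  shows "smooth_field A U (\<lambda>q. \<sigma> q *v Y q)"
  unfolding smooth_field_def
proof
  fix c assume c: "c \<in> A"
  have op: "open (cmap c ` (cdom c \<inter> U))" using assms(1) c by (simp add: mopen_def)
  show "smooth_on (cmap c ` (cdom c \<inter> U)) (field_in_chart A c (\<lambda>q. \<sigma> q *v Y q))"
  proof (rule smooth_on_cong[OF op])
    show "smooth_on (cmap c ` (cdom c \<inter> U))
        (\<lambda>x. endo_in_chart A c (cinv c x) (\<sigma> (cinv c x)) *v field_in_chart A c Y x)"
      using assms(2,3) c unfolding smooth_endo_def smooth_field_def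
      by (intro smooth_on_matrix_vector op) auto
  qed (auto simp: field_in_chart_def cinv_cmap c endo_in_chart_apply)
qed

lemma cinv_endo_chart:
  assumes "c \<in> A" "x \<in> cmap c ` cdom c"
  shows "cinv (endo_chart A c) (x, B) = (cinv c x, endo_from_chart A c (cinv c x) B)"
proof -
  have inj: "inj_on (cmap (endo_chart A c)) (cdom (endo_chart A c))"
    using inj_chart[OF assms(1)] by (auto simp: inj_on_def endo_in_chart_eq_iff assms(1))
  have "cinv c x \<in> cdom c" using assms(2) by (rule cinv_in)
  then have "cmap (endo_chart A c) (cinv c x, endo_from_chart A c (cinv c x) B) = (x, B)"
    using assms by (simp add: cmap_cinv endo_in_from_chart)
  with \<open>cinv c x \<in> cdom c\<close> show ?thesis
    unfolding cinv_def[of "endo_chart A c"] by (intro inv_into_f_eq[OF inj]) auto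
qed

lemma endo_chart_image:
  assumes "c \<in> A" "V \<subseteq> cdom c"
  shows "cmap (endo_chart A c) ` (V \<times> UNIV) = cmap c ` V \<times> UNIV"
proof
  show "cmap c ` V \<times> UNIV \<subseteq> cmap (endo_chart A c) ` (V \<times> UNIV)"
  proof clarify
    fix p B assume "p \<in> V"
    then have "(cmap c p, B) = cmap (endo_chart A c) (p, endo_from_chart A c p B)"
      using assms by (auto simp: endo_in_from_chart)
    then show "(cmap c p, B) \<in> cmap (endo_chart A c) ` (V \<times> UNIV)"
      using \<open>p \<in> V\<close> by (intro image_eqI[of _ _ "(p, endo_from_chart A c p B)"]) auto
  qed
qed auto

lemma smooth_on_fst:
  fixes g :: "'v::euclidean_space \<Rightarrow> 'u::real_normed_vector"
  assumes "open S" "smooth_on S g"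
  shows "smooth_on (S \<times> (UNIV :: 'w::euclidean_space set)) (\<lambda>z. g (fst z))"
  by (rule smooth_on_compose[OF _ assms(1) _ smooth_on_linear[OF _ bounded_linear_fst] assms(2)])
    (auto intro: open_Times assms)

lemma smooth_atlas_endo: "smooth_atlas (endo_atlas A)"
proof
  show "(\<Union>c\<in>endo_atlas A. cdom c) = UNIV"
  proof -
    have "(p, J) \<in> cdom (endo_chart A (chart_at A p))" for p J by (simp add: in_chart_at)
    then show ?thesis unfolding endo_atlas_eq using chart_at_in by fastforce
  qed
next
  fix C assume "C \<in> endo_atlas A"
  then obtain c where c: "c \<in> A" "C = endo_chart A c" by (auto simp: endo_atlas_eq)
  show "inj_on (cmap C) (cdom C)"
    unfolding c(2) using inj_chart[OF c(1)] by (auto simp: inj_on_def endo_in_chart_eq_iff c(1))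
  fix D assume "D \<in> endo_atlas A"
  then obtain d where d: "d \<in> A" "D = endo_chart A d" by (auto simp: endo_atlas_eq)
  let ?S = "cmap c ` (cdom c \<inter> cdom d)"
  have opS: "open ?S" by (rule open_overlap[OF c(1) d(1)])
  have img: "cmap C ` (cdom C \<inter> cdom D) = ?S \<times> UNIV"
    using endo_chart_image[OF c(1), of "cdom c \<inter> cdom d"] by (simp add: c d Times_Int_Times)
  show op: "open (cmap C ` (cdom C \<inter> cdom D))"
    unfolding img by (intro open_Times opS open_UNIV)
  let ?T = "\<lambda>x. matrix (frechet_derivative (cmap d \<circ> cinv c) (at x))"
  let ?T' = "\<lambda>x. matrix (frechet_derivative (cmap c \<circ> cinv d) (at (cmap d (cinv c x))))"
  have "smooth_on (?S \<times> UNIV) (\<lambda>z. ((cmap d \<circ> cinv c) (fst z), ?T (fst z) ** snd z ** ?T' (fst z)))"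
    by (intro smooth_on_Pair smooth_on_matrix_mul smooth_on_fst[OF opS]
        smooth_on_linear[OF _ bounded_linear_snd] open_Times opS open_UNIV smooth_transition
        smooth_transition_matrices c(1) d(1))
  then show "smooth_on (cmap C ` (cdom C \<inter> cdom D)) (cmap D \<circ> cinv C)"
    unfolding img
  proof (rule smooth_on_cong[rotated])
    show "open (?S \<times> (UNIV :: (real ^ 'm ^ 'm) set))" by (intro open_Times opS open_UNIV)
    fix z :: "(real ^ 'm) \<times> (real ^ 'm ^ 'm)"
    assume "z \<in> ?S \<times> UNIV"
    then obtain p B where z: "z = (cmap c p, B)" "p \<in> cdom c" "p \<in> cdom d" by (cases z) auto
    then have "(cmap D \<circ> cinv C) z = (cmap d p, endo_in_chart A d p (endo_from_chart A c p B))"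
      by (simp add: c d cinv_endo_chart cinv_cmap)
    then show "((cmap d \<circ> cinv c) (fst z), ?T (fst z) ** snd z ** ?T' (fst z)) = (cmap D \<circ> cinv C) z"
      using z c(1) d(1) by (simp add: endo_in_chart_change[OF c(1) d(1)] endo_in_from_chart cinv_cmap)
  qed
qed

sublocale E: smooth_atlas "endo_atlas A" by (rule smooth_atlas_endo)

lemma endo_chart_in: "c \<in> A \<Longrightarrow> endo_chart A c \<in> endo_atlas A"
  by (simp add: endo_atlas_eq)

lemma proj_differential_in_chart:
  assumes "c \<in> A" "p \<in> cdom c"
  shows "mdiff A (cmap c) p (proj_differential A (p, J) W) =
    fst (mdiff (endo_atlas A) (cmap (endo_chart A c)) (p, J) W)"
proof -
  let ?C = "endo_chart A c"
  have near: "\<forall>\<^sub>F y in nhds (cmap ?C (p, J)). y \<in> cmap c ` cdom c \<times> UNIV"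
    by (rule eventually_nhds_in_open) (use assms in \<open>auto intro: open_Times open_chart\<close>)
  have "mdiff A (cmap c) (fst (p, J)) (tangent_map (endo_atlas A) A fst (p, J) W) =
      fst (mdiff (endo_atlas A) (cmap ?C) (p, J) W)"
  proof (rule E.tangent_map_in_chart[OF smooth_atlas_axioms endo_chart_in])
    show "\<forall>\<^sub>F y in nhds (cmap ?C (p, J)). fst (cinv ?C y) \<in> cdom c"
      using near by eventually_elim (auto simp: cinv_endo_chart assms(1) cinv_cmap)
    show "(cmap c \<circ> fst \<circ> cinv ?C has_derivative fst) (at (cmap ?C (p, J)))"
    proof (rule has_derivative_cong_nhds)
      show "(fst has_derivative fst) (at (cmap ?C (p, J)))"
        by (rule bounded_linear_imp_has_derivative[OF bounded_linear_fst])
      show "\<forall>\<^sub>F y in nhds (cmap ?C (p, J)). fst y = (cmap c \<circ> fst \<circ> cinv ?C) y"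
        using near by eventually_elim (auto simp: cinv_endo_chart assms(1) cinv_cmap)
    qed
  qed (use assms in auto)
  then show ?thesis by (simp add: proj_differential_def)
qed

lemma vlift_in_chart:
  assumes "c \<in> A" "p \<in> cdom c"
  shows "mdiff (endo_atlas A) (cmap (endo_chart A c)) (p, J) (vlift A (p, J) B) =
    (0, endo_in_chart A c p B)"
proof -
  let ?C = "endo_chart A c"
  have "((\<lambda>t. (cmap c p, endo_in_chart A c p J + t *\<^sub>R endo_in_chart A c p B)) has_vector_derivative
      (0, endo_in_chart A c p B)) (at 0)"
    by (auto intro!: derivative_eq_intros has_vector_derivative_Pair)
  moreover have "cmap ?C \<circ> (\<lambda>t. (p, J + t *\<^sub>R B)) =
      (\<lambda>t. (cmap c p, endo_in_chart A c p J + t *\<^sub>R endo_in_chart A c p B))"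
    by (simp add: fun_eq_iff linear_add[OF linear_endo_in_chart] linear_cmul[OF linear_endo_in_chart] assms)
  ultimately have "velocity (endo_atlas A) (\<lambda>t. (p, J + t *\<^sub>R B)) 0 =
      tangent_vector (endo_atlas A) ?C (p, J + 0 *\<^sub>R B) (0, endo_in_chart A c p B)"
    by (intro E.velocity_in_chart endo_chart_in assms(1)) (use assms in auto)
  then show ?thesis
    using E.mdiff_tangent_vector[OF endo_chart_in[OF assms(1)], of "(p, J)"] assms
    by (simp add: vlift_def)
qed

end

section \<open>Linear connections in charts\<close>

definition coordinate_field ::
    "('a, real ^ 'm) chart set \<Rightarrow> ('a, real ^ 'm) chart \<Rightarrow> real ^ 'm \<Rightarrow> 'a \<Rightarrow> real ^ 'm" where
  "coordinate_field A c u = (\<lambda>q. tangent_vector A c q u)"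

text \<open>The matrix \<open>christoffel A D c x w\<close> is the value at \<open>x\<close> of the connection form on the vector with
  components \<open>w\<close>: its columns are the covariant derivatives of the coordinate fields.\<close>

definition christoffel ::
    "('a, real ^ 'm) chart set \<Rightarrow> ('a, real ^ 'm) connection \<Rightarrow> ('a, real ^ 'm) chart \<Rightarrow>
     real ^ 'm \<Rightarrow> real ^ 'm \<Rightarrow> real ^ 'm ^ 'm" where
  "christoffel A D c x w =
     matrix (\<lambda>u. mdiff A (cmap c) (cinv c x)
       (D (cinv c x) (tangent_vector A c (cinv c x) w) (coordinate_field A c u)))"

context frame_atlas
begin

lemma smooth_field_zero: "mopen A U \<Longrightarrow> smooth_field A U (\<lambda>q. 0)"
  unfolding smooth_field_def
proof
  fix c assume c: "c \<in> A" "mopen A U"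
  show "smooth_on (cmap c ` (cdom c \<inter> U)) (field_in_chart A c (\<lambda>q. 0))"
    by (rule smooth_on_cong[OF _ smooth_on_const[of _ 0]])
      (use c in \<open>auto simp: mopen_def field_in_chart_cmap linear_0[OF linear_mdiff_chart]\<close>)
qed

lemma smooth_field_add:
  assumes "mopen A U" "smooth_field A U X" "smooth_field A U Y"
  shows "smooth_field A U (\<lambda>q. X q + Y q)"
  unfolding smooth_field_def
proof
  fix c assume c: "c \<in> A"
  have op: "open (cmap c ` (cdom c \<inter> U))" using assms(1) c by (simp add: mopen_def)
  show "smooth_on (cmap c ` (cdom c \<inter> U)) (field_in_chart A c (\<lambda>q. X q + Y q))"
    by (rule smooth_on_cong[OF op smooth_on_add[OF op, of "field_in_chart A c X" "field_in_chart A c Y"]])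
      (use assms c in \<open>auto simp: smooth_field_def field_in_chart_cmap linear_add[OF linear_mdiff_chart]\<close>)
qed

lemma smooth_field_scaleR:
  assumes "mopen A U" "smooth_fun A U f" "smooth_field A U Y"
  shows "smooth_field A U (\<lambda>q. f q *\<^sub>R Y q)"
  unfolding smooth_field_def
proof
  fix c assume c: "c \<in> A"
  have op: "open (cmap c ` (cdom c \<inter> U))" using assms(1) c by (simp add: mopen_def)
  show "smooth_on (cmap c ` (cdom c \<inter> U)) (field_in_chart A c (\<lambda>q. f q *\<^sub>R Y q))"
    by (rule smooth_on_cong[OF op smooth_on_scaleR[OF op, of "f \<circ> cinv c" "field_in_chart A c Y"]])
      (use assms c in \<open>auto simp: smooth_field_def smooth_fun_def field_in_chart_cmap cinv_cmap
          linear_cmul[OF linear_mdiff_chart]\<close>)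
qed

lemma smooth_field_sum:
  assumes "mopen A U" "finite I" "\<And>i. i \<in> I \<Longrightarrow> smooth_field A U (Y i)"
  shows "smooth_field A U (\<lambda>q. \<Sum>i\<in>I. Y i q)"
  using assms(2,3)
  by (induction I rule: finite_induct) (simp_all add: smooth_field_zero smooth_field_add assms(1))

lemma smooth_field_subset: "smooth_field A U X \<Longrightarrow> V \<subseteq> U \<Longrightarrow> smooth_field A V X"
  unfolding smooth_field_def by (blast intro: smooth_on_subset)

lemma smooth_endo_subset: "smooth_endo A U X \<Longrightarrow> V \<subseteq> U \<Longrightarrow> smooth_endo A V X"
  unfolding smooth_endo_def by (blast intro: smooth_on_subset)

lemma smooth_field_coordinate:
  assumes "c \<in> A" "U \<subseteq> cdom c" "open (cmap c ` U)"
  shows "smooth_field A U (coordinate_field A c u)"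
proof (rule smooth_fieldI[OF assms])
  show "smooth_on (cmap c ` U) (field_in_chart A c (coordinate_field A c u))"
    by (rule smooth_on_cong[OF assms(3) smooth_on_const[OF assms(3), of u]])
      (use assms in \<open>auto simp: field_in_chart_cmap coordinate_field_def mdiff_tangent_vector subset_iff\<close>)
qed

end

locale framed_manifold =
  fixes A :: "('a::{t2_space,second_countable_topology}, real ^ 'm) chart set"
  assumes manifold: "smooth_manifold A"

sublocale framed_manifold \<subseteq> frame_atlas A
  by (rule frame_atlas.intro, rule smooth_manifold_imp_smooth_atlas, rule manifold)

context framed_manifold
begin

lemma open_cdom: "c \<in> A \<Longrightarrow> open (cdom c)"
  using manifold by (simp add: smooth_manifold_def)

lemma open_image: "c \<in> A \<Longrightarrow> open U \<Longrightarrow> U \<subseteq> cdom c \<Longrightarrow> open (cmap c ` U)"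
  using smooth_manifold_open_image[OF manifold, of c U] by (simp add: Int_absorb1)

lemma open_imp_mopen: "open U \<Longrightarrow> mopen A U"
  unfolding mopen_def using smooth_manifold_open_image[OF manifold] by blast

end

locale manifold_with_connection = framed_manifold A
  for A :: "('a::{t2_space,second_countable_topology}, real ^ 'm) chart set" +
  fixes D :: "('a, real ^ 'm) connection"
  assumes connection: "linear_connection A D"
begin

lemma D_linear: "open U \<Longrightarrow> p \<in> U \<Longrightarrow> smooth_field A U Y \<Longrightarrow> linear (\<lambda>v. D p v Y)"
  using connection[unfolded linear_connection_def, THEN conjunct1] by blast

lemma D_add: "open U \<Longrightarrow> p \<in> U \<Longrightarrow> smooth_field A U Y \<Longrightarrow> smooth_field A U Y' \<Longrightarrow>
    D p v (\<lambda>q. Y q + Y' q) = D p v Y + D p v Y'"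
  using connection[unfolded linear_connection_def, THEN conjunct2, THEN conjunct1] by blast

lemma D_leibniz: "open U \<Longrightarrow> p \<in> U \<Longrightarrow> smooth_fun A U f \<Longrightarrow> smooth_field A U Y \<Longrightarrow>
    D p v (\<lambda>q. f q *\<^sub>R Y q) = mdiff A f p v *\<^sub>R Y p + f p *\<^sub>R D p v Y"
  using connection[unfolded linear_connection_def, THEN conjunct2, THEN conjunct2, THEN conjunct1] by blast

lemma D_local: "open U \<Longrightarrow> p \<in> U \<Longrightarrow> smooth_field A U Y \<Longrightarrow> (\<And>q. q \<in> U \<Longrightarrow> Y' q = Y q) \<Longrightarrow>
    D p v Y' = D p v Y"
  using connection[unfolded linear_connection_def, THEN conjunct2, THEN conjunct2, THEN conjunct2, THEN conjunct1] by blast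

lemma D_smooth: "open U \<Longrightarrow> smooth_field A U X \<Longrightarrow> smooth_field A U Y \<Longrightarrow>
    smooth_field A U (\<lambda>p. D p (X p) Y)"
  using connection[unfolded linear_connection_def, THEN conjunct2, THEN conjunct2, THEN conjunct2, THEN conjunct2] by blast

lemma D_sum:
  assumes "open U" "p \<in> U" "finite I" "\<And>i. i \<in> I \<Longrightarrow> smooth_field A U (Y i)"
  shows "D p v (\<lambda>q. \<Sum>i\<in>I. Y i q) = (\<Sum>i\<in>I. D p v (Y i))"
  using assms(3,4)
proof (induction I rule: finite_induct)
  case empty
  have "D p v (\<lambda>q. 0 + 0) = D p v (\<lambda>q. 0) + D p v (\<lambda>q. 0)"
    by (rule D_add[OF assms(1,2)]) (intro smooth_field_zero open_imp_mopen assms(1))+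
  then show ?case by simp
next
  case (insert i I)
  then show ?case
    by (simp add: D_add[OF assms(1,2)] smooth_field_sum[OF open_imp_mopen[OF assms(1)]])
qed

lemma linear_D_coordinate:
  assumes "c \<in> A" "p \<in> cdom c"
  shows "linear (\<lambda>u. mdiff A (cmap c) p (D p v (coordinate_field A c u)))"
proof (rule linearI)
  note U = open_cdom[OF assms(1)] assms(2)
  note sm = smooth_field_coordinate[OF assms(1) order_refl open_chart[OF assms(1)]]
  fix u w and r :: real
  have "D p v (coordinate_field A c (u + w)) =
      D p v (\<lambda>q. coordinate_field A c u q + coordinate_field A c w q)"
    by (rule D_local[OF U smooth_field_add[OF open_imp_mopen[OF U(1)] sm sm]])
      (simp add: coordinate_field_def linear_add[OF linear_tangent_vector] assms)
  then show "mdiff A (cmap c) p (D p v (coordinate_field A c (u + w))) =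
      mdiff A (cmap c) p (D p v (coordinate_field A c u)) +
      mdiff A (cmap c) p (D p v (coordinate_field A c w))"
    by (simp add: D_add[OF U sm sm] linear_add[OF linear_mdiff_chart] assms)
  have const: "smooth_fun A (cdom c) (\<lambda>q. r)"
    by (rule smooth_funI[OF assms(1) order_refl open_chart[OF assms(1)]])
      (simp add: comp_def smooth_on_const open_chart assms(1))
  have "mdiff A (\<lambda>q. r) p v = 0"
    using mdiff_in_chart[OF assms, of "\<lambda>q. r" "\<lambda>_. 0" v] by (simp add: comp_def)
  moreover have "D p v (coordinate_field A c (r *\<^sub>R u)) =
      D p v (\<lambda>q. r *\<^sub>R coordinate_field A c u q)"
    by (rule D_local[OF U smooth_field_scaleR[OF open_imp_mopen[OF U(1)] const sm]])
      (simp add: coordinate_field_def linear_cmul[OF linear_tangent_vector] assms)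
  ultimately show "mdiff A (cmap c) p (D p v (coordinate_field A c (r *\<^sub>R u))) =
      r *\<^sub>R mdiff A (cmap c) p (D p v (coordinate_field A c u))"
    by (simp add: D_leibniz[OF U const sm] linear_cmul[OF linear_mdiff_chart] assms)
qed

lemma christoffel_apply:
  assumes "c \<in> A" "p \<in> cdom c"
  shows "christoffel A D c (cmap c p) w *v u =
    mdiff A (cmap c) p (D p (tangent_vector A c p w) (coordinate_field A c u))"
  by (simp add: christoffel_def cinv_cmap assms matrix_works linear_D_coordinate)

lemma linear_christoffel:
  assumes "c \<in> A" "p \<in> cdom c"
  shows "linear (christoffel A D c (cmap c p))"
proof (rule linearI)
  note sm = smooth_field_coordinate[OF assms(1) order_refl open_chart[OF assms(1)]]
  note lin = linear_compose[OF linear_tangent_vector[OF assms]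
      linear_compose[OF D_linear[OF open_cdom[OF assms(1)] assms(2) sm] linear_mdiff_chart[OF assms]]]
  fix w w' and r :: real
  show "christoffel A D c (cmap c p) (w + w') =
      christoffel A D c (cmap c p) w + christoffel A D c (cmap c p) w'"
    using linear_add[OF lin] by (simp add: matrix_eq christoffel_apply assms mv.add_left)
  show "christoffel A D c (cmap c p) (r *\<^sub>R w) = r *\<^sub>R christoffel A D c (cmap c p) w"
    using linear_cmul[OF lin] by (simp add: matrix_eq christoffel_apply assms mv.scaleR_left)
qed

lemma smooth_christoffel:
  assumes "c \<in> A"
  shows "smooth_on (cmap c ` cdom c) (\<lambda>x. christoffel A D c x w)"
proof (rule smooth_on_matrixI[OF open_chart[OF assms]])
  fix u
  note sm = smooth_field_coordinate[OF assms order_refl open_chart[OF assms]]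
  have "smooth_field A (cdom c) (\<lambda>p. D p (coordinate_field A c w p) (coordinate_field A c u))"
    by (rule D_smooth[OF open_cdom[OF assms] sm sm])
  then have "smooth_on (cmap c ` cdom c)
      (field_in_chart A c (\<lambda>p. D p (coordinate_field A c w p) (coordinate_field A c u)))"
    using assms unfolding smooth_field_def by fastforce
  then show "smooth_on (cmap c ` cdom c) (\<lambda>x. christoffel A D c x w *v u)"
    by (rule smooth_on_cong[OF open_chart[OF assms]])
      (auto simp: field_in_chart_cmap assms christoffel_apply coordinate_field_def[of A c w])
qed

text \<open>Locally a field is a combination of coordinate fields, so the axioms of a connection
  determine it from the Christoffel symbols.\<close>

lemma D_in_chart:
  assumes "c \<in> A" "p \<in> cdom c" "open U" "p \<in> U" "smooth_field A U Y"
  shows "mdiff A (cmap c) p (D p v Y) =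
    frechet_derivative (field_in_chart A c Y) (at (cmap c p)) (mdiff A (cmap c) p v) +
    christoffel A D c (cmap c p) (mdiff A (cmap c) p v) *v mdiff A (cmap c) p (Y p)"
proof -
  define V where "V = U \<inter> cdom c"
  have V: "open V" "p \<in> V" "V \<subseteq> cdom c" "V \<subseteq> U"
    using open_Int[OF assms(3) open_cdom[OF assms(1)]] assms(2,4) by (auto simp: V_def)
  note opV = open_image[OF assms(1) V(1,3)]
  let ?y = "field_in_chart A c Y" and ?x = "cmap c p" and ?w = "mdiff A (cmap c) p v"
  define f where "f b q = mdiff A (cmap c) q (Y q) \<bullet> b" for b q
  have y: "smooth_on (cmap c ` V) ?y"
    using smooth_field_subset[OF assms(5) V(4)] assms(1) V(3)
    unfolding smooth_field_def by (metis Int_absorb1)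
  have fy: "(f b \<circ> cinv c) z = ?y z \<bullet> b" if "z \<in> cmap c ` V" for b z
    using that V(3) by (auto simp: f_def field_in_chart_def)
  have smf: "smooth_fun A V (f b)" for b
  proof (rule smooth_funI[OF assms(1) V(3) opV])
    show "smooth_on (cmap c ` V) (f b \<circ> cinv c)"
      by (rule smooth_on_cong[OF opV smooth_on_linear_comp[OF opV bounded_linear_inner_left y]])
        (simp only: fy)
  qed
  have smb: "smooth_field A V (coordinate_field A c b)" for b
    by (rule smooth_field_coordinate[OF assms(1) V(3) opV])
  have smt: "smooth_field A V (\<lambda>q. f b q *\<^sub>R coordinate_field A c b q)" for b
    by (rule smooth_field_scaleR[OF open_imp_mopen[OF V(1)] smf smb])
  have Y: "(\<Sum>b\<in>Basis. f b q *\<^sub>R coordinate_field A c b q) = Y q" if "q \<in> V" for q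
  proof -
    have q: "q \<in> cdom c" using that V(3) by blast
    have "(\<Sum>b\<in>Basis. f b q *\<^sub>R coordinate_field A c b q) =
        tangent_vector A c q (\<Sum>b\<in>Basis. f b q *\<^sub>R b)"
      by (simp add: coordinate_field_def linear_sum[OF linear_tangent_vector[OF assms(1) q]]
          linear_cmul[OF linear_tangent_vector[OF assms(1) q]])
    also have "(\<Sum>b\<in>Basis. f b q *\<^sub>R b) = mdiff A (cmap c) q (Y q)"
      unfolding f_def by (rule euclidean_representation)
    finally show ?thesis by (simp add: tangent_vector_mdiff[OF assms(1) q])
  qed
  have "?x \<in> cmap c ` V" using V(2) by blast
  then have ydiff: "(?y has_derivative frechet_derivative ?y (at ?x)) (at ?x)"
    by (rule smooth_on_has_derivative[OF y])
  have df: "mdiff A (f b) p v = frechet_derivative ?y (at ?x) ?w \<bullet> b" for b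
  proof (rule mdiff_in_chart[OF assms(1,2)])
    have "((\<lambda>z. ?y z \<bullet> b) has_derivative (\<lambda>w. frechet_derivative ?y (at ?x) w \<bullet> b)) (at ?x)"
      by (rule bounded_linear.has_derivative[OF bounded_linear_inner_left ydiff])
    then show "(f b \<circ> cinv c has_derivative (\<lambda>w. frechet_derivative ?y (at ?x) w \<bullet> b)) (at ?x)"
      by (rule has_derivative_transform_within_open[OF _ opV \<open>?x \<in> cmap c ` V\<close>]) (simp only: fy)
  qed
  have "D p v Y = D p v (\<lambda>q. \<Sum>b\<in>Basis. f b q *\<^sub>R coordinate_field A c b q)"
    by (rule D_local[OF V(1,2), symmetric])
      (use smooth_field_subset[OF assms(5) V(4)] Y in auto)
  also have "\<dots> = (\<Sum>b\<in>Basis. D p v (\<lambda>q. f b q *\<^sub>R coordinate_field A c b q))"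
    by (rule D_sum[OF V(1,2) finite_Basis smt])
  also have "\<dots> = (\<Sum>b\<in>Basis. mdiff A (f b) p v *\<^sub>R coordinate_field A c b p +
      f b p *\<^sub>R D p v (coordinate_field A c b))"
    by (simp add: D_leibniz[OF V(1,2) smf smb])
  finally have "mdiff A (cmap c) p (D p v Y) =
      (\<Sum>b\<in>Basis. (frechet_derivative ?y (at ?x) ?w \<bullet> b) *\<^sub>R b) +
      (\<Sum>b\<in>Basis. f b p *\<^sub>R (christoffel A D c ?x ?w *v b))"
    by (simp add: linear_sum[OF linear_mdiff_chart[OF assms(1,2)]]
        linear_add[OF linear_mdiff_chart[OF assms(1,2)]] linear_cmul[OF linear_mdiff_chart[OF assms(1,2)]]
        sum.distrib df coordinate_field_def[of A c _, THEN fun_cong] mdiff_tangent_vector tangent_vector_mdiff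
        christoffel_apply assms)
  also have "(\<Sum>b\<in>Basis. f b p *\<^sub>R (christoffel A D c ?x ?w *v b)) =
      christoffel A D c ?x ?w *v (\<Sum>b\<in>Basis. f b p *\<^sub>R b)"
    by (simp add: mv.sum_right mv.scaleR_right)
  also have "(\<Sum>b\<in>Basis. f b p *\<^sub>R b) = mdiff A (cmap c) p (Y p)"
    unfolding f_def by (rule euclidean_representation)
  also have "(\<Sum>b\<in>Basis. (frechet_derivative ?y (at ?x) ?w \<bullet> b) *\<^sub>R b) = frechet_derivative ?y (at ?x) ?w"
    by (rule euclidean_representation)
  finally show ?thesis .
qed

text \<open>Differentiating \<open>\<sigma> Y\<close> by the product rule, the derivatives of \<open>Y\<close> cancel. What remains is
  applied to the value \<open>Y p\<close>, which can be any vector; so the definite description in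
  \<open>nabla_endo\<close> has exactly one candidate.\<close>

lemma nabla_endo_in_chart:
  fixes v :: "real ^ 'm"
  assumes "c \<in> A" "p \<in> cdom c" "open U" "p \<in> U" "smooth_endo A U \<sigma>"
  defines "s \<equiv> \<lambda>x. endo_in_chart A c (cinv c x) (\<sigma> (cinv c x))"
    and "w \<equiv> mdiff A (cmap c) p v" and "x \<equiv> cmap c p"
  shows "endo_in_chart A c p (nabla_endo A D p v \<sigma>) =
    frechet_derivative s (at x) w + christoffel A D c x w ** s x - s x ** christoffel A D c x w"
proof -
  let ?G = "christoffel A D c x w"
  let ?R = "frechet_derivative s (at x) w + ?G ** s x - s x ** ?G"
  let ?B = "endo_from_chart A c p ?R"
  have sx: "s x = endo_in_chart A c p (\<sigma> p)" by (simp add: s_def x_def cinv_cmap assms)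
  have B: "?B *v Y p = D p v (\<lambda>q. \<sigma> q *v Y q) - \<sigma> p *v D p v Y"
    if Y: "open U'" "p \<in> U'" "smooth_field A U' Y" for U' Y
  proof -
    define V where "V = U \<inter> U'"
    have V: "open V" "p \<in> V" "V \<subseteq> U" "V \<subseteq> U'" using assms Y by (auto simp: V_def)
    have smV: "smooth_endo A V \<sigma>" "smooth_field A V Y"
      using smooth_endo_subset smooth_field_subset assms(5) Y V by blast+
    have smp: "smooth_field A V (\<lambda>q. \<sigma> q *v Y q)"
      by (rule smooth_endo_mult_field[OF open_imp_mopen[OF V(1)] smV])
    let ?y = "field_in_chart A c Y" and ?S = "cmap c ` (cdom c \<inter> V)"
    have S: "open ?S" "x \<in> ?S"
      using open_imp_mopen[OF V(1)] assms(1,2) V(2) by (auto simp: mopen_def x_def)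
    have ds: "(s has_derivative frechet_derivative s (at x)) (at x)"
      using smV(1) assms(1) S(2) smooth_on_has_derivative unfolding smooth_endo_def s_def by blast
    have dy: "(?y has_derivative frechet_derivative ?y (at x)) (at x)"
      using smV(2) assms(1) S(2) smooth_on_has_derivative unfolding smooth_field_def by blast
    have "(field_in_chart A c (\<lambda>q. \<sigma> q *v Y q) has_derivative
        (\<lambda>u. s x *v frechet_derivative ?y (at x) u + frechet_derivative s (at x) u *v ?y x)) (at x)"
    proof (rule has_derivative_transform_within_open[OF mv.FDERIV[OF ds dy] S])
      show "s z *v ?y z = field_in_chart A c (\<lambda>q. \<sigma> q *v Y q) z" if "z \<in> ?S" for z
        using that by (auto simp: s_def field_in_chart_def cinv_cmap assms(1) endo_in_chart_apply)
    qed
    then have d: "frechet_derivative (field_in_chart A c (\<lambda>q. \<sigma> q *v Y q)) (at x) =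
        (\<lambda>u. s x *v frechet_derivative ?y (at x) u + frechet_derivative s (at x) u *v ?y x)"
      by (rule frechet_derivative_at[symmetric])
    have yx: "?y x = mdiff A (cmap c) p (Y p)"
      by (simp add: x_def field_in_chart_cmap assms(1,2))
    have "mdiff A (cmap c) p (?B *v Y p) = ?R *v ?y x"
      by (simp add: endo_in_chart_apply[symmetric] endo_in_from_chart assms(1,2) yx)
    also have "\<dots> = mdiff A (cmap c) p (D p v (\<lambda>q. \<sigma> q *v Y q)) - s x *v mdiff A (cmap c) p (D p v Y)"
      unfolding D_in_chart[OF assms(1,2) V(1,2) smp] D_in_chart[OF assms(1,2) V(1,2) smV(2)]
        x_def[symmetric] w_def[symmetric] d endo_in_chart_apply[OF assms(1,2), symmetric] sx[symmetric]
        yx[symmetric]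
      by (simp add: mv.add_left mv.diff_left mv.add_right matrix_vector_mul_assoc)
    also have "\<dots> = mdiff A (cmap c) p (D p v (\<lambda>q. \<sigma> q *v Y q) - \<sigma> p *v D p v Y)"
      by (simp add: linear_diff[OF linear_mdiff_chart] assms(1,2) sx endo_in_chart_apply)
    finally show ?thesis by (simp add: mdiff_chart_eq_iff assms(1,2))
  qed
  have "nabla_endo A D p v \<sigma> = ?B"
    unfolding nabla_endo_def
  proof (rule the_equality)
    show "\<forall>U Y. open U \<and> p \<in> U \<and> smooth_field A U Y \<longrightarrow>
        ?B *v Y p = D p v (\<lambda>q. \<sigma> q *v Y q) - \<sigma> p *v D p v Y"
      using B by blast
    fix B'
    assume B': "\<forall>U Y. open U \<and> p \<in> U \<and> smooth_field A U Y \<longrightarrow>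
        B' *v Y p = D p v (\<lambda>q. \<sigma> q *v Y q) - \<sigma> p *v D p v Y"
    show "B' = ?B"
      unfolding matrix_eq
    proof
      fix u
      let ?Y = "coordinate_field A c (mdiff A (cmap c) p u)"
      have "smooth_field A (cdom c) ?Y"
        by (rule smooth_field_coordinate[OF assms(1) order_refl open_chart[OF assms(1)]])
      then have "B' *v ?Y p = D p v (\<lambda>q. \<sigma> q *v ?Y q) - \<sigma> p *v D p v ?Y"
        using B' open_cdom[OF assms(1)] assms(2) by blast
      also have "\<dots> = ?B *v ?Y p"
        by (rule B[OF open_cdom[OF assms(1)] assms(2), symmetric]) fact
      finally have "B' *v ?Y p = ?B *v ?Y p" .
      then show "B' *v u = ?B *v u"
        by (simp add: coordinate_field_def tangent_vector_mdiff assms(1,2))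
    qed
  qed
  then show ?thesis by (simp add: endo_in_from_chart assms(1,2))
qed

end

section \<open>Para-quaternion algebra\<close>

lemma eq_neg_imp_zero:
  fixes x :: "'v::real_vector"
  assumes "x = - x" shows "x = 0"
proof -
  have "2 *\<^sub>R x = x + x" by (rule scaleR_2)
  also have "\<dots> = 0" using assms by (metis add.right_inverse)
  finally show ?thesis by simp
qed

locale para_quaternion_triple =
  fixes j1 j2 j3 :: "real ^ 'm ^ 'm"
  assumes sq1: "j1 ** j1 = mat 1" and sq2: "j2 ** j2 = mat 1" and sq3: "j3 ** j3 = - mat 1"
    and mul12: "j1 ** j2 = j3" and mul21: "j2 ** j1 = - j3"
begin

lemma mul13: "j1 ** j3 = j2"
  by (metis mul12 sq1 matrix_mul_assoc matrix_mul_lid)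

lemma mul32: "j3 ** j2 = j1"
  by (metis mul12 sq2 matrix_mul_assoc matrix_mul_rid)

lemma mul31: "j3 ** j1 = - j2"
proof -
  have "j3 ** j1 = - (j2 ** j1) ** j1" by (simp add: mul21)
  also have "\<dots> = - j2" by (simp add: mm.minus_left sq1 flip: matrix_mul_assoc)
  finally show ?thesis .
qed

lemma mul23: "j2 ** j3 = - j1"
proof -
  have "j2 ** j3 = j2 ** (- (j2 ** j1))" by (simp add: mul21)
  also have "\<dots> = - j1" by (simp add: mm.minus_right sq2 matrix_mul_assoc)
  finally show ?thesis .
qed

lemmas mul_table = sq1 sq2 sq3 mul12 mul21 mul13 mul32 mul31 mul23

definition comb :: "real \<Rightarrow> real \<Rightarrow> real \<Rightarrow> real ^ 'm ^ 'm" where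
  "comb a1 a2 a3 = a1 *\<^sub>R j1 + a2 *\<^sub>R j2 + a3 *\<^sub>R j3"

lemma span_iff_comb: "B \<in> span {j1, j2, j3} \<longleftrightarrow> (\<exists>a1 a2 a3. B = comb a1 a2 a3)"
  unfolding span_breakdown_eq span_empty comb_def
  by (auto simp: algebra_simps eq_diff_eq)

lemma comb_in_span: "comb a1 a2 a3 \<in> span {j1, j2, j3}"
  using span_iff_comb by blast

lemma comb_mult: "comb a1 a2 a3 ** comb b1 b2 b3 =
    (a1 * b1 + a2 * b2 - a3 * b3) *\<^sub>R mat 1 +
    comb (a3 * b2 - a2 * b3) (a1 * b3 - a3 * b1) (a1 * b2 - a2 * b1)"
  by (simp add: comb_def matrix_distribs mul_table algebra_simps)

lemma comb_anticommutator: "comb a1 a2 a3 ** comb b1 b2 b3 + comb b1 b2 b3 ** comb a1 a2 a3 =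
    (2 * (a1 * b1 + a2 * b2 - a3 * b3)) *\<^sub>R mat 1"
  by (simp add: comb_mult) (simp add: comb_def algebra_simps flip: scaleR_add_left)

lemma comb_square: "comb a1 a2 a3 ** comb a1 a2 a3 = (a1\<^sup>2 + a2\<^sup>2 - a3\<^sup>2) *\<^sub>R mat 1"
  by (simp add: comb_mult power2_eq_square) (simp add: comb_def)

lemma mat_1_nonzero [simp]: "(mat 1 :: real ^ 'm ^ 'm) \<noteq> 0"
  by (simp add: vec_eq_iff mat_def)

lemma scaleR_mat_eq_iff: "r *\<^sub>R (mat 1 :: real ^ 'm ^ 'm) = s *\<^sub>R mat 1 \<longleftrightarrow> r = s"
  by simp

lemma trace_scaleR: "trace (r *\<^sub>R (B :: real ^ 'm ^ 'm)) = r * trace B"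
  by (simp add: trace_def sum_distrib_left)

lemma trace_minus: "trace (- (B :: real ^ 'm ^ 'm)) = - trace B"
  using trace_scaleR[of "-1" B] by simp

lemma trace_basis: "trace j1 = 0" "trace j2 = 0" "trace j3 = 0"
proof -
  have "trace (j3 ** j2) = trace (j2 ** j3)" "trace (j1 ** j3) = trace (j3 ** j1)"
    "trace (j1 ** j2) = trace (j2 ** j1)" by (rule trace_mul_sym)+
  then show "trace j1 = 0" "trace j2 = 0" "trace j3 = 0" by (simp_all add: mul_table trace_minus)
qed

lemma trace_comb: "trace (comb a1 a2 a3) = 0"
  by (simp add: comb_def trace_add trace_scaleR trace_basis)

text \<open>Since distinct basis elements anticommute, their products have trace \<open>0\<close>. So traces recover
  the coefficients, and with respect to a smooth frame the coefficients are differentiable along with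
  the element.\<close>

lemma trace_basis_comb:
  "trace (j1 ** comb a1 a2 a3) = a1 * real CARD('m)"
  "trace (j2 ** comb a1 a2 a3) = a2 * real CARD('m)"
  "trace (j3 ** comb a1 a2 a3) = - a3 * real CARD('m)"
  by (simp_all add: comb_def matrix_distribs mul_table trace_add trace_sub trace_scaleR trace_basis
      trace_I trace_minus)

lemma comb_eq_0_iff: "comb a1 a2 a3 = 0 \<longleftrightarrow> a1 = 0 \<and> a2 = 0 \<and> a3 = 0"
proof
  assume *: "comb a1 a2 a3 = 0"
  have "trace (0 :: real ^ 'm ^ 'm) = 0" by (simp add: trace_def)
  then show "a1 = 0 \<and> a2 = 0 \<and> a3 = 0"
    using trace_basis_comb(1)[of a1 a2 a3, unfolded *] trace_basis_comb(2)[of a1 a2 a3, unfolded *]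
      trace_basis_comb(3)[of a1 a2 a3, unfolded *]
    by (simp add: mm.zero_right)
qed (simp add: comb_def)

lemma scalar_plus_comb_eq_0:
  assumes "r *\<^sub>R mat 1 + comb a1 a2 a3 = 0"
  shows "r = 0" "a1 = 0" "a2 = 0" "a3 = 0"
proof -
  have "trace (r *\<^sub>R (mat 1 :: real ^ 'm ^ 'm) + comb a1 a2 a3) = r * real CARD('m)"
    by (simp add: trace_add trace_scaleR trace_comb trace_I)
  moreover have "trace (0 :: real ^ 'm ^ 'm) = 0" by (simp add: trace_def)
  ultimately show "r = 0" using assms by simp
  then show "a1 = 0" "a2 = 0" "a3 = 0" using assms comb_eq_0_iff by auto
qed

lemma anticommute_imp_mult_in_span:
  assumes "B \<in> span {j1, j2, j3}" "C \<in> span {j1, j2, j3}" "B ** C + C ** B = 0"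
  shows "B ** C \<in> span {j1, j2, j3}"
proof -
  obtain b1 b2 b3 c1 c2 c3 where bc: "B = comb b1 b2 b3" "C = comb c1 c2 c3"
    using assms(1,2) unfolding span_iff_comb by blast
  have "b1 * c1 + b2 * c2 - b3 * c3 = 0"
    using assms(3) unfolding bc comb_anticommutator by simp
  then show ?thesis unfolding bc comb_mult by (simp add: comb_in_span)
qed

text \<open>The imaginary part of a product of imaginary elements is a cross product up to signs.\<close>

lemma mult_eq_0_imp_proportional:
  assumes "F \<in> span {j1, j2, j3}" "N \<in> span {j1, j2, j3}" "F ** N = 0" "N \<noteq> 0"
  shows "\<exists>r. F = r *\<^sub>R N"
proof -
  obtain f1 f2 f3 n1 n2 n3 where fn: "F = comb f1 f2 f3" "N = comb n1 n2 n3"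
    using assms(1,2) unfolding span_iff_comb by blast
  have eq: "f3 * n2 = f2 * n3" "f1 * n3 = f3 * n1" "f1 * n2 = f2 * n1"
    using scalar_plus_comb_eq_0[OF assms(3)[unfolded fn comb_mult]] by auto
  have s: "F = r *\<^sub>R N" if "f1 = r * n1" "f2 = r * n2" "f3 = r * n3" for r
    using that by (simp add: fn comb_def algebra_simps)
  consider "n1 \<noteq> 0" | "n2 \<noteq> 0" | "n3 \<noteq> 0" using assms(4) fn comb_eq_0_iff by blast
  then show ?thesis
  proof cases
    case 1
    then have "F = (f1 / n1) *\<^sub>R N" using eq by (intro s) (simp_all add: field_simps)
    then show ?thesis by blast
  next
    case 2
    then have "F = (f2 / n2) *\<^sub>R N" using eq by (intro s) (simp_all add: field_simps)
    then show ?thesis by blast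
  next
    case 3
    then have "F = (f3 / n3) *\<^sub>R N" using eq by (intro s) (simp_all add: field_simps)
    then show ?thesis by blast
  qed
qed

lemma CARD_le_of_spanning:
  assumes "finite S" "\<And>v :: real ^ 'm. v \<in> span S"
  shows "CARD('m) \<le> card S"
  using dim_le_card[of UNIV S] assms by (auto simp: subset_iff)

text \<open>A nonzero vertical element \<open>N = \<delta> X\<close> is invertible here, so that every vector is of the form
  \<open>N Y = \<delta> Y X\<close> and hence a combination of the images of \<open>X\<close> under the three basis elements.\<close>

lemma symmetric_vertical_form_zero_twistor:
  fixes \<delta> :: "real ^ 'm \<Rightarrow> real ^ 'm ^ 'm"
  assumes J: "J \<in> span {j1, j2, j3}" "J ** J = - mat 1"
    and vert: "\<And>X. \<delta> X \<in> span {j1, j2, j3}" "\<And>X. \<delta> X ** J + J ** \<delta> X = 0"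
    and sym: "\<And>X Y. \<delta> X *v Y = \<delta> Y *v X"
    and dim: "CARD('m) \<ge> 4"
  shows "\<delta> X = 0"
proof (rule ccontr)
  assume nz: "\<delta> X \<noteq> 0"
  obtain a1 a2 a3 n1 n2 n3 where an: "J = comb a1 a2 a3" "\<delta> X = comb n1 n2 n3"
    using J(1) vert(1) unfolding span_iff_comb by blast
  define \<nu> where "\<nu> = n1\<^sup>2 + n2\<^sup>2 - n3\<^sup>2"
  have N2: "\<delta> X ** \<delta> X = \<nu> *\<^sub>R mat 1" unfolding an \<nu>_def by (rule comb_square)
  have Qa: "a1\<^sup>2 + a2\<^sup>2 - a3\<^sup>2 = -1"
    using J(2) scaleR_mat_eq_iff[of _ "-1"] unfolding an comb_square by simp
  have Qan: "n1 * a1 + n2 * a2 = n3 * a3"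
    using vert(2)[of X] unfolding an comb_anticommutator by simp
  \<comment> \<open>The form is negative at \<open>J\<close>, hence definite on the orthogonal complement of \<open>J\<close>.\<close>
  have "\<nu> \<noteq> 0"
  proof
    assume "\<nu> = 0"
    then have n3: "n3\<^sup>2 = n1\<^sup>2 + n2\<^sup>2" by (simp add: \<nu>_def)
    have "(n1 * a1 + n2 * a2)\<^sup>2 \<le> (n1\<^sup>2 + n2\<^sup>2) * (a1\<^sup>2 + a2\<^sup>2)"
      using zero_le_power2[of "n1 * a2 - n2 * a1"] by (simp add: power2_eq_square algebra_simps)
    moreover have "a1\<^sup>2 + a2\<^sup>2 = a3\<^sup>2 - 1" using Qa by simp
    ultimately have "n3\<^sup>2 * a3\<^sup>2 \<le> n3\<^sup>2 * (a3\<^sup>2 - 1)"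
      by (simp only: Qan power_mult_distrib n3)
    then have "n3 = 0" by (simp add: algebra_simps)
    moreover from this n3 have "n1\<^sup>2 + n2\<^sup>2 = 0" by simp
    ultimately show False using nz unfolding an by (simp add: comb_def sum_power2_eq_zero_iff)
  qed
  have "v \<in> span {j1 *v X, j2 *v X, j3 *v X}" for v
  proof -
    let ?Y = "(1 / \<nu>) *\<^sub>R (\<delta> X *v v)"
    have "v = \<delta> X *v ?Y"
      using \<open>\<nu> \<noteq> 0\<close> by (simp add: mv.scaleR_right mv.scaleR_left matrix_vector_mul_assoc N2)
    also have "\<dots> = \<delta> ?Y *v X" by (rule sym)
    finally have v: "v = \<delta> ?Y *v X" .
    obtain b1 b2 b3 where "\<delta> ?Y = comb b1 b2 b3" using vert(1) unfolding span_iff_comb by blast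
    then have "v = b1 *\<^sub>R (j1 *v X) + b2 *\<^sub>R (j2 *v X) + b3 *\<^sub>R (j3 *v X)"
      using v by (simp add: comb_def mv.add_left mv.scaleR_left)
    then show ?thesis by (simp add: span_add span_scale span_base)
  qed
  then have "CARD('m) \<le> card {j1 *v X, j2 *v X, j3 *v X}"
    by (intro CARD_le_of_spanning) auto
  also have "\<dots> \<le> 3" by (simp add: card_insert_if)
  finally show False using dim by simp
qed

text \<open>Here nonzero vertical elements can be singular. The form splits along the eigenspaces of \<open>J\<close>
  into pieces with values in a line of nilpotents; a nonzero nilpotent \<open>N\<close> of the algebra is so large
  that its range and one translate of it already span the whole space, whereas symmetry forces the
  range to be a line.\<close>

lemma symmetric_vertical_form_zero_reflector:
  fixes \<delta> :: "real ^ 'm \<Rightarrow> real ^ 'm ^ 'm"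
  assumes J: "J ** J = mat 1"
    and lin: "linear \<delta>"
    and vert: "\<And>X. \<delta> X \<in> span {j1, j2, j3}" "\<And>X. \<delta> X ** J + J ** \<delta> X = 0"
    and equiv: "\<And>X. \<delta> (J *v X) = - (J ** \<delta> X)"
    and sym: "\<And>X Y. \<delta> X *v Y = \<delta> Y *v X"
    and dim: "CARD('m) \<ge> 4"
  shows "\<delta> X = 0"
proof (rule ccontr)
  assume nz: "\<delta> X \<noteq> 0"
  have eigen: "J *v (X + s *\<^sub>R (J *v X)) = s *\<^sub>R (X + s *\<^sub>R (J *v X))" if "s * s = 1" for s X
    using that by (simp add: mv.add_right mv.scaleR_right matrix_vector_mul_assoc J algebra_simps)
  have split: "X = (1/2) *\<^sub>R (X + s *\<^sub>R (J *v X)) + (1/2) *\<^sub>R (X + (- s) *\<^sub>R (J *v X))" for s X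
    by (simp add: algebra_simps flip: scaleR_add_left)
  obtain s X1 where s: "s * s = (1::real)" and X1: "J *v X1 = s *\<^sub>R X1" "\<delta> X1 \<noteq> 0"
  proof -
    have "\<delta> X = (1/2) *\<^sub>R \<delta> (X + 1 *\<^sub>R (J *v X)) + (1/2) *\<^sub>R \<delta> (X + (-1) *\<^sub>R (J *v X))"
      by (subst split[of X 1]) (simp only: linear_add[OF lin] linear_cmul[OF lin])
    then have "\<delta> (X + 1 *\<^sub>R (J *v X)) \<noteq> 0 \<or> \<delta> (X + (-1) *\<^sub>R (J *v X)) \<noteq> 0"
      using nz by auto
    then show ?thesis
    proof
      assume "\<delta> (X + 1 *\<^sub>R (J *v X)) \<noteq> 0"
      then show ?thesis by (rule that[OF _ eigen, rotated 2]) simp_all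
    next
      assume "\<delta> (X + (-1) *\<^sub>R (J *v X)) \<noteq> 0"
      then show ?thesis by (rule that[OF _ eigen, rotated 2]) simp_all
    qed
  qed
  define N where "N = \<delta> X1"
  have val: "J ** \<delta> Y = - t *\<^sub>R \<delta> Y" if "J *v Y = t *\<^sub>R Y" for t Y
  proof -
    have "t *\<^sub>R \<delta> Y = - (J ** \<delta> Y)" using equiv[of Y] that linear_cmul[OF lin] by metis
    then show ?thesis by simp
  qed
  have anti: "\<delta> Y ** J = - (J ** \<delta> Y)" for Y using vert(2)[of Y] by (simp add: eq_neg_iff_add_eq_0)
  \<comment> \<open>On the eigenspace of \<open>X1\<close> the values of \<open>\<delta>\<close> are multiples of \<open>N\<close>; on the other one they
    annihilate \<open>X1\<close>.\<close>
  have range: "N *v Y \<in> span {N *v X1}" for Y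
  proof -
    let ?P = "Y + s *\<^sub>R (J *v Y)" and ?M = "Y + (- s) *\<^sub>R (J *v Y)"
    have P: "J *v ?P = s *\<^sub>R ?P" by (rule eigen[OF s])
    have M: "J *v ?M = (- s) *\<^sub>R ?M" by (rule eigen) (use s in simp)
    have "\<delta> ?P ** N = 0"
    proof -
      have JN: "J ** N = - s *\<^sub>R N" unfolding N_def by (rule val[OF X1(1)])
      have "\<delta> ?P ** (J ** N) = - s *\<^sub>R (\<delta> ?P ** N)" by (simp add: JN matrix_distribs)
      moreover have "\<delta> ?P ** (J ** N) = s *\<^sub>R (\<delta> ?P ** N)"
        by (simp add: matrix_mul_assoc anti val[OF P] matrix_distribs)
      ultimately have "s *\<^sub>R (\<delta> ?P ** N) = 0" by (intro eq_neg_imp_zero) simp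
      moreover have "s \<noteq> 0" using s by auto
      ultimately show ?thesis by simp
    qed
    moreover have "N \<in> span {j1, j2, j3}" "N \<noteq> 0" unfolding N_def by (rule vert(1), rule X1(2))
    ultimately obtain r where r: "\<delta> ?P = r *\<^sub>R N"
      using mult_eq_0_imp_proportional[OF vert(1)] by blast
    have "\<delta> M *v X1 = 0" if M: "J *v M = (- s) *\<^sub>R M" for M
    proof -
      have "\<delta> M *v (J *v X1) = s *\<^sub>R (\<delta> M *v X1)" by (simp add: X1(1) mv.scaleR_right)
      moreover have "\<delta> M *v (J *v X1) = - s *\<^sub>R (\<delta> M *v X1)"
        by (simp add: matrix_vector_mul_assoc anti val[OF M] mv.minus_left mv.scaleR_left)
      ultimately have "s *\<^sub>R (\<delta> M *v X1) = 0" by (intro eq_neg_imp_zero) simp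
      moreover have "s \<noteq> 0" using s by auto
      ultimately show ?thesis by simp
    qed
    then have "\<delta> ?M *v X1 = 0" using M by blast
    have "N *v Y = \<delta> Y *v X1" unfolding N_def by (rule sym)
    also have "\<delta> Y = (1/2) *\<^sub>R \<delta> ?P + (1/2) *\<^sub>R \<delta> ?M"
      by (subst split[of Y s]) (simp only: linear_add[OF lin] linear_cmul[OF lin])
    also have "\<dots> *v X1 = (r / 2) *\<^sub>R (N *v X1)"
      by (simp only: mv.add_left mv.scaleR_left r \<open>\<delta> ?M *v X1 = 0\<close>) simp
    finally show ?thesis by (simp add: span_scale span_base)
  qed
  obtain n1 n2 n3 where n: "N = comb n1 n2 n3"
    using vert(1)[of X1] unfolding N_def span_iff_comb by blast
  \<comment> \<open>The norm form is nondegenerate, so some basis element is not orthogonal to \<open>N\<close>.\<close>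
  obtain j k where jk: "k \<noteq> 0" "j ** N + N ** j = k *\<^sub>R mat 1"
  proof -
    have "j1 ** N + N ** j1 = (2 * n1) *\<^sub>R mat 1" "j2 ** N + N ** j2 = (2 * n2) *\<^sub>R mat 1"
      "j3 ** N + N ** j3 = (- 2 * n3) *\<^sub>R mat 1"
      using comb_anticommutator[of 1 0 0 n1 n2 n3] comb_anticommutator[of 0 1 0 n1 n2 n3]
        comb_anticommutator[of 0 0 1 n1 n2 n3]
      by (simp_all add: n comb_def[of 1 0 0] comb_def[of 0 1 0] comb_def[of 0 0 1])
    moreover have "2 * n1 \<noteq> 0 \<or> 2 * n2 \<noteq> 0 \<or> - 2 * n3 \<noteq> 0"
      using X1(2) comb_eq_0_iff[of n1 n2 n3] unfolding N_def[symmetric] n by simp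
    ultimately show ?thesis using that by blast
  qed
  have "v \<in> span {N *v X1, j *v (N *v X1)}" for v
  proof -
    obtain r t where rt: "N *v v = r *\<^sub>R (N *v X1)" "N *v (j *v v) = t *\<^sub>R (N *v X1)"
      using range[of v] range[of "j *v v"] by (auto simp: span_singleton)
    have "k *\<^sub>R v = (j ** N + N ** j) *v v" by (simp add: jk(2) mv.scaleR_left)
    also have "\<dots> = r *\<^sub>R (j *v (N *v X1)) + t *\<^sub>R (N *v X1)"
      by (simp add: mv.add_left rt mv.scaleR_right flip: matrix_vector_mul_assoc)
    finally have "k *\<^sub>R v \<in> span {N *v X1, j *v (N *v X1)}"
      by (simp add: span_add span_scale span_base)
    then have "(1 / k) *\<^sub>R (k *\<^sub>R v) \<in> span {N *v X1, j *v (N *v X1)}" by (rule span_scale)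
    then show ?thesis using jk(1) by simp
  qed
  then have "CARD('m) \<le> card {N *v X1, j *v (N *v X1)}"
    by (intro CARD_le_of_spanning) auto
  also have "\<dots> \<le> 2" by (simp add: card_insert_if)
  finally show False using dim by simp
qed

end

section \<open>The canonical structures in a chart\<close>

definition commutator :: "real ^ 'm ^ 'm \<Rightarrow> real ^ 'm ^ 'm \<Rightarrow> real ^ 'm ^ 'm" where
  "commutator G B = G ** B - B ** G"

lemma commutator_combination:
  "commutator G (a1 *\<^sub>R B1 + a2 *\<^sub>R B2 + a3 *\<^sub>R B3) =
    a1 *\<^sub>R commutator G B1 + a2 *\<^sub>R commutator G B2 + a3 *\<^sub>R commutator G B3"
  by (simp add: commutator_def matrix_distribs algebra_simps)

lemma commutator_anticommutes:
  assumes "B ** B = e *\<^sub>R mat 1"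
  shows "commutator G B ** B + B ** commutator G B = 0"
proof -
  have "commutator G B ** B + B ** commutator G B = G ** (B ** B) - (B ** B) ** G"
    by (simp add: commutator_def matrix_distribs matrix_mul_assoc)
  then show ?thesis by (simp add: assms matrix_distribs)
qed

locale para_quaternionic_chart = framed_manifold A
  for A :: "('a::{t2_space,second_countable_topology}, real ^ 'm) chart set" +
  fixes P :: "'a \<Rightarrow> (real ^ 'm ^ 'm) set" and c :: "('a, real ^ 'm) chart"
    and U :: "'a set" and J1 J2 J3 :: "'a \<Rightarrow> real ^ 'm ^ 'm"
  assumes c: "c \<in> A" and open_U: "open U" and U_subset: "U \<subseteq> cdom c"
    and basis: "admissible_local_basis A P U J1 J2 J3"
begin

abbreviation "ec \<equiv> endo_in_chart A c"
abbreviation "EC \<equiv> endo_chart A c"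
abbreviation "S \<equiv> cmap c ` U"

definition "j1 x = ec (cinv c x) (J1 (cinv c x))"
definition "j2 x = ec (cinv c x) (J2 (cinv c x))"
definition "j3 x = ec (cinv c x) (J3 (cinv c x))"

abbreviation "fibre x \<equiv> span {j1 x, j2 x, j3 x}"

lemma in_cdom: "p \<in> U \<Longrightarrow> p \<in> cdom c"
  using U_subset by blast

lemma open_S: "open S"
  by (rule open_image[OF c open_U U_subset])

lemma S_cases:
  assumes "x \<in> S" obtains p where "p \<in> U" "x = cmap c p" "cinv c x = p"
  using assms cinv_cmap[OF c in_cdom] by blast

lemma smooth_frame: "smooth_endo A U J1" "smooth_endo A U J2" "smooth_endo A U J3"
  using basis unfolding admissible_local_basis_def by simp_all

lemma smooth_j: "smooth_on S j1" "smooth_on S j2" "smooth_on S j3"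
proof -
  have U: "cdom c \<inter> U = U" using U_subset by blast
  have "smooth_on S (\<lambda>x. ec (cinv c x) (\<sigma> (cinv c x)))" if "smooth_endo A U \<sigma>" for \<sigma>
    using bspec[OF that[unfolded smooth_endo_def] c] U by simp
  then show "smooth_on S j1" "smooth_on S j2" "smooth_on S j3"
    unfolding j1_def[abs_def] j2_def[abs_def] j3_def[abs_def] using smooth_frame by simp_all
qed

lemma j_at: "p \<in> U \<Longrightarrow> j1 (cmap c p) = ec p (J1 p)" "p \<in> U \<Longrightarrow> j2 (cmap c p) = ec p (J2 p)"
  "p \<in> U \<Longrightarrow> j3 (cmap c p) = ec p (J3 p)"
  by (simp_all add: j1_def j2_def j3_def cinv_cmap c in_cdom)

lemma triple:
  assumes "x \<in> S" shows "para_quaternion_triple (j1 x) (j2 x) (j3 x)"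
proof -
  obtain p where p: "p \<in> U" "x = cmap c p" using S_cases[OF assms] by blast
  have J: "J1 p ** J1 p = mat 1" "J2 p ** J2 p = mat 1" "J3 p ** J3 p = - mat 1"
    "J1 p ** J2 p = J3 p" "J2 p ** J1 p = - J3 p"
    using basis p(1) unfolding admissible_local_basis_def by blast+
  note pc = c in_cdom[OF p(1)]
  note sim = linear_neg[OF linear_endo_in_chart[OF pc]] endo_in_chart_one[OF pc]
  show ?thesis
    unfolding para_quaternion_triple_def p(2) j_at[OF p(1)]
    by (simp add: J sim flip: endo_in_chart_mult[OF pc])
qed

lemma in_fibre_iff:
  assumes "p \<in> U" shows "ec p J \<in> fibre (cmap c p) \<longleftrightarrow> J \<in> P p"
proof -
  note pc = c in_cdom[OF assms]
  have P: "P p = span {J1 p, J2 p, J3 p}"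
    using basis assms unfolding admissible_local_basis_def by blast
  have "fibre (cmap c p) = ec p ` P p"
    using linear_span_image[OF linear_endo_in_chart[OF pc], of "{J1 p, J2 p, J3 p}"]
    by (simp add: P j_at assms)
  moreover have "inj (ec p)" by (rule injI) (simp add: endo_in_chart_eq_iff[OF pc])
  ultimately show ?thesis by (simp add: inj_image_mem_iff)
qed

lemma square_in_chart:
  assumes "p \<in> U"
  shows "ec p J ** ec p J = e *\<^sub>R mat 1 \<longleftrightarrow> J ** J = e *\<^sub>R mat 1"
proof -
  note pc = c in_cdom[OF assms]
  have "ec p (e *\<^sub>R mat 1) = e *\<^sub>R mat 1"
    by (simp add: linear_cmul[OF linear_endo_in_chart[OF pc]] endo_in_chart_one[OF pc])
  then show ?thesis
    using endo_in_chart_eq_iff[OF pc, of "J ** J" "e *\<^sub>R mat 1"] endo_in_chart_mult[OF pc, of J J] by simp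
qed

lemma vertical_space_iff:
  assumes "p \<in> U"
  shows "B \<in> vertical_space P (p, J) \<longleftrightarrow>
    ec p B \<in> fibre (cmap c p) \<and> ec p B ** ec p J + ec p J ** ec p B = 0"
proof -
  note pc = c in_cdom[OF assms]
  have "ec p B ** ec p J + ec p J ** ec p B = ec p (B ** J + J ** B)"
    by (simp add: endo_in_chart_mult[OF pc] linear_add[OF linear_endo_in_chart[OF pc]])
  then have "ec p B ** ec p J + ec p J ** ec p B = 0 \<longleftrightarrow> B ** J + J ** B = 0"
    using endo_in_chart_eq_iff[OF pc, of "B ** J + J ** B" 0] linear_0[OF linear_endo_in_chart[OF pc]]
    by simp
  then show ?thesis by (simp add: vertical_space_def in_fibre_iff[OF assms])
qed

text \<open>\<open>Z e\<close> is the twistor space for \<open>e = -1\<close> and the reflector space for \<open>e = 1\<close>.\<close>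

definition Z :: "real \<Rightarrow> ('a \<times> (real ^ 'm ^ 'm)) set" where
  "Z e = {(p, J). J \<in> P p \<and> J ** J = e *\<^sub>R mat 1}"

lemma in_Z_iff:
  assumes "p \<in> U"
  shows "(p, J) \<in> Z e \<longleftrightarrow> ec p J \<in> fibre (cmap c p) \<and> ec p J ** ec p J = e *\<^sub>R mat 1"
  by (simp add: Z_def in_fibre_iff[OF assms] square_in_chart[OF assms])

abbreviation \<Phi> :: "'a \<times> (real ^ 'm ^ 'm) \<Rightarrow> (real ^ 'm) \<times> (real ^ 'm ^ 'm) \<Rightarrow> (real ^ 'm) \<times> (real ^ 'm ^ 'm)"
  where "\<Phi> z \<equiv> mdiff (endo_atlas A) (cmap EC) z"

lemma EC_in: "EC \<in> endo_atlas A" by (rule endo_chart_in[OF c])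

lemma linear_\<Phi>: "p \<in> U \<Longrightarrow> linear (\<Phi> (p, J))"
  by (rule E.linear_mdiff_chart[OF EC_in]) (simp add: in_cdom)

lemma \<Phi>_eq_iff: "p \<in> U \<Longrightarrow> \<Phi> (p, J) V = \<Phi> (p, J) W \<longleftrightarrow> V = W"
  by (rule E.mdiff_chart_eq_iff[OF EC_in]) (simp add: in_cdom)

lemma \<Phi>_surj: "p \<in> U \<Longrightarrow> \<exists>W. \<Phi> (p, J) W = V"
  by (rule exI, rule E.mdiff_tangent_vector[OF EC_in]) (simp add: in_cdom)

lemma section_differential:
  assumes "p \<in> U" "open V" "p \<in> V" "smooth_endo A V \<sigma>"
  shows "\<Phi> (p, \<sigma> p) (tangent_map A (endo_atlas A) (\<lambda>q. (q, \<sigma> q)) p v) =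
    (mdiff A (cmap c) p v,
     frechet_derivative (\<lambda>x. ec (cinv c x) (\<sigma> (cinv c x))) (at (cmap c p)) (mdiff A (cmap c) p v))"
proof -
  let ?s = "\<lambda>x. ec (cinv c x) (\<sigma> (cinv c x))" and ?x = "cmap c p"
  let ?T = "cmap c ` (cdom c \<inter> V)"
  have T: "open ?T" "?x \<in> ?T"
    using open_imp_mopen[OF assms(2)] c assms in_cdom by (auto simp: mopen_def)
  have ds: "(?s has_derivative frechet_derivative ?s (at ?x)) (at ?x)"
    using assms(4) c T(2) smooth_on_has_derivative unfolding smooth_endo_def by blast
  have "\<Phi> ((\<lambda>q. (q, \<sigma> q)) p) (tangent_map A (endo_atlas A) (\<lambda>q. (q, \<sigma> q)) p v) =
    (\<lambda>w. (w, frechet_derivative ?s (at ?x) w)) (mdiff A (cmap c) p v)"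
  proof (rule tangent_map_in_chart[OF smooth_atlas_endo c EC_in])
    show "\<forall>\<^sub>F y in nhds ?x. (cinv c y, \<sigma> (cinv c y)) \<in> cdom EC"
      using eventually_nhds_in_open[OF T] by eventually_elim (auto simp: cinv_cmap c)
    show "(cmap EC \<circ> (\<lambda>q. (q, \<sigma> q)) \<circ> cinv c has_derivative (\<lambda>w. (w, frechet_derivative ?s (at ?x) w))) (at ?x)"
      by (rule has_derivative_transform_within_open[OF has_derivative_Pair[OF has_derivative_ident ds] T])
        (auto simp: cinv_cmap c)
  qed (use assms in_cdom in auto)
  then show ?thesis by simp
qed

definition frame_section ::
    "(real ^ 'm \<Rightarrow> real) \<Rightarrow> (real ^ 'm \<Rightarrow> real) \<Rightarrow> (real ^ 'm \<Rightarrow> real) \<Rightarrow> 'a \<Rightarrow> real ^ 'm ^ 'm" where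
  "frame_section f1 f2 f3 q = f1 (cmap c q) *\<^sub>R J1 q + f2 (cmap c q) *\<^sub>R J2 q + f3 (cmap c q) *\<^sub>R J3 q"

lemma frame_section_in_chart:
  assumes "y \<in> S"
  shows "ec (cinv c y) (frame_section f1 f2 f3 (cinv c y)) = f1 y *\<^sub>R j1 y + f2 y *\<^sub>R j2 y + f3 y *\<^sub>R j3 y"
proof -
  obtain q where q: "q \<in> U" "y = cmap c q" "cinv c y = q" using S_cases[OF assms] by blast
  note qc = c in_cdom[OF q(1)]
  show ?thesis
    unfolding q(3) unfolding q(2) j_at[OF q(1)] frame_section_def
    by (simp add: linear_add[OF linear_endo_in_chart[OF qc]] linear_cmul[OF linear_endo_in_chart[OF qc]])
qed

lemma smooth_endo_frame_section:
  assumes "smooth_on S f1" "smooth_on S f2" "smooth_on S f3"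
  shows "smooth_endo A U (frame_section f1 f2 f3)"
proof -
  have "smooth_on S (\<lambda>y. f1 y *\<^sub>R j1 y + f2 y *\<^sub>R j2 y + f3 y *\<^sub>R j3 y)"
    by (intro smooth_on_add smooth_on_scaleR open_S assms smooth_j)
  then have "smooth_on S (\<lambda>y. ec (cinv c y) (frame_section f1 f2 f3 (cinv c y)))"
    by (rule smooth_on_cong[OF open_S]) (simp add: frame_section_in_chart)
  then show ?thesis
    by (rule smooth_endoI[OF c U_subset open_S])
qed

lemma combination_in_P:
  assumes "q \<in> U" shows "a1 *\<^sub>R J1 q + a2 *\<^sub>R J2 q + a3 *\<^sub>R J3 q \<in> P q"
proof -
  have "P q = span {J1 q, J2 q, J3 q}" using basis assms unfolding admissible_local_basis_def by blast
  then show ?thesis by (simp add: span_add span_scale span_base)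
qed

end

locale para_quaternionic_chart_connection = para_quaternionic_chart A P c U J1 J2 J3
  for A :: "('a::{t2_space,second_countable_topology}, real ^ 'm) chart set"
    and P c U J1 J2 J3 +
  fixes D :: "('a, real ^ 'm) connection"
  assumes D: "D \<in> para_quaternionic_connections A P"

sublocale para_quaternionic_chart_connection \<subseteq> manifold_with_connection A D
  by unfold_locales (use D in \<open>simp add: para_quaternionic_connections_def\<close>)

context para_quaternionic_chart_connection
begin

abbreviation "G \<equiv> christoffel A D c"

lemma linear_G: "x \<in> S \<Longrightarrow> linear (G x)"
  using linear_christoffel[OF c] in_cdom by blast

lemma commutator_G_linear: "x \<in> S \<Longrightarrow> linear (\<lambda>w. commutator (G x w) B)"
  by (rule linearI)
    (simp_all add: commutator_def linear_add[OF linear_G] linear_cmul[OF linear_G] matrix_distribs algebra_simps)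

lemma covariant_derivative_frame:
  assumes "x \<in> S"
  shows "frechet_derivative j1 (at x) w + commutator (G x w) (j1 x) \<in> fibre x"
    "frechet_derivative j2 (at x) w + commutator (G x w) (j2 x) \<in> fibre x"
    "frechet_derivative j3 (at x) w + commutator (G x w) (j3 x) \<in> fibre x"
proof -
  obtain p where p: "p \<in> U" "x = cmap c p" "cinv c x = p" using S_cases[OF assms] .
  let ?v = "tangent_vector A c p w"
  have v: "mdiff A (cmap c) p ?v = w" by (rule mdiff_tangent_vector[OF c in_cdom[OF p(1)]])
  have gen: "frechet_derivative (\<lambda>x. ec (cinv c x) (\<sigma> (cinv c x))) (at x) w +
      commutator (G x w) (ec p (\<sigma> p)) \<in> fibre x"
    if s: "smooth_endo A U \<sigma>" "\<And>q. q \<in> U \<Longrightarrow> \<sigma> q \<in> P q" for \<sigma>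
  proof -
    have "local_section A P p \<sigma>" unfolding local_section_def using s open_U p(1) by blast
    then have "nabla_endo A D p ?v \<sigma> \<in> P p" using D unfolding para_quaternionic_connections_def by blast
    then have "ec p (nabla_endo A D p ?v \<sigma>) \<in> fibre x" using in_fibre_iff[OF p(1)] p(2) by simp
    then show ?thesis
      unfolding nabla_endo_in_chart[OF c in_cdom[OF p(1)] open_U p(1) s(1)] v p(2)[symmetric] p(3)
      by (simp add: commutator_def add_diff_eq)
  qed
  have mem: "J1 q \<in> P q" "J2 q \<in> P q" "J3 q \<in> P q" if "q \<in> U" for q
    using combination_in_P[OF that, of 1 0 0] combination_in_P[OF that, of 0 1 0]
      combination_in_P[OF that, of 0 0 1] by simp_all
  show "frechet_derivative j1 (at x) w + commutator (G x w) (j1 x) \<in> fibre x"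
    "frechet_derivative j2 (at x) w + commutator (G x w) (j2 x) \<in> fibre x"
    "frechet_derivative j3 (at x) w + commutator (G x w) (j3 x) \<in> fibre x"
    using gen[OF smooth_frame(1) mem(1)] gen[OF smooth_frame(2) mem(2)] gen[OF smooth_frame(3) mem(3)]
    by (simp_all add: p(3) j1_def[abs_def] j2_def[abs_def] j3_def[abs_def])
qed

text \<open>The square of a section with constant coefficients in the frame is a constant multiple of the
  identity. Therefore its covariant derivative \<open>E\<close>, which lies in the fibre because the connection
  preserves \<open>P\<close>, anticommutes with it.\<close>

lemma covariant_derivative_vertical:
  fixes w :: "real ^ 'm"
  assumes "x \<in> S" and B: "B = a1 *\<^sub>R j1 x + a2 *\<^sub>R j2 x + a3 *\<^sub>R j3 x"
  defines "E \<equiv> a1 *\<^sub>R frechet_derivative j1 (at x) w + a2 *\<^sub>R frechet_derivative j2 (at x) w +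
    a3 *\<^sub>R frechet_derivative j3 (at x) w + commutator (G x w) B"
  shows "E \<in> fibre x"
    and "B ** B = e *\<^sub>R mat 1 \<Longrightarrow> E ** B + B ** E = 0"
proof -
  have "E = a1 *\<^sub>R (frechet_derivative j1 (at x) w + commutator (G x w) (j1 x)) +
    a2 *\<^sub>R (frechet_derivative j2 (at x) w + commutator (G x w) (j2 x)) +
    a3 *\<^sub>R (frechet_derivative j3 (at x) w + commutator (G x w) (j3 x))"
    unfolding E_def B commutator_combination by (simp add: algebra_simps)
  then show "E \<in> fibre x"
    by (simp only:) (intro span_add span_scale covariant_derivative_frame assms(1))
  assume sq: "B ** B = e *\<^sub>R mat 1"
  define s where "s y = a1 *\<^sub>R j1 y + a2 *\<^sub>R j2 y + a3 *\<^sub>R j3 y" for y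
  define ds where "ds w = a1 *\<^sub>R frechet_derivative j1 (at x) w + a2 *\<^sub>R frechet_derivative j2 (at x) w +
    a3 *\<^sub>R frechet_derivative j3 (at x) w" for w
  have s: "(s has_derivative ds) (at x)"
    unfolding s_def[abs_def] ds_def[abs_def]
    by (intro has_derivative_add has_derivative_scaleR_right smooth_on_has_derivative[OF _ assms(1)] smooth_j)
  have "((\<lambda>y. s y ** s y) has_derivative (\<lambda>w. s x ** ds w + ds w ** s x)) (at x)"
    by (rule mm.FDERIV[OF s s])
  moreover have "((\<lambda>y. s y ** s y) has_derivative (\<lambda>w. 0)) (at x)"
  proof (rule has_derivative_transform_within_open[OF has_derivative_const open_S assms(1)])
    fix y assume "y \<in> S"
    then interpret T: para_quaternion_triple "j1 y" "j2 y" "j3 y" by (rule triple)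
    show "(a1\<^sup>2 + a2\<^sup>2 - a3\<^sup>2) *\<^sub>R mat 1 = s y ** s y"
      unfolding s_def T.comb_def[symmetric] T.comb_square by simp
  qed
  ultimately have "s x ** ds w + ds w ** s x = 0"
    by (rule has_derivative_unique[THEN fun_cong])
  moreover have "s x = B" by (simp add: s_def B)
  moreover have "E = ds w + commutator (G x w) B" by (simp add: E_def ds_def)
  ultimately have "E ** B + B ** E = commutator (G x w) B ** B + B ** commutator (G x w) B"
    by (simp add: matrix_distribs algebra_simps)
  then show "E ** B + B ** E = 0" by (simp add: commutator_anticommutes[OF sq])
qed

text \<open>In the frame, let the coefficients be affine functions of the coordinates with prescribed value
  and prescribed derivative in the direction \<open>w\<close>. The prescribed derivative lies in the fibre because the
  connection preserves \<open>P\<close>.\<close>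

lemma parallel_section_exists:
  assumes "p \<in> U" "J \<in> P p"
  shows "\<exists>\<sigma>. smooth_endo A U \<sigma> \<and> (\<forall>q\<in>U. \<sigma> q \<in> P q) \<and> \<sigma> p = J \<and>
    frechet_derivative (\<lambda>x. ec (cinv c x) (\<sigma> (cinv c x))) (at (cmap c p)) w =
      - commutator (G (cmap c p) w) (ec p J)"
proof -
  let ?x = "cmap c p"
  have xS: "?x \<in> S" using assms(1) by blast
  interpret T: para_quaternion_triple "j1 ?x" "j2 ?x" "j3 ?x" by (rule triple[OF xS])
  obtain a1 a2 a3 where a: "J = a1 *\<^sub>R J1 p + a2 *\<^sub>R J2 p + a3 *\<^sub>R J3 p"
    and ea: "ec p J = a1 *\<^sub>R j1 ?x + a2 *\<^sub>R j2 ?x + a3 *\<^sub>R j3 ?x"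
  proof -
    obtain a1 a2 a3 where "ec p J = a1 *\<^sub>R j1 ?x + a2 *\<^sub>R j2 ?x + a3 *\<^sub>R j3 ?x"
      using in_fibre_iff[OF assms(1), of J] assms(2) unfolding T.span_iff_comb T.comb_def by auto
    moreover from this have "ec p J = ec p (a1 *\<^sub>R J1 p + a2 *\<^sub>R J2 p + a3 *\<^sub>R J3 p)"
      using c in_cdom[OF assms(1)] assms(1)
      by (simp add: j_at linear_add[OF linear_endo_in_chart] linear_cmul[OF linear_endo_in_chart])
    ultimately show ?thesis using that endo_in_chart_eq_iff[OF c in_cdom[OF assms(1)]] by blast
  qed
  obtain b1 b2 b3 where b: "- (a1 *\<^sub>R frechet_derivative j1 (at ?x) w + a2 *\<^sub>R frechet_derivative j2 (at ?x) w +
      a3 *\<^sub>R frechet_derivative j3 (at ?x) w + commutator (G ?x w) (ec p J)) =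
      b1 *\<^sub>R j1 ?x + b2 *\<^sub>R j2 ?x + b3 *\<^sub>R j3 ?x"
    using span_neg[OF covariant_derivative_vertical(1)[OF xS ea, of w]]
    unfolding T.span_iff_comb T.comb_def ea[symmetric] by blast
  \<comment> \<open>A linear form with \<open>l w = 1\<close>. For \<open>w = 0\<close> it is zero, and there is nothing to correct.\<close>
  define l where "l y = (y \<bullet> w) / (w \<bullet> w)" for y :: "real ^ 'm"
  have lin_l: "bounded_linear l"
    unfolding l_def[abs_def] by (rule bounded_linear_divide[THEN bounded_linear_compose, OF bounded_linear_inner_left])
  define f where "f a b y = a + b * l (y - ?x)" for a b y
  have df: "(f a b has_derivative (\<lambda>u. b * l u)) (at y)" for a b y
    unfolding f_def[abs_def]
    by (auto intro!: derivative_eq_intros bounded_linear.has_derivative[OF lin_l])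
  have smf: "smooth_on S (f a b)" for a b
    unfolding f_def[abs_def] linear_diff[OF bounded_linear.linear[OF lin_l]]
    by (intro smooth_on_add smooth_on_mult smooth_on_diff smooth_on_const smooth_on_linear open_S lin_l)
  have f0: "f a b ?x = a" for a b
    by (simp add: f_def linear_0[OF bounded_linear.linear[OF lin_l]])
  let ?\<sigma> = "frame_section (f a1 b1) (f a2 b2) (f a3 b3)"
  let ?s = "\<lambda>y. f a1 b1 y *\<^sub>R j1 y + f a2 b2 y *\<^sub>R j2 y + f a3 b3 y *\<^sub>R j3 y"
  let ?d = "\<lambda>u. (f a1 b1 ?x *\<^sub>R frechet_derivative j1 (at ?x) u + (b1 * l u) *\<^sub>R j1 ?x) +
    (f a2 b2 ?x *\<^sub>R frechet_derivative j2 (at ?x) u + (b2 * l u) *\<^sub>R j2 ?x) +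
    (f a3 b3 ?x *\<^sub>R frechet_derivative j3 (at ?x) u + (b3 * l u) *\<^sub>R j3 ?x)"
  have "(?s has_derivative ?d) (at ?x)"
    by (intro has_derivative_add has_derivative_scaleR df smooth_on_has_derivative[OF _ xS] smooth_j)
  then have "((\<lambda>x. ec (cinv c x) (?\<sigma> (cinv c x))) has_derivative ?d) (at ?x)"
    by (rule has_derivative_transform_within_open[OF _ open_S xS])
      (rule frame_section_in_chart[symmetric])
  then have d: "frechet_derivative (\<lambda>x. ec (cinv c x) (?\<sigma> (cinv c x))) (at ?x) = ?d"
    by (rule frechet_derivative_at[symmetric])
  have dw: "?d w = - commutator (G ?x w) (ec p J)"
  proof (cases "w = 0")
    case True
    have z: "frechet_derivative j1 (at ?x) 0 = 0" "frechet_derivative j2 (at ?x) 0 = 0"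
      "frechet_derivative j3 (at ?x) 0 = 0"
      by (rule linear_0[OF has_derivative_linear[OF smooth_on_has_derivative[OF _ xS]]], rule smooth_j)+
    show ?thesis
      by (simp add: True z l_def linear_0[OF commutator_G_linear[OF xS]])
  next
    case False
    then have "l w = 1" by (simp add: l_def)
    then have "?d w = (a1 *\<^sub>R frechet_derivative j1 (at ?x) w + a2 *\<^sub>R frechet_derivative j2 (at ?x) w +
      a3 *\<^sub>R frechet_derivative j3 (at ?x) w) + (b1 *\<^sub>R j1 ?x + b2 *\<^sub>R j2 ?x + b3 *\<^sub>R j3 ?x)"
      by (simp add: f0)
    also have "\<dots> = - commutator (G ?x w) (ec p J)" unfolding b[symmetric] by simp
    finally show ?thesis .
  qed
  have "smooth_endo A U ?\<sigma>" by (rule smooth_endo_frame_section[OF smf smf smf])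
  moreover have "\<forall>q\<in>U. ?\<sigma> q \<in> P q" by (simp add: frame_section_def combination_in_P)
  moreover have "?\<sigma> p = J" by (simp add: frame_section_def f0 a)
  ultimately show ?thesis using d dw by (intro exI[of _ ?\<sigma>]) auto
qed

text \<open>A section through \<open>J\<close> is parallel in the direction \<open>w\<close> exactly if the derivative of its chart
  expression is \<open>- [G w, J]\<close>, and every direction admits a parallel section. So the horizontal space is a graph
  over the tangent space of the base.\<close>

lemma horizontal_space_iff:
  assumes "p \<in> U" "J \<in> P p"
  shows "W \<in> horizontal_space A P D (p, J) \<longleftrightarrow>
    snd (\<Phi> (p, J) W) = - commutator (G (cmap c p) (fst (\<Phi> (p, J) W))) (ec p J)"
proof
  let ?x = "cmap c p"
  note pc = c in_cdom[OF assms(1)]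
  have nab: "nabla_endo A D p w \<sigma> = 0 \<longleftrightarrow>
      frechet_derivative (\<lambda>x. ec (cinv c x) (\<sigma> (cinv c x))) (at ?x) (mdiff A (cmap c) p w) =
      - commutator (G ?x (mdiff A (cmap c) p w)) (ec p J)"
    if "open V" "p \<in> V" "smooth_endo A V \<sigma>" "\<sigma> p = J" for w V \<sigma>
  proof -
    have "nabla_endo A D p w \<sigma> = 0 \<longleftrightarrow> ec p (nabla_endo A D p w \<sigma>) = 0"
      using endo_in_chart_eq_iff[OF pc, of _ 0] linear_0[OF linear_endo_in_chart[OF pc]] by simp
    then show ?thesis
      unfolding nabla_endo_in_chart[OF pc that(1-3)]
      by (simp add: cinv_cmap[OF pc] that(4) commutator_def eq_neg_iff_add_eq_0 algebra_simps)
  qed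
  {
    assume "W \<in> horizontal_space A P D (p, J)"
    then obtain \<sigma> w V where W: "W = tangent_map A (endo_atlas A) (\<lambda>q. (q, \<sigma> q)) p w" "\<sigma> p = J"
      "nabla_endo A D p w \<sigma> = 0" "open V" "p \<in> V" "smooth_endo A V \<sigma>"
      unfolding horizontal_space_def local_section_def by auto
    then show "snd (\<Phi> (p, J) W) = - commutator (G ?x (fst (\<Phi> (p, J) W))) (ec p J)"
      using section_differential[OF assms(1) W(4-6), of w] nab[OF W(4-6,2)] by simp
  next
    assume *: "snd (\<Phi> (p, J) W) = - commutator (G ?x (fst (\<Phi> (p, J) W))) (ec p J)"
    let ?w = "fst (\<Phi> (p, J) W)"
    let ?v = "tangent_vector A c p ?w"
    have v: "mdiff A (cmap c) p ?v = ?w" by (rule mdiff_tangent_vector[OF pc])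
    obtain \<sigma> where s: "smooth_endo A U \<sigma>" "\<forall>q\<in>U. \<sigma> q \<in> P q" "\<sigma> p = J"
      "frechet_derivative (\<lambda>x. ec (cinv c x) (\<sigma> (cinv c x))) (at ?x) ?w = - commutator (G ?x ?w) (ec p J)"
      using parallel_section_exists[OF assms] by blast
    have "\<Phi> (p, J) (tangent_map A (endo_atlas A) (\<lambda>q. (q, \<sigma> q)) p ?v) = \<Phi> (p, J) W"
      using section_differential[OF assms(1) open_U assms(1) s(1), of ?v] s(3,4) v *
      by (simp add: prod_eq_iff)
    then have "W = tangent_map A (endo_atlas A) (\<lambda>q. (q, \<sigma> q)) p ?v"
      by (simp add: \<Phi>_eq_iff assms(1))
    moreover have "nabla_endo A D p ?v \<sigma> = 0"
      using nab[OF open_U assms(1) s(1,3), of ?v] s(4) v by simp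
    moreover have "local_section A P p \<sigma>"
      unfolding local_section_def using s open_U assms(1) by blast
    ultimately show "W \<in> horizontal_space A P D (p, J)"
      unfolding horizontal_space_def using s(3) by blast
  }
qed

lemma hlift_in_chart:
  assumes "p \<in> U" "J \<in> P p"
  shows "\<Phi> (p, J) (hlift A P D (p, J) X) =
    (mdiff A (cmap c) p X, - commutator (G (cmap c p) (mdiff A (cmap c) p X)) (ec p J))"
proof -
  note pc = c in_cdom[OF assms(1)]
  let ?V = "(mdiff A (cmap c) p X, - commutator (G (cmap c p) (mdiff A (cmap c) p X)) (ec p J))"
  obtain W where W: "\<Phi> (p, J) W = ?V" using \<Phi>_surj[OF assms(1)] by blast
  have "W' \<in> horizontal_space A P D (p, J) \<and> proj_differential A (p, J) W' = X \<longleftrightarrow> W' = W" for W'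
  proof -
    have "proj_differential A (p, J) W' = X \<longleftrightarrow> fst (\<Phi> (p, J) W') = mdiff A (cmap c) p X"
      using mdiff_chart_eq_iff[OF pc, of "proj_differential A (p, J) W'" X]
      unfolding proj_differential_in_chart[OF pc] by blast
    then have "W' \<in> horizontal_space A P D (p, J) \<and> proj_differential A (p, J) W' = X \<longleftrightarrow>
        \<Phi> (p, J) W' = ?V"
      unfolding horizontal_space_iff[OF assms] by (auto simp: prod_eq_iff)
    then show ?thesis unfolding W[symmetric] \<Phi>_eq_iff[OF assms(1)] .
  qed
  then have "hlift A P D (p, J) X = W" unfolding hlift_def by auto
  then show ?thesis using W by simp
qed

lemma vproj_in_chart:
  assumes "p \<in> U" "J \<in> P p"
  defines "B \<equiv> \<lambda>W. snd (\<Phi> (p, J) W) + commutator (G (cmap c p) (fst (\<Phi> (p, J) W))) (ec p J)"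
  assumes vert: "B W \<in> fibre (cmap c p)" "B W ** ec p J + ec p J ** B W = 0"
  shows "ec p (vproj A P D (p, J) W) = B W"
proof -
  note pc = c in_cdom[OF assms(1)]
  let ?B = "endo_from_chart A c p (B W)"
  have ecB: "ec p ?B = B W" by (rule endo_in_from_chart[OF pc])
  have "C \<in> vertical_space P (p, J) \<and> W - vlift A (p, J) C \<in> horizontal_space A P D (p, J) \<longleftrightarrow> C = ?B" for C
  proof -
    have "\<Phi> (p, J) (W - vlift A (p, J) C) = \<Phi> (p, J) W - (0, ec p C)"
      by (simp add: linear_diff[OF linear_\<Phi>[OF assms(1)]] vlift_in_chart[OF pc])
    then have "W - vlift A (p, J) C \<in> horizontal_space A P D (p, J) \<longleftrightarrow> ec p C = B W"
      unfolding horizontal_space_iff[OF assms(1,2)] B_def by (auto simp: diff_eq_eq)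
    also have "\<dots> \<longleftrightarrow> C = ?B" using endo_in_chart_eq_iff[OF pc, of C ?B] ecB by simp
    finally show ?thesis using vert ecB by (auto simp: vertical_space_iff[OF assms(1)])
  qed
  then have "vproj A P D (p, J) W = ?B" unfolding vproj_def by auto
  then show ?thesis using ecB by simp
qed

text \<open>The base component makes sense for all vectors of the ambient bundle. It is applied to Lie
  brackets, which are computed from ambient extensions.\<close>

lemma canonical_structure_fst:
  assumes "p \<in> U" "J \<in> P p"
  shows "fst (\<Phi> (p, J) (canonical_structure A P D (p, J) W)) = ec p J *v fst (\<Phi> (p, J) W)"
proof -
  note pc = c in_cdom[OF assms(1)]
  show ?thesis
    by (simp add: canonical_structure_def linear_add[OF linear_\<Phi>[OF assms(1)]] vlift_in_chart[OF pc]
        hlift_in_chart[OF assms] endo_in_chart_apply[OF pc, symmetric] proj_differential_in_chart[OF pc])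
qed

lemma canonical_structure_in_chart:
  assumes "p \<in> U" "J \<in> P p"
  defines "X \<equiv> \<lambda>W. fst (\<Phi> (p, J) W)"
  defines "B \<equiv> \<lambda>W. snd (\<Phi> (p, J) W) + commutator (G (cmap c p) (X W)) (ec p J)"
  assumes "B W \<in> fibre (cmap c p)" "B W ** ec p J + ec p J ** B W = 0"
  shows "\<Phi> (p, J) (canonical_structure A P D (p, J) W) =
    (ec p J *v X W, ec p J ** B W - commutator (G (cmap c p) (ec p J *v X W)) (ec p J))"
proof -
  note pc = c in_cdom[OF assms(1)]
  have "ec p (vproj A P D (p, J) W) = B W"
    using vproj_in_chart[OF assms(1,2)] assms(5,6) unfolding B_def X_def by blast
  then show ?thesis
    by (simp add: canonical_structure_def linear_add[OF linear_\<Phi>[OF assms(1)]] vlift_in_chart[OF pc] X_def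
        hlift_in_chart[OF assms(1,2)] endo_in_chart_apply[OF pc, symmetric] proj_differential_in_chart[OF pc]
        endo_in_chart_mult[OF pc])
qed

end

context para_quaternionic_chart_connection
begin

text \<open>Along a curve in \<open>Z\<close> the coefficients in the frame are differentiable, so that the covariant
  derivative of the curve lies in the fibre; it anticommutes with \<open>J\<close> because the square is constant.
  These are the vectors on which \<open>vproj\<close> is given by its defining property.\<close>

lemma tangent_to_imp_vertical:
  assumes "p \<in> U" "(p, J) \<in> Z e" "W \<in> tangent_to (endo_atlas A) (Z e) (p, J)"
  defines "B \<equiv> snd (\<Phi> (p, J) W) + commutator (G (cmap c p) (fst (\<Phi> (p, J) W))) (ec p J)"
  shows "B \<in> fibre (cmap c p)" "B ** ec p J + ec p J ** B = 0"
proof -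
  let ?x = "cmap c p" and ?X = "fst (\<Phi> (p, J) W)" and ?C = "snd (\<Phi> (p, J) W)" and ?B = "ec p J"
  let ?m = "real CARD('m)"
  have xS: "?x \<in> S" using assms(1) by blast
  have sqB: "?B ** ?B = e *\<^sub>R mat 1" using assms(2) in_Z_iff[OF assms(1)] by blast
  obtain \<gamma> where g: "\<gamma> 0 = (p, J)" "((cmap EC \<circ> \<gamma>) has_vector_derivative \<Phi> (p, J) W) (at 0)"
    "\<forall>\<^sub>F t in nhds 0. \<gamma> t \<in> Z e \<inter> cdom EC"
    using E.tangent_toE[OF EC_in _ assms(3)] in_cdom[OF assms(1)] by auto
  define \<xi> where "\<xi> t = fst ((cmap EC \<circ> \<gamma>) t)" for t
  define \<beta> where "\<beta> t = snd ((cmap EC \<circ> \<gamma>) t)" for t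
  have d\<xi>: "(\<xi> has_vector_derivative ?X) (at 0)"
    unfolding \<xi>_def[abs_def] by (rule bounded_linear.has_vector_derivative[OF bounded_linear_fst g(2)])
  have d\<beta>: "(\<beta> has_vector_derivative ?C) (at 0)"
    unfolding \<beta>_def[abs_def] by (rule bounded_linear.has_vector_derivative[OF bounded_linear_snd g(2)])
  have at0: "\<xi> 0 = ?x" "\<beta> 0 = ?B" by (simp_all add: \<xi>_def \<beta>_def g(1))
  have "isCont \<xi> 0" using d\<xi> has_vector_derivative_continuous by blast
  then have "(\<xi> \<longlongrightarrow> \<xi> 0) (nhds 0)" unfolding isCont_def tendsto_at_iff_tendsto_nhds .
  then have "\<forall>\<^sub>F t in nhds 0. \<xi> t \<in> S" by (rule topological_tendstoD[OF _ open_S]) (simp add: at0 xS)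
  then have ev: "\<forall>\<^sub>F t in nhds 0. \<xi> t \<in> S \<and> \<beta> t \<in> fibre (\<xi> t) \<and> \<beta> t ** \<beta> t = e *\<^sub>R mat 1"
    using g(3)
  proof eventually_elim
    case (elim t)
    obtain q K where qK: "\<gamma> t = (q, K)" by fastforce
    then have q: "q \<in> cdom c" "(q, K) \<in> Z e" "\<xi> t = cmap c q" "\<beta> t = ec q K"
      using elim by (auto simp: \<xi>_def \<beta>_def)
    obtain r where "r \<in> U" "cmap c q = cmap c r" using elim q(3) by auto
    then have "q \<in> U" using inj_onD[OF inj_chart[OF c]] q(1) in_cdom by metis
    then show ?case using q in_Z_iff elim(1) by simp
  qed
  have dj: "((\<lambda>t. j1 (\<xi> t)) has_vector_derivative frechet_derivative j1 (at ?x) ?X) (at 0)"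
    "((\<lambda>t. j2 (\<xi> t)) has_vector_derivative frechet_derivative j2 (at ?x) ?X) (at 0)"
    "((\<lambda>t. j3 (\<xi> t)) has_vector_derivative frechet_derivative j3 (at ?x) ?X) (at 0)"
    using has_vector_derivative_chain[OF d\<xi> smooth_on_has_derivative[OF smooth_j(1) xS] at0(1)]
      has_vector_derivative_chain[OF d\<xi> smooth_on_has_derivative[OF smooth_j(2) xS] at0(1)]
      has_vector_derivative_chain[OF d\<xi> smooth_on_has_derivative[OF smooth_j(3) xS] at0(1)]
    by (simp_all add: comp_def)
  have lin_tr: "bounded_linear (\<lambda>M :: real ^ 'm ^ 'm. r * trace M)" for r
    by (intro linear_conv_bounded_linear[THEN iffD1] linearI)
      (simp_all add: algebra_simps trace_def sum_distrib_left sum.distrib)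
  define a1 where "a1 t = (1 / ?m) * trace (j1 (\<xi> t) ** \<beta> t)" for t
  define a2 where "a2 t = (1 / ?m) * trace (j2 (\<xi> t) ** \<beta> t)" for t
  define a3 where "a3 t = (- 1 / ?m) * trace (j3 (\<xi> t) ** \<beta> t)" for t
  obtain a1' a2' a3' where da: "(a1 has_vector_derivative a1') (at 0)"
    "(a2 has_vector_derivative a2') (at 0)" "(a3 has_vector_derivative a3') (at 0)"
    using bounded_linear.has_vector_derivative[OF lin_tr mm.has_vector_derivative[OF dj(1) d\<beta>]]
      bounded_linear.has_vector_derivative[OF lin_tr mm.has_vector_derivative[OF dj(2) d\<beta>]]
      bounded_linear.has_vector_derivative[OF lin_tr mm.has_vector_derivative[OF dj(3) d\<beta>]]
    unfolding a1_def[abs_def] a2_def[abs_def] a3_def[abs_def] by blast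
  define \<sigma> where "\<sigma> t = a1 t *\<^sub>R j1 (\<xi> t) + a2 t *\<^sub>R j2 (\<xi> t) + a3 t *\<^sub>R j3 (\<xi> t)" for t
  have ev_eq: "\<forall>\<^sub>F t in nhds 0. \<sigma> t = \<beta> t"
    using ev
  proof eventually_elim
    case (elim t)
    then interpret T: para_quaternion_triple "j1 (\<xi> t)" "j2 (\<xi> t)" "j3 (\<xi> t)" using triple by blast
    obtain b1 b2 b3 where b: "\<beta> t = T.comb b1 b2 b3" using elim unfolding T.span_iff_comb by blast
    have "a1 t = b1" "a2 t = b2" "a3 t = b3"
      unfolding a1_def a2_def a3_def b T.trace_basis_comb by simp_all
    then show ?case by (simp add: \<sigma>_def b T.comb_def)
  qed
  then have B0: "?B = a1 0 *\<^sub>R j1 ?x + a2 0 *\<^sub>R j2 ?x + a3 0 *\<^sub>R j3 ?x"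
    using eventually_nhds_x_imp_x[OF ev_eq] at0 by (simp add: \<sigma>_def)
  let ?d = "a1 0 *\<^sub>R frechet_derivative j1 (at ?x) ?X + a2 0 *\<^sub>R frechet_derivative j2 (at ?x) ?X +
    a3 0 *\<^sub>R frechet_derivative j3 (at ?x) ?X"
  let ?F = "a1' *\<^sub>R j1 ?x + a2' *\<^sub>R j2 ?x + a3' *\<^sub>R j3 ?x"
  interpret sc: bounded_bilinear "(*\<^sub>R) :: real \<Rightarrow> real ^ 'm ^ 'm \<Rightarrow> real ^ 'm ^ 'm"
    by (rule bounded_bilinear_scaleR)
  have "(\<sigma> has_vector_derivative
      ((a1 0 *\<^sub>R frechet_derivative j1 (at ?x) ?X + a1' *\<^sub>R j1 (\<xi> 0)) +
       (a2 0 *\<^sub>R frechet_derivative j2 (at ?x) ?X + a2' *\<^sub>R j2 (\<xi> 0))) +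
       (a3 0 *\<^sub>R frechet_derivative j3 (at ?x) ?X + a3' *\<^sub>R j3 (\<xi> 0))) (at 0)"
    unfolding \<sigma>_def[abs_def]
    by (intro has_vector_derivative_add sc.has_vector_derivative da dj)
  then have "(\<beta> has_vector_derivative (?d + ?F)) (at 0)"
    by (rule has_vector_derivative_cong_nhds[OF _ ev_eq, THEN has_vector_derivative_eq_rhs])
      (simp add: at0 algebra_simps)
  then have C: "?C = ?d + ?F" by (rule vector_derivative_unique_at[OF d\<beta>])
  have "?F \<in> fibre ?x" by (simp add: span_add span_scale span_base)
  then have "(?d + commutator (G ?x ?X) ?B) + ?F \<in> fibre ?x"
    by (rule span_add[OF covariant_derivative_vertical(1)[OF xS B0, of ?X]])
  then show "B \<in> fibre ?x" unfolding B_def C by (simp add: algebra_simps)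
  have "((\<lambda>t. \<beta> t ** \<beta> t) has_vector_derivative (\<beta> 0 ** ?C + ?C ** \<beta> 0)) (at 0)"
    by (rule mm.has_vector_derivative[OF d\<beta> d\<beta>])
  moreover have "((\<lambda>t. \<beta> t ** \<beta> t) has_vector_derivative 0) (at 0)"
    by (rule has_vector_derivative_cong_nhds[OF has_vector_derivative_const[of "e *\<^sub>R mat 1"]])
      (use ev in eventually_elim, simp)
  ultimately have "\<beta> 0 ** ?C + ?C ** \<beta> 0 = 0" by (rule vector_derivative_unique_at)
  then have "?B ** ?C + ?C ** ?B = 0" by (simp only: at0)
  then show "B ** ?B + ?B ** B = 0"
    using commutator_anticommutes[OF sqB, of "G ?x ?X"]
    by (simp add: B_def matrix_distribs algebra_simps)
qed

text \<open>A curve through the given point: along a line in the chart, the coefficients in the frame run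
  through a rational parametrisation of the conic that the quadric of norm \<open>e\<close> has in common with
  the plane of the initial coefficients \<open>a\<close> and the initial velocity \<open>b\<close>.\<close>

lemma horizontal_imp_tangent_to:
  assumes "p \<in> U" "(p, J) \<in> Z e" "e * e = 1"
    and hor: "snd (\<Phi> (p, J) W) = - commutator (G (cmap c p) (fst (\<Phi> (p, J) W))) (ec p J)"
  shows "W \<in> tangent_to (endo_atlas A) (Z e) (p, J)"
proof -
  let ?x = "cmap c p" and ?X = "fst (\<Phi> (p, J) W)" and ?B = "ec p J"
  have xS: "?x \<in> S" using assms(1) by blast
  interpret T: para_quaternion_triple "j1 ?x" "j2 ?x" "j3 ?x" by (rule triple[OF xS])
  have sqB: "?B ** ?B = e *\<^sub>R mat 1" and fibB: "?B \<in> fibre ?x"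
    using assms(2) in_Z_iff[OF assms(1)] by blast+
  obtain a1 a2 a3 where a: "?B = a1 *\<^sub>R j1 ?x + a2 *\<^sub>R j2 ?x + a3 *\<^sub>R j3 ?x"
    using fibB unfolding T.span_iff_comb T.comb_def by blast
  let ?d = "a1 *\<^sub>R frechet_derivative j1 (at ?x) ?X + a2 *\<^sub>R frechet_derivative j2 (at ?x) ?X +
    a3 *\<^sub>R frechet_derivative j3 (at ?x) ?X"
  let ?E = "?d + commutator (G ?x ?X) ?B"
  note vert = covariant_derivative_vertical[OF xS a, where w = ?X]
  obtain b1 b2 b3 where b: "- ?E = b1 *\<^sub>R j1 ?x + b2 *\<^sub>R j2 ?x + b3 *\<^sub>R j3 ?x"
    using span_neg[OF vert(1)] unfolding T.span_iff_comb T.comb_def by blast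
  have aT: "?B = T.comb a1 a2 a3" and bT: "- ?E = T.comb b1 b2 b3"
    using a b unfolding T.comb_def by blast+
  have Qa: "a1\<^sup>2 + a2\<^sup>2 - a3\<^sup>2 = e"
    using sqB unfolding aT T.comb_square by simp
  have "(- N) ** M + M ** (- N) = - (N ** M + M ** N)" for N M :: "real ^ 'm ^ 'm"
    by (simp add: mm.minus_left mm.minus_right)
  from this[of ?E ?B] have "(- ?E) ** ?B + ?B ** (- ?E) = 0"
    unfolding vert(2)[OF sqB] by simp
  then have Qab: "b1 * a1 + b2 * a2 - b3 * a3 = 0"
    unfolding bT unfolding aT T.comb_anticommutator by simp
  define s where "s = (b1\<^sup>2 + b2\<^sup>2 - b3\<^sup>2) * e"
  have Qb: "b1\<^sup>2 + b2\<^sup>2 - b3\<^sup>2 = s * e" using assms(3) by (simp add: s_def)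
  \<comment> \<open>The functions \<open>f\<close> and \<open>h\<close> parametrise the conic \<open>f\<^sup>2 + s h\<^sup>2 = 1\<close>, starting at
    \<open>f = 1\<close>, \<open>h = 0\<close> with velocity \<open>(0, 1)\<close>.\<close>
  define u where "u t = s * (t * t) / 4" for t :: real
  define f where "f t = (1 - u t) / (1 + u t)" for t
  define h where "h t = t / (1 + u t)" for t
  have fh: "(f t)\<^sup>2 + s * (h t)\<^sup>2 = 1" if "1 + u t \<noteq> 0" for t
  proof -
    have "(1 - u t)\<^sup>2 + s * t\<^sup>2 = (1 + u t)\<^sup>2" by (simp add: u_def power2_eq_square algebra_simps)
    then show ?thesis using that
      by (simp add: f_def h_def power_divide) (simp flip: add_divide_distrib)
  qed
  let ?g = "\<lambda>a b t. f t * a + h t * b"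
  let ?y = "\<lambda>t. ?x + t *\<^sub>R ?X"
  define \<sigma> where "\<sigma> t = ?g a1 b1 t *\<^sub>R j1 (?y t) + ?g a2 b2 t *\<^sub>R j2 (?y t) + ?g a3 b3 t *\<^sub>R j3 (?y t)" for t
  let ?O = "{t. ?y t \<in> S} \<inter> {t. 1 + u t \<noteq> 0}"
  have "continuous_on UNIV ?y" by (intro continuous_intros)
  then have "open {t. ?y t \<in> S}" using open_vimage[OF open_S] by (simp add: vimage_def)
  moreover have "open {t. 1 + u t \<noteq> 0}"
    unfolding u_def by (intro open_Collect_neq continuous_intros) auto
  ultimately have "open ?O" by blast
  moreover have "0 \<in> ?O" using xS by (simp add: u_def)
  ultimately obtain r where r: "r > 0" "ball 0 r \<subseteq> ?O" by (meson open_contains_ball)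
  let ?I = "{-r<..<r}"
  have "ball 0 r = ?I" by (auto simp: dist_real_def)
  then have I: "?y t \<in> S" "1 + u t \<noteq> 0" if "t \<in> ?I" for t using r(2) that by blast+
  have opI: "open ?I" by simp
  have smy: "smooth_on ?I ?y"
    by (intro smooth_on_add smooth_on_scaleR smooth_on_const smooth_on_id opI)
  have smj: "smooth_on ?I (\<lambda>t. j (?y t))" if "smooth_on S j" for j :: "real ^ 'm \<Rightarrow> real ^ 'm ^ 'm"
    by (rule smooth_on_compose[OF opI open_S _ smy that]) (use I in blast)
  have "smooth_on ?I (\<lambda>t. (s / 4) * (t * t))"
    by (intro smooth_on_mult smooth_on_const smooth_on_id opI)
  then have smu: "smooth_on ?I u" by (simp add: u_def[abs_def])
  have smf: "smooth_on ?I f" "smooth_on ?I h"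
    unfolding f_def[abs_def] h_def[abs_def]
    by (intro smooth_on_divide smooth_on_add smooth_on_diff smooth_on_const smooth_on_id opI smu I(2),
        assumption)+
  have sm\<sigma>: "smooth_on ?I \<sigma>"
    unfolding \<sigma>_def[abs_def]
    by (intro smooth_on_add smooth_on_scaleR smooth_on_mult smooth_on_const opI smf smj smooth_j)
  have u0: "u 0 = 0" by (simp add: u_def)
  have du: "(u has_real_derivative 0) (at 0)"
    unfolding u_def[abs_def] by (auto intro!: derivative_eq_intros)
  have df: "(f has_real_derivative 0) (at 0)" "(h has_real_derivative 1) (at 0)"
    unfolding f_def[abs_def] h_def[abs_def]
    by (auto intro!: derivative_eq_intros du simp: u0)
  have f0: "f 0 = 1" "h 0 = 0" by (simp_all add: f_def h_def u0)
  have dg: "(?g a b has_vector_derivative b) (at 0)" for a b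
    unfolding has_real_derivative_iff_has_vector_derivative[symmetric]
    by (auto intro!: derivative_eq_intros df)
  have dy: "(?y has_vector_derivative ?X) (at 0)"
    by (auto intro!: derivative_eq_intros)
  have y0: "?y 0 = ?x" by simp
  have dj: "((\<lambda>t. j (?y t)) has_vector_derivative frechet_derivative j (at ?x) ?X) (at 0)"
    if "smooth_on S j" for j :: "real ^ 'm \<Rightarrow> real ^ 'm ^ 'm"
    using has_vector_derivative_chain[OF dy smooth_on_has_derivative[OF that xS] y0] by (simp add: comp_def)
  interpret sc: bounded_bilinear "(*\<^sub>R) :: real \<Rightarrow> real ^ 'm ^ 'm \<Rightarrow> real ^ 'm ^ 'm"
    by (rule bounded_bilinear_scaleR)
  have summand: "((\<lambda>t. ?g a b t *\<^sub>R j (?y t)) has_vector_derivative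
      a *\<^sub>R frechet_derivative j (at ?x) ?X + b *\<^sub>R j ?x) (at 0)"
    if "smooth_on S j" for j :: "real ^ 'm \<Rightarrow> real ^ 'm ^ 'm" and a b
    using sc.has_vector_derivative[OF dg[of a b] dj[OF that]] by (simp add: f0)
  have "?d + (- ?E) = (a1 *\<^sub>R frechet_derivative j1 (at ?x) ?X + b1 *\<^sub>R j1 ?x) +
      (a2 *\<^sub>R frechet_derivative j2 (at ?x) ?X + b2 *\<^sub>R j2 ?x) +
      (a3 *\<^sub>R frechet_derivative j3 (at ?x) ?X + b3 *\<^sub>R j3 ?x)"
    unfolding b by (simp add: algebra_simps)
  then have "(\<sigma> has_vector_derivative (?d + (- ?E))) (at 0)"
    unfolding \<sigma>_def[abs_def]
    by (simp only:) (intro has_vector_derivative_add summand smooth_j)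
  then have d\<sigma>: "(\<sigma> has_vector_derivative snd (\<Phi> (p, J) W)) (at 0)"
    unfolding hor by simp
  show ?thesis
  proof (rule E.tangent_toI[OF EC_in _ r(1)])
    show "(p, J) \<in> cdom EC" using in_cdom[OF assms(1)] by simp
    show "smooth_on ?I (\<lambda>t. (?y t, \<sigma> t))" by (intro smooth_on_Pair smy sm\<sigma> opI)
    show "(?y 0, \<sigma> 0) = cmap EC (p, J)" by (simp add: \<sigma>_def f0 a)
    show "((\<lambda>t. (?y t, \<sigma> t)) has_vector_derivative \<Phi> (p, J) W) (at 0)"
      using has_vector_derivative_Pair[OF dy d\<sigma>] by simp
    fix t assume t: "t \<in> ?I"
    obtain q where q: "q \<in> U" "?y t = cmap c q" "cinv c (?y t) = q" using S_cases[OF I(1)[OF t]] .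
    interpret Q: para_quaternion_triple "j1 (?y t)" "j2 (?y t)" "j3 (?y t)" by (rule triple[OF I(1)[OF t]])
    let ?K = "endo_from_chart A c q (\<sigma> t)"
    have ecK: "ec q ?K = \<sigma> t" by (rule endo_in_from_chart[OF c in_cdom[OF q(1)]])
    have comb: "\<sigma> t = Q.comb (?g a1 b1 t) (?g a2 b2 t) (?g a3 b3 t)" by (simp only: \<sigma>_def Q.comb_def)
    have "(?g a1 b1 t)\<^sup>2 + (?g a2 b2 t)\<^sup>2 - (?g a3 b3 t)\<^sup>2 =
        (f t)\<^sup>2 * (a1\<^sup>2 + a2\<^sup>2 - a3\<^sup>2) + 2 * f t * h t * (b1 * a1 + b2 * a2 - b3 * a3) +
        (h t)\<^sup>2 * (b1\<^sup>2 + b2\<^sup>2 - b3\<^sup>2)"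
      by (simp add: power2_eq_square algebra_simps)
    also have "\<dots> = e * ((f t)\<^sup>2 + s * (h t)\<^sup>2)" unfolding Qa Qab Qb by (simp add: algebra_simps)
    also have "\<dots> = e" by (simp add: fh I(2)[OF t])
    finally have "\<sigma> t ** \<sigma> t = e *\<^sub>R mat 1" unfolding comb Q.comb_square by simp
    moreover have "\<sigma> t \<in> fibre (?y t)" unfolding comb by (rule Q.comb_in_span)
    ultimately have "(q, ?K) \<in> Z e" unfolding in_Z_iff[OF q(1)] ecK q(2) by blast
    moreover have "(?y t, \<sigma> t) = cmap EC (q, ?K)" by (simp add: ecK q(2))
    moreover have "(q, ?K) \<in> cdom EC" using in_cdom[OF q(1)] by simp
    moreover have "cinv EC (cmap EC (q, ?K)) = (q, ?K)"
      by (rule E.cinv_cmap[OF EC_in]) fact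
    ultimately show "(?y t, \<sigma> t) \<in> cmap EC ` cdom EC \<and> cinv EC (?y t, \<sigma> t) \<in> Z e"
      by (simp only:) blast
  qed
qed

section \<open>The Nijenhuis tensor on horizontal fields\<close>

text \<open>The horizontal vector with base component \<open>\<xi>\<close>, in the chart and as a field on the bundle. The
  formula makes sense for all endomorphisms, not only for the elements of \<open>Z\<close>, and thereby provides
  the ambient extensions that brackets on \<open>Z\<close> require.\<close>

definition horizontal_part ::
    "((real ^ 'm) \<times> (real ^ 'm ^ 'm) \<Rightarrow> real ^ 'm) \<Rightarrow> (real ^ 'm) \<times> (real ^ 'm ^ 'm) \<Rightarrow>
     (real ^ 'm) \<times> (real ^ 'm ^ 'm)" where
  "horizontal_part \<xi> \<zeta> = (\<xi> \<zeta>, - commutator (G (fst \<zeta>) (\<xi> \<zeta>)) (snd \<zeta>))"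

definition horizontal_field ::
    "((real ^ 'm) \<times> (real ^ 'm ^ 'm) \<Rightarrow> real ^ 'm) \<Rightarrow> 'a \<times> (real ^ 'm ^ 'm) \<Rightarrow>
     (real ^ 'm) \<times> (real ^ 'm ^ 'm)" where
  "horizontal_field \<xi> z = tangent_vector (endo_atlas A) EC z (horizontal_part \<xi> (cmap EC z))"

abbreviation "SE \<equiv> S \<times> (UNIV :: (real ^ 'm ^ 'm) set)"
abbreviation "UE \<equiv> U \<times> (UNIV :: (real ^ 'm ^ 'm) set)"

lemma open_SE: "open SE" by (intro open_Times open_S open_UNIV)

lemma UE_image: "cmap EC ` UE = SE" by (rule endo_chart_image[OF c U_subset])

lemma mopen_UE: "mopen (endo_atlas A) UE"
proof (rule E.mopenI[OF EC_in])
  show "UE \<subseteq> cdom EC" using U_subset by auto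
  show "open (cmap EC ` UE)" unfolding UE_image by (rule open_SE)
qed

lemma \<Phi>_horizontal_field:
  "p \<in> U \<Longrightarrow> \<Phi> (p, K) (horizontal_field \<xi> (p, K)) = horizontal_part \<xi> (cmap c p, ec p K)"
  unfolding horizontal_field_def using E.mdiff_tangent_vector[OF EC_in, of "(p, K)"] in_cdom by simp

lemma field_in_chart_horizontal_field:
  assumes "\<zeta> \<in> SE"
  shows "field_in_chart (endo_atlas A) EC (horizontal_field \<xi>) \<zeta> = horizontal_part \<xi> \<zeta>"
proof -
  obtain p K where pK: "p \<in> U" "\<zeta> = cmap EC (p, K)" using assms unfolding UE_image[symmetric] by auto
  then show ?thesis
    using E.field_in_chart_cmap[OF EC_in, of "(p, K)"] \<Phi>_horizontal_field in_cdom by simp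
qed

lemma smooth_horizontal_part:
  assumes "smooth_on SE \<xi>" shows "smooth_on SE (horizontal_part \<xi>)"
proof -
  have smG: "smooth_on SE (\<lambda>\<zeta>. G (fst \<zeta>) (\<xi> \<zeta>))"
  proof (rule smooth_on_linear_family[OF open_SE, where G = "\<lambda>\<zeta>. G (fst \<zeta>)"])
    show "smooth_on SE (\<lambda>\<zeta>. G (fst \<zeta>) v)" for v
      by (rule smooth_on_fst[OF open_S smooth_on_subset[OF smooth_christoffel[OF c]]]) (use U_subset in blast)
  qed (use linear_G assms in auto)
  show ?thesis
    unfolding horizontal_part_def[abs_def] commutator_def
    by (intro smooth_on_Pair smooth_on_minus smooth_on_diff smooth_on_matrix_mul open_SE assms smG
        smooth_on_linear[OF open_SE bounded_linear_snd])
qed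

lemma local_extension_horizontal_field:
  assumes "smooth_on SE \<xi>" "z \<in> UE" "\<And>y. y \<in> Z e \<inter> UE \<Longrightarrow> V y = horizontal_field \<xi> y"
  shows "local_extension (endo_atlas A) (Z e) z V (horizontal_field \<xi>)"
proof -
  have "smooth_field (endo_atlas A) UE (horizontal_field \<xi>)"
  proof (rule E.smooth_fieldI[OF EC_in])
    show "UE \<subseteq> cdom EC" using U_subset by auto
    show "smooth_on (cmap EC ` UE) (field_in_chart (endo_atlas A) EC (horizontal_field \<xi>))"
      unfolding UE_image
      by (rule smooth_on_cong[OF open_SE smooth_horizontal_part[OF assms(1)]])
        (simp add: field_in_chart_horizontal_field)
  qed (simp add: UE_image open_SE)
  then show ?thesis
    unfolding local_extension_def using mopen_UE assms(2,3) by (intro exI[of _ UE]) auto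
qed

lemma horizontal_field_tangent:
  assumes "z \<in> Z e \<inter> UE" "e * e = 1"
  shows "horizontal_field \<xi> z \<in> tangent_to (endo_atlas A) (Z e) z"
proof -
  obtain p K where "z = (p, K)" by fastforce
  then show ?thesis using assms
    by (auto intro!: horizontal_imp_tangent_to simp: \<Phi>_horizontal_field horizontal_part_def)
qed

lemma canonical_structure_horizontal_field:
  assumes "z \<in> Z e \<inter> UE"
  shows "canonical_structure A P D z (horizontal_field \<xi> z) = horizontal_field (\<lambda>\<zeta>. snd \<zeta> *v \<xi> \<zeta>) z"
proof -
  obtain p K where z: "z = (p, K)" "p \<in> U" "K \<in> P p" using assms by (auto simp: Z_def)
  have "\<Phi> (p, K) (canonical_structure A P D (p, K) (horizontal_field \<xi> (p, K))) =
      \<Phi> (p, K) (horizontal_field (\<lambda>\<zeta>. snd \<zeta> *v \<xi> \<zeta>) (p, K))"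
    using canonical_structure_in_chart[OF z(2,3), of "horizontal_field \<xi> (p, K)"]
    by (simp add: \<Phi>_horizontal_field[OF z(2)] horizontal_part_def span_zero mm.zero_left mm.zero_right)
  then show ?thesis unfolding z(1) \<Phi>_eq_iff[OF z(2)] .
qed

lemma fst_lie_bracket_horizontal:
  assumes "p \<in> U" "chart_at (endo_atlas A) (p, J) = EC" "smooth_on SE \<xi>" "smooth_on SE \<eta>"
  defines "\<zeta> \<equiv> (cmap c p, ec p J)"
  shows "fst (lie_bracket (endo_atlas A) (horizontal_field \<xi>) (horizontal_field \<eta>) (p, J)) =
    frechet_derivative \<eta> (at \<zeta>) (horizontal_part \<xi> \<zeta>) - frechet_derivative \<xi> (at \<zeta>) (horizontal_part \<eta> \<zeta>)"
proof -
  have \<zeta>: "\<zeta> \<in> SE" using assms(1) by (simp add: \<zeta>_def)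
  have d: "fst (frechet_derivative (field_in_chart (endo_atlas A) EC (horizontal_field \<xi>)) (at \<zeta>) V) =
      frechet_derivative \<xi> (at \<zeta>) V" if \<xi>: "smooth_on SE \<xi>" for \<xi> V
  proof -
    let ?D = "frechet_derivative (horizontal_part \<xi>) (at \<zeta>)"
    have "frechet_derivative (field_in_chart (endo_atlas A) EC (horizontal_field \<xi>)) (at \<zeta>) = ?D"
      by (rule frechet_derivative_cong_open[OF open_SE \<zeta> field_in_chart_horizontal_field])
    moreover have "((\<lambda>\<zeta>. fst (horizontal_part \<xi> \<zeta>)) has_derivative (\<lambda>V. fst (?D V))) (at \<zeta>)"
      by (rule has_derivative_fst[OF smooth_on_has_derivative[OF smooth_horizontal_part[OF \<xi>] \<zeta>]])
    then have "frechet_derivative \<xi> (at \<zeta>) = (\<lambda>V. fst (?D V))"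
      by (simp add: horizontal_part_def frechet_derivative_at[symmetric])
    ultimately show ?thesis by simp
  qed
  have "cmap EC (p, J) = \<zeta>" by (simp add: \<zeta>_def)
  then show ?thesis
    unfolding lie_bracket_def Let_def assms(2)
    by (simp add: fst_diff d assms(3,4) field_in_chart_horizontal_field[OF \<zeta>])
qed

text \<open>The Nijenhuis tensor is evaluated on two horizontal fields whose base components \<open>X\<close>, \<open>Y\<close>
  are constant in the chart. The canonical structure maps them to the horizontal fields with base
  components \<open>J X\<close>, \<open>J Y\<close>, so all four fields have explicit smooth extensions, and the base components
  of their brackets involve only derivatives of \<open>J X\<close> and \<open>J Y\<close> in horizontal directions. The base
  component of the tensor comes out as \<open>\<delta> X Y - \<delta> Y X\<close>.\<close>

lemma integrable_imp_symmetric: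
  assumes "p \<in> U" "chart_at (endo_atlas A) (p, J) = EC" "(p, J) \<in> Z e" "e * e = 1"
    and int: "integrable_structure (endo_atlas A) (Z e) (canonical_structure A P D)"
  defines "B \<equiv> ec p J" and "x \<equiv> cmap c p"
  defines "\<delta> \<equiv> \<lambda>X. B ** commutator (G x X) B - commutator (G x (B *v X)) B"
  shows "\<delta> X *v Y = \<delta> Y *v X"
proof -
  let ?K = "canonical_structure A P D"
  let ?br = "lie_bracket_sub (endo_atlas A) (Z e)"
  let ?z = "(p, J)" and ?\<zeta> = "(x, B)"
  let ?c = "\<lambda>X \<zeta>. X :: real ^ 'm" and ?l = "\<lambda>X \<zeta>. snd \<zeta> *v X :: real ^ 'm"
  let ?H = "\<lambda>X. horizontal_field (?c X)"
  have z: "?z \<in> Z e \<inter> UE" using assms(1,3) by simp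
  have smc: "smooth_on SE (?c X)" for X by (rule smooth_on_const[OF open_SE])
  have sml: "smooth_on SE (?l X)" for X
    by (intro smooth_on_matrix_vector open_SE smooth_on_const smooth_on_linear bounded_linear_snd)
  have KH: "?K y (?H X y) = horizontal_field (?l X) y" if "y \<in> Z e \<inter> UE" for X y
    using canonical_structure_horizontal_field[OF that, of "?c X"] .
  have br: "fst (?br V W ?z) = frechet_derivative \<eta> (at ?\<zeta>) (horizontal_part \<xi> ?\<zeta>) -
      frechet_derivative \<xi> (at ?\<zeta>) (horizontal_part \<eta> ?\<zeta>)"
    if "smooth_on SE \<xi>" "smooth_on SE \<eta>" "\<And>y. y \<in> Z e \<inter> UE \<Longrightarrow> V y = horizontal_field \<xi> y"
      "\<And>y. y \<in> Z e \<inter> UE \<Longrightarrow> W y = horizontal_field \<eta> y" for V W \<xi> \<eta>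
  proof -
    have "?br V W ?z = lie_bracket (endo_atlas A) (horizontal_field \<xi>) (horizontal_field \<eta>) ?z"
    proof (rule E.lie_bracket_sub_eq)
      show "local_extension (endo_atlas A) (Z e) ?z V (horizontal_field \<xi>)"
        by (rule local_extension_horizontal_field[OF that(1) _ that(3)]) (use z in blast)+
      show "local_extension (endo_atlas A) (Z e) ?z W (horizontal_field \<eta>)"
        by (rule local_extension_horizontal_field[OF that(2) _ that(4)]) (use z in blast)+
      show "V ?z \<in> tangent_to (endo_atlas A) (Z e) ?z" "W ?z \<in> tangent_to (endo_atlas A) (Z e) ?z"
        unfolding that(3)[OF z] that(4)[OF z] by (rule horizontal_field_tangent[OF z assms(4)])+
    qed (rule assms(3))
    then show ?thesis
      using fst_lie_bracket_horizontal[OF assms(1,2) that(1,2)] by (simp add: x_def B_def)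
  qed
  have dc: "frechet_derivative (?c X) (at ?\<zeta>) V = 0" for X V by simp
  have dl: "frechet_derivative (?l X) (at ?\<zeta>) V = snd V *v X" for X V
  proof -
    have "(?l X has_derivative (\<lambda>V. snd V *v X)) (at ?\<zeta>)"
      by (rule bounded_linear_imp_has_derivative[OF
            bounded_linear_compose[OF mv.bounded_linear_left bounded_linear_snd]])
    then show ?thesis by (simp add: frechet_derivative_at[symmetric])
  qed
  have b1: "fst (?br (?H X) (?H Y) ?z) = 0"
    by (subst br[OF smc smc refl refl]) (simp add: dc)
  have b2: "fst (?br (\<lambda>y. ?K y (?H X y)) (?H Y) ?z) = commutator (G x Y) B *v X"
    by (subst br[OF sml smc KH refl], assumption) (simp add: dc dl horizontal_part_def mv.minus_left)
  have b3: "fst (?br (?H X) (\<lambda>y. ?K y (?H Y y)) ?z) = - (commutator (G x X) B *v Y)"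
    by (subst br[OF smc sml refl KH], assumption) (simp add: dc dl horizontal_part_def mv.minus_left)
  have b4: "fst (?br (\<lambda>y. ?K y (?H X y)) (\<lambda>y. ?K y (?H Y y)) ?z) =
      - (commutator (G x (B *v X)) B *v Y) + commutator (G x (B *v Y)) B *v X"
    by (rule trans[OF br[OF sml sml]], rule KH, assumption, rule KH, assumption)
      (simp add: dl horizontal_part_def mv.minus_left)
  have id: "\<Phi> ?z V = V" for V using E.mdiff_chart_at[of ?z V] assms(2) by simp
  have fK: "fst (?K ?z V) = B *v fst V" for V
    using canonical_structure_fst[OF assms(1), of J V] assms(3) by (simp add: id B_def Z_def)
  have sub: "smooth_field_sub (endo_atlas A) (Z e) (Z e \<inter> UE) (?H X)" for X
    unfolding smooth_field_sub_def
    using horizontal_field_tangent[OF _ assms(4)] local_extension_horizontal_field[OF smc] by blast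
  have "nijenhuis (endo_atlas A) (Z e) ?K (?H X) (?H Y) ?z = 0"
    using int mopen_UE sub[of X] sub[of Y] z unfolding integrable_structure_def by blast
  then have "fst (nijenhuis (endo_atlas A) (Z e) ?K (?H X) (?H Y) ?z) = 0" by simp
  then show ?thesis
    unfolding nijenhuis_def Let_def
    by (simp add: b1 b2 b3 b4 fK \<delta>_def mv.diff_left mv.zero_right mv.minus_right
        matrix_vector_mul_assoc algebra_simps)
qed

end

section \<open>At most one integrable structure\<close>

context para_quaternionic_chart
begin

text \<open>On a tangent vector with base component \<open>X\<close> the two structures differ by a vertical vector
  \<open>\<delta> X\<close>. The form \<open>\<delta>\<close> is vertical because both connections preserve \<open>P\<close> and symmetric because both
  structures are integrable, so the algebraic lemmas make it vanish.\<close>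

lemma canonical_structures_agree:
  assumes D: "D \<in> para_quaternionic_connections A P" "D' \<in> para_quaternionic_connections A P"
    and z: "p \<in> U" "chart_at (endo_atlas A) (p, J) = EC" "(p, J) \<in> Z e"
    and e: "e = -1 \<or> e = 1" and dim: "CARD('m) \<ge> 4"
    and int: "integrable_structure (endo_atlas A) (Z e) (canonical_structure A P D)"
      "integrable_structure (endo_atlas A) (Z e) (canonical_structure A P D')"
    and W: "W \<in> tangent_to (endo_atlas A) (Z e) (p, J)"
  shows "canonical_structure A P D (p, J) W = canonical_structure A P D' (p, J) W"
proof -
  interpret C: para_quaternionic_chart_connection A P c U J1 J2 J3 D by unfold_locales (rule D(1))
  interpret C': para_quaternionic_chart_connection A P c U J1 J2 J3 D' by unfold_locales (rule D(2))
  have ee: "e * e = 1" using e by auto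
  define x where "x = cmap c p"
  define B where "B = ec p J"
  have xS: "x \<in> S" using z(1) by (simp add: x_def)
  interpret T: para_quaternion_triple "j1 x" "j2 x" "j3 x" by (rule triple[OF xS])
  have B: "B \<in> fibre x" "B ** B = e *\<^sub>R mat 1" and JP: "J \<in> P p"
    using z(3) in_Z_iff[OF z(1)] by (auto simp: Z_def x_def B_def)
  define F where "F X = commutator (C'.G x X) B - commutator (C.G x X) B" for X
  define \<delta> where "\<delta> X = B ** F X - F (B *v X)" for X
  have linF: "linear F"
    unfolding F_def[abs_def]
    by (intro linear_compose_sub C.commutator_G_linear C'.commutator_G_linear xS)
  have lin: "linear \<delta>"
    by (rule linearI) (simp_all add: \<delta>_def linear_add[OF linF] linear_cmul[OF linF] matrix_distribs
        mv.add_right mv.scaleR_right algebra_simps)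
  have F: "F X \<in> fibre x" "F X ** B + B ** F X = 0" for X
  proof -
    obtain a1 a2 a3 where a: "B = a1 *\<^sub>R j1 x + a2 *\<^sub>R j2 x + a3 *\<^sub>R j3 x"
      using B(1) unfolding T.span_iff_comb T.comb_def by blast
    let ?d = "a1 *\<^sub>R frechet_derivative j1 (at x) X + a2 *\<^sub>R frechet_derivative j2 (at x) X +
      a3 *\<^sub>R frechet_derivative j3 (at x) X"
    have eq: "F X = (?d + commutator (C'.G x X) B) - (?d + commutator (C.G x X) B)"
      by (simp add: F_def)
    show "F X \<in> fibre x"
      unfolding eq
      by (rule span_diff[OF C'.covariant_derivative_vertical(1)[OF xS a]
            C.covariant_derivative_vertical(1)[OF xS a]])
    have "F X ** B + B ** F X =
        (commutator (C'.G x X) B ** B + B ** commutator (C'.G x X) B) -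
        (commutator (C.G x X) B ** B + B ** commutator (C.G x X) B)"
      by (simp add: F_def matrix_distribs)
    then show "F X ** B + B ** F X = 0" by (simp add: commutator_anticommutes[OF B(2)])
  qed
  have BF: "B ** F X \<in> fibre x" for X
    by (rule T.anticommute_imp_mult_in_span[OF B(1) F(1)]) (use F(2)[of X] in \<open>simp add: add.commute\<close>)
  have vert: "\<delta> X \<in> fibre x" "\<delta> X ** B + B ** \<delta> X = 0" for X
  proof -
    show "\<delta> X \<in> fibre x" unfolding \<delta>_def by (rule span_diff[OF BF F(1)])
    have "\<delta> X ** B + B ** \<delta> X =
        B ** (F X ** B + B ** F X) - (F (B *v X) ** B + B ** F (B *v X))"
      by (simp add: \<delta>_def matrix_distribs matrix_mul_assoc algebra_simps)
    then show "\<delta> X ** B + B ** \<delta> X = 0" by (simp add: F(2) mm.zero_right)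
  qed
  have BB: "B *v (B *v X) = e *\<^sub>R X" for X
    by (simp add: matrix_vector_mul_assoc B(2) mv.scaleR_left)
  have equiv: "\<delta> (B *v X) = - (B ** \<delta> X)" for X
    by (simp add: \<delta>_def BB linear_cmul[OF linF] matrix_distribs matrix_mul_assoc B(2))
  have sym: "\<delta> X *v Y = \<delta> Y *v X" for X Y
  proof -
    define \<tau> where "\<tau> X = B ** commutator (C.G x X) B - commutator (C.G x (B *v X)) B" for X
    define \<tau>' where "\<tau>' X = B ** commutator (C'.G x X) B - commutator (C'.G x (B *v X)) B" for X
    have "\<delta> X = \<tau>' X - \<tau> X" for X
      by (simp add: \<delta>_def F_def \<tau>_def \<tau>'_def matrix_distribs)
    moreover have "\<tau> X *v Y = \<tau> Y *v X" "\<tau>' X *v Y = \<tau>' Y *v X"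
      unfolding \<tau>_def \<tau>'_def x_def B_def
      by (rule C.integrable_imp_symmetric[OF z ee int(1)] C'.integrable_imp_symmetric[OF z ee int(2)])+
    ultimately show ?thesis by (simp add: mv.diff_left)
  qed
  have \<delta>0: "\<delta> X = 0" for X
    using e
  proof
    assume "e = -1"
    then show ?thesis
      using T.symmetric_vertical_form_zero_twistor[OF B(1) _ vert sym dim] B(2) by simp
  next
    assume "e = 1"
    then show ?thesis
      using T.symmetric_vertical_form_zero_reflector[OF _ lin vert equiv sym dim] B(2) by simp
  qed
  let ?X = "fst (\<Phi> (p, J) W)" and ?C = "snd (\<Phi> (p, J) W)"
  note v = C.tangent_to_imp_vertical[OF z(1,3) W]
  note v' = C'.tangent_to_imp_vertical[OF z(1,3) W]
  have "\<Phi> (p, J) (canonical_structure A P D' (p, J) W) =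
      \<Phi> (p, J) (canonical_structure A P D (p, J) W) + (0, \<delta> ?X)"
    unfolding C.canonical_structure_in_chart[OF z(1) JP v] C'.canonical_structure_in_chart[OF z(1) JP v']
    by (simp add: \<delta>_def F_def x_def B_def matrix_distribs algebra_simps)
  then have "\<Phi> (p, J) (canonical_structure A P D' (p, J) W) =
      \<Phi> (p, J) (canonical_structure A P D (p, J) W)"
    by (simp add: \<delta>0 zero_prod_def[symmetric])
  then show ?thesis unfolding \<Phi>_eq_iff[OF z(1)] by simp
qed

end

lemma integrable_canonical_structure_unique:
  fixes A :: "('a::{t2_space,second_countable_topology}, real ^ 'm) chart set"
    and P :: "'a \<Rightarrow> (real ^ 'm ^ 'm) set"
  defines "Z \<equiv> \<lambda>e. {(p, J). J \<in> P p \<and> J ** J = e *\<^sub>R mat 1}"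
  assumes "smooth_manifold A" "CARD('m) \<ge> 4" "almost_para_quaternionic A P"
    and D: "D \<in> para_quaternionic_connections A P" "D' \<in> para_quaternionic_connections A P"
    and e: "e = -1 \<or> e = 1"
    and int: "integrable_structure (endo_atlas A) (Z e) (canonical_structure A P D)"
      "integrable_structure (endo_atlas A) (Z e) (canonical_structure A P D')"
    and z: "z \<in> Z e" and W: "W \<in> tangent_to (endo_atlas A) (Z e) z"
  shows "canonical_structure A P D z W = canonical_structure A P D' z W"
proof -
  interpret framed_manifold A by unfold_locales (rule assms(2))
  obtain p J where pJ: "z = (p, J)" by fastforce
  \<comment> \<open>The Lie bracket at \<open>z\<close> is defined in the chart chosen at \<open>z\<close>, so this chart is used.\<close>
  obtain c where hc: "c \<in> A" "chart_at (endo_atlas A) z = endo_chart A c"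
    using E.chart_at_in[of z] by (auto simp: endo_atlas_eq)
  have pc: "p \<in> cdom c" using E.in_chart_at[of z] hc(2) pJ by simp
  obtain V J1 J2 J3 where V: "open V" "p \<in> V" "admissible_local_basis A P V J1 J2 J3"
    using assms(4) unfolding almost_para_quaternionic_def by blast
  have "admissible_local_basis A P (V \<inter> cdom c) J1 J2 J3"
    using V(3) smooth_endo_subset[of V _ "V \<inter> cdom c"] unfolding admissible_local_basis_def by simp
  then interpret para_quaternionic_chart A P c "V \<inter> cdom c" J1 J2 J3
    by unfold_locales (auto intro: hc open_Int V open_cdom)
  have "Z e = para_quaternionic_chart.Z P e" unfolding assms(1) Z_def by simp
  then show ?thesis
    using canonical_structures_agree[OF D, of p J e W] V(2) pc hc(2) z W e int assms(3)
    unfolding pJ by simp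
qed

theorem corollary3p10:
  fixes A :: "('a::{t2_space,second_countable_topology}, real ^ 'm) chart set"
    and P :: "'a \<Rightarrow> (real ^ 'm ^ 'm) set"
    and n :: nat
  assumes "smooth_manifold A"
    and "n \<ge> 1" and "CARD('m) = 4 * n"
    and "almost_para_quaternionic A P"
  shows
    "(\<forall>D \<in> para_quaternionic_connections A P. \<forall>D' \<in> para_quaternionic_connections A P.
        integrable_structure (endo_atlas A) (twistor_space P) (canonical_structure A P D) \<longrightarrow>
        integrable_structure (endo_atlas A) (twistor_space P) (canonical_structure A P D') \<longrightarrow>
        (\<forall>z \<in> twistor_space P. \<forall>W \<in> tangent_to (endo_atlas A) (twistor_space P) z.
           canonical_structure A P D z W = canonical_structure A P D' z W)) \<and>
     (\<forall>D \<in> para_quaternionic_connections A P. \<forall>D' \<in> para_quaternionic_connections A P.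
        integrable_structure (endo_atlas A) (reflector_space P) (canonical_structure A P D) \<longrightarrow>
        integrable_structure (endo_atlas A) (reflector_space P) (canonical_structure A P D') \<longrightarrow>
        (\<forall>z \<in> reflector_space P. \<forall>W \<in> tangent_to (endo_atlas A) (reflector_space P) z.
           canonical_structure A P D z W = canonical_structure A P D' z W))"
proof -
  have dim: "CARD('m) \<ge> 4" using assms(2,3) by simp
  note unique = integrable_canonical_structure_unique[OF assms(1) dim assms(4)]
  have twistor: "twistor_space P = {(p, J). J \<in> P p \<and> J ** J = (-1) *\<^sub>R mat 1}"
    and reflector: "reflector_space P = {(p, J). J \<in> P p \<and> J ** J = 1 *\<^sub>R mat 1}"
    by (simp_all add: twistor_space_def reflector_space_def)
  show ?thesis
    unfolding twistor reflector
  proof (intro conjI ballI impI, goal_cases)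
    case (1 D D' z W)
    show ?case by (rule unique[OF 1(1,2) _ 1(3-6)]) simp
  next
    case (2 D D' z W)
    show ?case by (rule unique[OF 2(1,2) _ 2(3-6)]) simp
  qed
qed

end
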